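(* Let $N\geq 2$, $R>0$, and let $\Omega=B_R\subset\mathbb{R}^N$ be the open ball of radius $R$ centered at the origin. Assume $1<p<\infty$, $m,q>0$, $0\leq \alpha<p-1$, $0\leq \beta\leq m$ and $\delta:=(p-1-\alpha)(p-1-\beta)-qm\neq 0$. Consider the system $$\Delta_p u=v^{m}|\nabla u|^{\alpha},\qquad \Delta_p v=v^{\beta}|\nabla u|^{q}\qquad\text{in }B_R. \tag{S}$$ Then: (i) There are no non-constant positive radial solutions $(u,v)$ of (S) with $u(R^-)=\infty$ and $v(R^-)<\infty$. (ii) All non-constant positive radial solutions of (S) are bounded if and only if $mq<(p-1-\alpha)(p-1-\beta)$. (iii) There are non-constant positive radial solutions $(u,v)$ of (S) with $u(R^-)<\infty$ and $v(R^-)=\infty$ if and only if $mq>mp+(p-\alpha)(p-1-\beta)$. (iv) There are non-constant positive radial solutions $(u,v)$ of (S) with $u(R^-)=v(R^-)=\infty$ if and only if $(p-1-\alpha)(p-1-\beta)<mq\leq mp+(p-\alpha)(p-1-\beta)$.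
   Context: $\Delta_p u=\mathrm{div}(|\nabla u|^{p-2}\nabla u)$ is the $p$-Laplace operator. A non-constant positive radial solution of the system in $\Omega$ is a pair $(u,v)$ such that $u,v\in C^2(\Omega)$ are positive and radially symmetric, $u$ and $v$ are not constant in any neighbourhood of the origin, and $u,v$ satisfy the system in $\Omega$. Radial functions are identified with functions of one variable: $u(x)=u(r)$, $v(x)=v(r)$, $r=|x|$. For $f:(0,R)\to\mathbb{R}$, $f(R^-)=\lim_{r\nearrow R}f(r)$, provided the limit exists.
   Formalization: Solutions are required to be C² in the ball only if p ≤ 2+α and (p−2)(p−1−α) ≤ q; otherwise, where no C² solution exists and the claim would fail (e.g. p=3, α=β=0, m=1, q=5), they are C¹ in the ball and C² away from the origin. *)

theory Defs
  imports "HOL-Analysis.Analysis"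
begin

definition grad :: "('a::euclidean_space \<Rightarrow> real) \<Rightarrow> 'a \<Rightarrow> 'a" where
  "grad f x = (THE D. GDERIV f x :> D)"

definition divergence :: "('a::euclidean_space \<Rightarrow> 'a) \<Rightarrow> 'a \<Rightarrow> real" where
  "divergence F x = (\<Sum>b\<in>Basis. frechet_derivative F (at x) b \<bullet> b)"

text \<open>
  The power \<open>t\<^sup>a\<close> of a number \<open>t \<ge> 0\<close>, with \<open>0\<^sup>0 = 1\<close>: in contrast, \<open>0 powr 0 = 0\<close>, which would be
  wrong for \<open>|\<nabla>u|\<^sup>\<alpha>\<close> with \<open>\<alpha> = 0\<close> at a critical point of \<open>u\<close>.
\<close>

definition npow :: "real \<Rightarrow> real \<Rightarrow> real" where
  "npow t a = (if a = 0 then 1 else t powr a)"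

text \<open>
  Where the gradient vanishes, the flux \<open>|\<nabla>u|\<^sup>p\<^sup>-\<^sup>2\<nabla>u\<close> is \<open>0\<close> for every \<open>p\<close>; for \<open>1 < p < 2\<close> this is its
  continuous extension.
\<close>

definition p_flux :: "real \<Rightarrow> ('a::euclidean_space \<Rightarrow> real) \<Rightarrow> 'a \<Rightarrow> 'a" where
  "p_flux p u x = npow (norm (grad u x)) (p - 2) *\<^sub>R grad u x"

definition p_laplacian :: "real \<Rightarrow> ('a::euclidean_space \<Rightarrow> real) \<Rightarrow> 'a \<Rightarrow> real" where
  "p_laplacian p u x = divergence (p_flux p u) x"

definition C1_on :: "'a::euclidean_space set \<Rightarrow> ('a \<Rightarrow> real) \<Rightarrow> bool" where
  "C1_on S f \<longleftrightarrow> (\<forall>x\<in>S. f differentiable (at x)) \<and> continuous_on S (grad f)"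

definition C2_on :: "'a::euclidean_space set \<Rightarrow> ('a \<Rightarrow> real) \<Rightarrow> bool" where
  "C2_on S f \<longleftrightarrow> C1_on S f \<and>
     (\<exists>H :: 'a \<Rightarrow> 'a \<Rightarrow>\<^sub>L 'a. continuous_on S H \<and>
        (\<forall>x\<in>S. (grad f has_derivative blinfun_apply (H x)) (at x)))"

definition radial_on :: "'a::euclidean_space set \<Rightarrow> ('a \<Rightarrow> real) \<Rightarrow> bool" where
  "radial_on S f \<longleftrightarrow> (\<forall>x\<in>S. \<forall>y\<in>S. norm x = norm y \<longrightarrow> f x = f y)"

text \<open>
  The function of one variable \<open>r = |x|\<close> identified with a radial function. It is meaningful
  for \<open>r\<close> such that the sphere of radius \<open>r\<close> lies in the domain on which the function is radial.
\<close>

definition radial_profile :: "('a::euclidean_space \<Rightarrow> real) \<Rightarrow> real \<Rightarrow> real" where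
  "radial_profile f r = (THE c. \<forall>x. norm x = r \<longrightarrow> f x = c)"

definition infinite_at_boundary :: "real \<Rightarrow> ('a::euclidean_space \<Rightarrow> real) \<Rightarrow> bool" where
  "infinite_at_boundary R f \<longleftrightarrow> filterlim (radial_profile f) at_top (at_left R)"

definition finite_at_boundary :: "real \<Rightarrow> ('a::euclidean_space \<Rightarrow> real) \<Rightarrow> bool" where
  "finite_at_boundary R f \<longleftrightarrow> (\<exists>L. (radial_profile f \<longlongrightarrow> L) (at_left R))"

text \<open>
  Regularity of solutions on a domain \<open>\<Omega>\<close> containing the origin. A radial solution that is not
  constant near the origin satisfies, as \<open>r \<rightarrow> 0\<close>,

    \<open>u'(r) \<sim> c r\<^sup>k\<close> with \<open>k = 1/(p-1-\<alpha>)\<close> and \<open>v'(r) \<sim> d r\<^sup>l\<close> with \<open>l = (1+kq)/(p-1)\<close>, where \<open>c, d > 0\<close>.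

  The condition below says \<open>k \<ge> 1\<close> and \<open>l \<ge> 1\<close> (it holds in particular if \<open>p \<le> 2\<close>), and then the
  solutions are of class \<open>C\<^sup>2\<close> in \<open>\<Omega>\<close>, as required. If \<open>k < 1\<close> or \<open>l < 1\<close>, the second derivative of
  \<open>u\<close> or \<open>v\<close> is unbounded at the origin, so that no pair at all would be a \<open>C\<^sup>2(\<Omega>)\<close> solution: for
  instance, if \<open>p > 2\<close> and \<open>\<alpha> = 0\<close> then \<open>|\<nabla>u|\<^sup>p\<^sup>-\<^sup>1 = O(|x|\<^sup>p\<^sup>-\<^sup>1)\<close> would give \<open>\<Delta>\<^sub>p u(0) = 0 < v(0)\<^sup>m\<close>.
  In this range the \<open>C\<^sup>2\<close> requirement is kept away from the origin, and \<open>C\<^sup>1\<close> is required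
  across it.
\<close>

definition solution_regularity ::
    "real \<Rightarrow> real \<Rightarrow> real \<Rightarrow> 'a::euclidean_space set \<Rightarrow> ('a \<Rightarrow> real) \<Rightarrow> bool" where
  "solution_regularity p q \<alpha> \<Omega> f \<longleftrightarrow>
     (if p \<le> 2 + \<alpha> \<and> (p - 2) * (p - 1 - \<alpha>) \<le> q
      then C2_on \<Omega> f
      else C1_on \<Omega> f \<and> C2_on (\<Omega> - {0}) f)"

definition nonconst_pos_radial_sol ::
    "real \<Rightarrow> real \<Rightarrow> real \<Rightarrow> real \<Rightarrow> real \<Rightarrow> 'a::euclidean_space set
      \<Rightarrow> ('a \<Rightarrow> real) \<Rightarrow> ('a \<Rightarrow> real) \<Rightarrow> bool" where
  "nonconst_pos_radial_sol p m q \<alpha> \<beta> \<Omega> u v \<longleftrightarrow>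
     solution_regularity p q \<alpha> \<Omega> u \<and> solution_regularity p q \<alpha> \<Omega> v \<and>
     (\<forall>x\<in>\<Omega>. u x > 0 \<and> v x > 0) \<and>
     radial_on \<Omega> u \<and> radial_on \<Omega> v \<and>
     (\<forall>U. open U \<and> 0 \<in> U \<and> U \<subseteq> \<Omega> \<longrightarrow> \<not> u constant_on U \<and> \<not> v constant_on U) \<and>
     (\<forall>x\<in>\<Omega>. p_flux p u differentiable (at x) \<and>
             p_laplacian p u x = npow (v x) m * npow (norm (grad u x)) \<alpha>) \<and>
     (\<forall>x\<in>\<Omega>. p_flux p v differentiable (at x) \<and>
             p_laplacian p v x = npow (v x) \<beta> * npow (norm (grad u x)) q)"

end

theory Submission
  imports Defs
begin

text \<open>
  A non-constant positive radial solution satisfies \<open>u' > 0\<close> and \<open>v' > 0\<close> for \<open>0 < r < R\<close>, and in the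
  unknowns \<open>w = (u')\<^sup>\<kappa>\<close> with \<open>\<kappa> = p - 1 - \<alpha>\<close>, and \<open>z = (v')\<^sup>p\<^sup>-\<^sup>1\<close>, the system becomes

    \<open>w' + (A/r) w = c v\<^sup>m\<close>,   \<open>z' + (B/r) z = v\<^sup>\<beta> w\<^sup>\<sigma>\<close>,   \<open>v' = z\<^sup>1\<^sup>/\<^sup>(\<^sup>p\<^sup>-\<^sup>1\<^sup>)\<close>

  with \<open>B = N - 1\<close>, \<open>c = \<kappa>/(p-1)\<close>, \<open>A = B c\<close>, \<open>\<sigma> = q/\<kappa>\<close>. The right-hand sides increase with \<open>r\<close>, so that
  the damping terms take away only a fixed fraction of them: \<open>w' \<approx> v\<^sup>m\<close> and \<open>z' \<approx> v\<^sup>\<beta> w\<^sup>\<sigma>\<close> up to constant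
  factors (lemma \<open>damped_derivative_lower_bound\<close>).

  The core is a two-sided estimate \<open>k w\<^sup>\<Theta> \<le> v\<^sup>m \<le> C (1+w)\<^sup>\<Theta>\<close> with \<open>\<Theta> = m(\<sigma>+p)/(mp+p-1-\<beta>)\<close> (lemmas
  \<open>v_power_ge\<close> and \<open>v_power_le\<close>). The upper bound for \<open>v\<close> comes from the energy identity, that is from multiplying the equation
  for \<open>z\<close> by \<open>v'\<close>. The lower bound comes from \<open>z \<ge> K v\<^sup>\<beta>\<^sup>-\<^sup>m w\<^sup>\<sigma>\<^sup>+\<^sup>1\<close>, which is the integrated form of an
  inequality between derivatives; the assumption \<open>\<beta> \<le> m\<close> gives the sign of one term there. Hence
  \<open>w' \<approx> w\<^sup>\<Theta>\<close> where \<open>w\<close> is large, and everything about the boundary behaviour can be read off from this scalar relation: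

    \<^item> if \<open>\<Theta> \<le> 1\<close>, no blow-up occurs, and \<open>\<Theta> > 1\<close> is equivalent to \<open>mq > (p-1-\<alpha>)(p-1-\<beta>)\<close>;

    \<^item> if \<open>\<Theta> > 1\<close>, the life span is finite, with a bound depending on one value of \<open>w\<close> only;

    \<^item> since \<open>u' = w\<^sup>1\<^sup>/\<^sup>\<kappa>\<close>, one has \<open>du/dw \<approx> w\<^sup>1\<^sup>/\<^sup>\<kappa>\<^sup>-\<^sup>\<Theta>\<close>, so that \<open>u\<close> stays bounded while \<open>w \<rightarrow> \<infinity>\<close> exactly if
      \<open>\<Theta> - 1 > 1/\<kappa>\<close>, which is equivalent to \<open>mq > mp + (p-\<alpha>)(p-1-\<beta>)\<close>.

  For existence, the integral equation for \<open>v\<close> is monotone, and Picard iteration from the constant \<open>1\<close>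
  increases to its minimal solution (lemma \<open>exists_blowup_solution\<close>). That solution lives until it
  becomes infinite, in finite time if \<open>\<Theta> > 1\<close>, and scaling moves the blow-up radius to \<open>R\<close>. What remains is the
  passage between the ball and the interval: a radial field \<open>G(|x|) x/|x|\<close> is differentiated by hand,
  and the regularity at the origin follows from the exact asymptotics of \<open>w\<close> and \<open>z\<close> as \<open>r \<rightarrow> 0\<close>.
\<close>

section \<open>The radial system and its two-sided estimates\<close>

lemma eventually_at_right_0_less: "0 < (R::real) \<Longrightarrow> \<forall>\<^sub>F r in at_right 0. 0 < r \<and> r < R"
  unfolding eventually_at_right_field by auto

lemma tendsto_powr_zero_at_right:
  fixes a :: real
  assumes "0 < a"
  shows "((\<lambda>t. t powr a) \<longlongrightarrow> 0) (at_right 0)"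
  by (rule tendsto_zero_powrI[OF tendsto_ident_at tendsto_const _ assms])
    (auto simp: eventually_at_right_field intro: exI[of _ 1])

text \<open>
  The tool for integrating differential inequalities from the origin. The singular point \<open>0\<close> enters
  through a limit, since the coefficients \<open>A/r\<close> and \<open>B/r\<close> leave no derivative there.
\<close>

lemma limit_at_0_le_of_deriv_nonneg:
  fixes h h' :: "real \<Rightarrow> real"
  assumes der: "\<And>t. 0 < t \<Longrightarrow> t \<le> r \<Longrightarrow> (h has_real_derivative h' t) (at t)"
    and nonneg: "\<And>t. 0 < t \<Longrightarrow> t \<le> r \<Longrightarrow> 0 \<le> h' t"
    and lim: "(h \<longlongrightarrow> L) (at_right 0)" and r: "0 < r"
  shows "L \<le> h r"
proof (rule tendsto_upperbound[OF lim])
  have "h t \<le> h r" if "0 < t" "t < r" for t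
    using that by (intro DERIV_nonneg_imp_nondecreasing[where f = h])
      (auto intro!: exI[where x = "h' _"] der nonneg)
  then show "\<forall>\<^sub>F t in at_right 0. h t \<le> h r"
    unfolding eventually_at_right_field using r by (intro exI[of _ r]) auto
qed simp

text \<open>
  If the source \<open>h\<close> has its largest value at the end point, then \<open>(t\<^sup>A y)' = t\<^sup>A h \<le> t\<^sup>A h(r)\<close> integrates to
  \<open>y(r) \<le> r h(r)/(A+1)\<close>. So the damping \<open>A y/r\<close> uses up at most the fraction \<open>A/(A+1)\<close> of the source.
\<close>

lemma damped_derivative_lower_bound:
  fixes y h :: "real \<Rightarrow> real"
  assumes A: "0 < A" and r: "0 < r"
    and der: "\<And>t. 0 < t \<Longrightarrow> t \<le> r \<Longrightarrow> (y has_real_derivative h t - A / t * y t) (at t)"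
    and mono: "\<And>t. 0 < t \<Longrightarrow> t \<le> r \<Longrightarrow> h t \<le> h r"
    and lim: "(y \<longlongrightarrow> 0) (at_right 0)"
  shows "h r / (A + 1) \<le> h r - A / r * y r"
proof -
  define g where "g = (\<lambda>t. t powr (A + 1) * (h r / (A + 1)) - t powr A * y t)"
  have "0 \<le> g r"
  proof (rule limit_at_0_le_of_deriv_nonneg[OF _ _ _ r])
    fix t assume t: "0 < t" "t \<le> r"
    have "(g has_real_derivative (A + 1) * t powr (A + 1 - 1) * (h r / (A + 1))
        - (A * t powr (A - 1) * y t + (h t - A / t * y t) * t powr A)) (at t)"
      unfolding g_def using t by (intro DERIV_diff DERIV_mult DERIV_cmult_right has_real_derivative_powr der) auto
    moreover have "(A + 1) * x * (h r / (A + 1)) = x * h r" "t powr (A - 1) = t powr A / t" for x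
      using t A by (simp_all add: powr_diff)
    ultimately show "(g has_real_derivative t powr A * (h r - h t)) (at t)"
      using t by (simp add: right_diff_distrib left_diff_distrib mult.commute)
    show "0 \<le> t powr A * (h r - h t)" using mono[OF t] by simp
  next
    have "(g \<longlongrightarrow> 0 * (h r / (A + 1)) - 0 * 0) (at_right 0)"
      unfolding g_def using A by (intro tendsto_intros lim tendsto_powr_zero_at_right) auto
    then show "(g \<longlongrightarrow> 0) (at_right 0)" by simp
  qed
  then have "r powr A * y r \<le> r powr A * (r * (h r / (A + 1)))"
    unfolding g_def using r by (simp add: powr_add algebra_simps)
  then have "y r \<le> r * (h r / (A + 1))" using r by (simp only: mult_le_cancel_left_pos powr_gt_zero)
  then have "A / r * y r \<le> A / r * (r * (h r / (A + 1)))" using A r by (intro mult_left_mono) auto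
  also have "\<dots> = A * (h r / (A + 1))" using r by simp
  also have "\<dots> = h r - h r / (A + 1)" using A by (simp add: field_simps)
  finally show ?thesis by simp
qed

locale radial_system =
  fixes A B c m \<beta> \<sigma> p :: real
  assumes A_pos: "0 < A" and B_pos: "0 < B" and c_pos: "0 < c" and m_pos: "0 < m"
    and beta_nonneg: "0 \<le> \<beta>" and beta_le: "\<beta> \<le> m" and sigma_pos: "0 < \<sigma>" and p_gt: "1 < p"
begin

text \<open>
  The exponent \<open>\<Theta>\<close> in \<open>w' \<approx> w\<^sup>\<Theta>\<close>. It is what remains of \<open>v\<^sup>m\<close> once \<open>v\<close> is expressed by \<open>w\<close> according to the scaling
  of the system.
\<close>

definition "critical_exp = m * (\<sigma> + p) / (m * p + p - 1 - \<beta>)"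

lemma denom_pos: "0 < m * p + p - 1 - \<beta>"
proof -
  have "0 < m * (p - 1)" using m_pos p_gt by simp
  then show ?thesis using beta_le p_gt by (simp add: algebra_simps)
qed

text \<open>
  Constants of the lower bounds. They are explicit because the life span must be bounded uniformly over
  all intervals on which a solution exists.
\<close>

definition "z_rate = 1 / ((B + 1) * c * (\<sigma> + 1))"
definition "v_rate = (m * p + p - 1 - \<beta>) / (p - 1) * z_rate powr (1 / (p - 1)) / c / ((\<sigma> + p) / (p - 1))"
definition "w_rate = c / (A + 1) * v_rate powr (m / ((m * p + p - 1 - \<beta>) / (p - 1)))"

lemma z_rate_pos: "0 < z_rate"
  unfolding z_rate_def using B_pos c_pos sigma_pos by simp

lemma v_rate_pos: "0 < v_rate"
  unfolding v_rate_def using z_rate_pos c_pos p_gt sigma_pos denom_pos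
  by (intro divide_pos_pos mult_pos_pos) auto

lemma w_rate_pos: "0 < w_rate"
  unfolding w_rate_def using v_rate_pos c_pos A_pos by simp

lemma critical_exp_pos: "0 < critical_exp"
  unfolding critical_exp_def using denom_pos m_pos sigma_pos p_gt by simp

end

text \<open>
  The values \<open>w 0\<close> and \<open>z 0\<close> are left open, while \<open>v 0\<close> is the initial value of \<open>v\<close>.
\<close>

locale radial_solution = radial_system +
  fixes R :: real and w z v :: "real \<Rightarrow> real"
  assumes R_pos: "0 < R"
    and w_pos: "\<And>r. 0 < r \<Longrightarrow> r < R \<Longrightarrow> 0 < w r"
    and z_pos: "\<And>r. 0 < r \<Longrightarrow> r < R \<Longrightarrow> 0 < z r"
    and v_pos: "\<And>r. 0 < r \<Longrightarrow> r < R \<Longrightarrow> 0 < v r"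
    and dw: "\<And>r. 0 < r \<Longrightarrow> r < R \<Longrightarrow>
      (w has_real_derivative c * v r powr m - A / r * w r) (at r)"
    and dz: "\<And>r. 0 < r \<Longrightarrow> r < R \<Longrightarrow>
      (z has_real_derivative v r powr \<beta> * w r powr \<sigma> - B / r * z r) (at r)"
    and dv: "\<And>r. 0 < r \<Longrightarrow> r < R \<Longrightarrow>
      (v has_real_derivative z r powr (1 / (p - 1))) (at r)"
    and w0: "(w \<longlongrightarrow> 0) (at_right 0)" and z0: "(z \<longlongrightarrow> 0) (at_right 0)"
    and v0: "(v \<longlongrightarrow> v 0) (at_right 0)" and v0_pos: "0 < v 0"
begin

abbreviation "w' r \<equiv> c * v r powr m - A / r * w r"
abbreviation "z' r \<equiv> v r powr \<beta> * w r powr \<sigma> - B / r * z r"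

lemma w_powr_tendsto_0: "0 < e \<Longrightarrow> ((\<lambda>r. w r powr e) \<longlongrightarrow> 0) (at_right 0)"
  by (rule tendsto_zero_powrI[OF w0 tendsto_const])
    (use eventually_at_right_0_less[OF R_pos] in \<open>auto elim!: eventually_mono intro: less_imp_le w_pos\<close>)

lemma z_powr_tendsto_0: "0 < e \<Longrightarrow> ((\<lambda>r. z r powr e) \<longlongrightarrow> 0) (at_right 0)"
  by (rule tendsto_zero_powrI[OF z0 tendsto_const])
    (use eventually_at_right_0_less[OF R_pos] in \<open>auto elim!: eventually_mono intro: less_imp_le z_pos\<close>)

lemma v_mono: "0 < s \<Longrightarrow> s \<le> r \<Longrightarrow> r < R \<Longrightarrow> v s \<le> v r"
proof (rule DERIV_nonneg_imp_nondecreasing[where f = v])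
  fix t assume "0 < s" "s \<le> t" "t \<le> r" "r < R"
  then show "\<exists>y. (v has_real_derivative y) (at t) \<and> 0 \<le> y"
    using dv[of t] by (intro exI[of _ "z t powr (1 / (p - 1))"]) auto
qed

lemma w'_le: "0 < r \<Longrightarrow> r < R \<Longrightarrow> w' r \<le> c * v r powr m"
  using A_pos w_pos[of r] by simp

lemma w'_ge:
  assumes "0 < r" "r < R"
  shows "c * v r powr m / (A + 1) \<le> w' r"
proof (rule damped_derivative_lower_bound[OF A_pos assms(1)])
  fix t assume t: "0 < t" "t \<le> r"
  then show "(w has_real_derivative w' t) (at t)" using dw assms by simp
  show "c * v t powr m \<le> c * v r powr m"
    using t v_mono[of t r] v_pos[of t] assms c_pos m_pos by (simp add: powr_mono2)
qed (rule w0)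

lemma w'_pos: "0 < r \<Longrightarrow> r < R \<Longrightarrow> 0 < w' r"
  using A_pos c_pos v_pos[of r] by (intro less_le_trans[OF _ w'_ge]) auto

lemma w_mono:
  assumes "0 < s" "s \<le> r" "r < R"
  shows "w s \<le> w r"
proof (rule DERIV_nonneg_imp_nondecreasing[OF assms(2)])
  fix t assume "s \<le> t" "t \<le> r"
  then show "\<exists>y. (w has_real_derivative y) (at t) \<and> 0 \<le> y"
    using dw[of t] w'_pos[of t] assms by (intro exI[of _ "w' t"]) auto
qed

lemma z'_ge:
  assumes "0 < r" "r < R"
  shows "v r powr \<beta> * w r powr \<sigma> / (B + 1) \<le> z' r"
proof (rule damped_derivative_lower_bound[OF B_pos assms(1)])
  fix t assume t: "0 < t" "t \<le> r"
  then show "(z has_real_derivative z' t) (at t)" using dz assms by simp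
  show "v t powr \<beta> * w t powr \<sigma> \<le> v r powr \<beta> * w r powr \<sigma>"
    using t v_mono[of t r] w_mono[of t r] w_pos[of t] v_pos[of t] assms sigma_pos beta_nonneg
    by (intro mult_mono powr_mono2) auto
qed (rule z0)

lemma z'_le: "0 < r \<Longrightarrow> r < R \<Longrightarrow> z' r \<le> v r powr \<beta> * w r powr \<sigma>"
  using B_pos z_pos[of r] by simp

text \<open>
  The energy estimate: \<open>(z\<^sup>p\<^sup>/\<^sup>(\<^sup>p\<^sup>-\<^sup>1\<^sup>))'\<close> is a multiple of \<open>z' v'\<close>, which is at most \<open>v\<^sup>\<beta> v' w\<^sup>\<sigma>\<close>, and on \<open>(0,r]\<close> the
  factor \<open>w\<^sup>\<sigma>\<close> is at most its value at \<open>r\<close>. The rest is the derivative of \<open>v\<^sup>\<beta>\<^sup>+\<^sup>1/(\<beta>+1)\<close>.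
\<close>

lemma z_power_le:
  assumes r: "0 < r" "r < R"
  shows "(p - 1) / p * z r powr (p / (p - 1)) \<le> w r powr \<sigma> * v r powr (\<beta> + 1) / (\<beta> + 1)"
proof -
  define h where "h = (\<lambda>t. w r powr \<sigma> * v t powr (\<beta> + 1) / (\<beta> + 1)
                            - (p - 1) / p * z t powr (p / (p - 1)))"
  have "w r powr \<sigma> * v 0 powr (\<beta> + 1) / (\<beta> + 1) - (p - 1) / p * 0 \<le> h r"
  proof (rule limit_at_0_le_of_deriv_nonneg[OF _ _ _ r(1)])
    fix t assume t: "0 < t" "t \<le> r"
    then have pos: "0 < w t" "0 < z t" "0 < v t" using r w_pos z_pos v_pos by auto
    have e: "p / (p - 1) - 1 = 1 / (p - 1)" using p_gt by (simp add: field_simps)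
    have "((\<lambda>t. z t powr (p / (p - 1))) has_real_derivative
        p / (p - 1) * z t powr (p / (p - 1) - 1) * z' t) (at t)"
      using DERIV_fun_powr[OF dz, of t "p / (p - 1)"] t r pos by simp
    moreover have "((\<lambda>t. v t powr (\<beta> + 1)) has_real_derivative
        (\<beta> + 1) * v t powr \<beta> * z t powr (1 / (p - 1))) (at t)"
      using DERIV_fun_powr[OF dv, of t "\<beta> + 1"] t r pos by simp
    ultimately have "(h has_real_derivative
        w r powr \<sigma> * ((\<beta> + 1) * v t powr \<beta> * z t powr (1 / (p - 1))) / (\<beta> + 1)
        - (p - 1) / p * (p / (p - 1) * z t powr (1 / (p - 1)) * z' t)) (at t)"
      unfolding h_def e by (intro DERIV_diff DERIV_cmult DERIV_cdivide)
    moreover have "w r powr \<sigma> * ((\<beta> + 1) * v t powr \<beta> * z t powr (1 / (p - 1))) / (\<beta> + 1)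
        - (p - 1) / p * (p / (p - 1) * z t powr (1 / (p - 1)) * z' t)
        = z t powr (1 / (p - 1)) * (v t powr \<beta> * w r powr \<sigma> - z' t)"
    proof -
      have "a * ((\<beta> + 1) * b * d) / (\<beta> + 1) - (p - 1) / p * (p / (p - 1) * d * e) = d * (b * a - e)"
        for a b d e
      proof -
        have 1: "a * ((\<beta> + 1) * b * d) / (\<beta> + 1) = a * (b * d)"
          and 2: "(p - 1) / p * (p / (p - 1) * d * e) = d * e"
          using p_gt beta_nonneg by simp_all
        show ?thesis unfolding 1 2 by (simp add: algebra_simps)
      qed
      then show ?thesis .
    qed
    ultimately show "(h has_real_derivative
        z t powr (1 / (p - 1)) * (v t powr \<beta> * w r powr \<sigma> - z' t)) (at t)" by metis
    have "z' t \<le> v t powr \<beta> * w t powr \<sigma>" using z'_le t r by simp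
    also have "\<dots> \<le> v t powr \<beta> * w r powr \<sigma>"
      using w_mono[of t r] t r pos sigma_pos by (intro mult_left_mono powr_mono2) auto
    finally show "0 \<le> z t powr (1 / (p - 1)) * (v t powr \<beta> * w r powr \<sigma> - z' t)" by simp
  next
    show "(h \<longlongrightarrow> w r powr \<sigma> * v 0 powr (\<beta> + 1) / (\<beta> + 1) - (p - 1) / p * 0) (at_right 0)"
      unfolding h_def
      by (intro tendsto_intros v0 z_powr_tendsto_0)
        (use v0_pos p_gt beta_nonneg in auto)
  qed
  moreover have "0 \<le> w r powr \<sigma> * v 0 powr (\<beta> + 1) / (\<beta> + 1)" using beta_nonneg by simp
  ultimately show ?thesis unfolding h_def by simp
qed

lemma v'_le:
  "\<exists>C>0. \<forall>r. 0 < r \<and> r < R \<longrightarrow>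
     z r powr (1 / (p - 1)) \<le> C * (w r powr (\<sigma> / p) * v r powr ((\<beta> + 1) / p))"
proof (intro exI conjI allI impI)
  let ?K = "p / ((p - 1) * (\<beta> + 1))"
  show "0 < ?K powr (1 / p)" using p_gt beta_nonneg by simp
  fix r assume "0 < r \<and> r < R"
  then have r: "0 < r" "r < R" by auto
  have pos: "0 < w r" "0 < z r" "0 < v r" using r w_pos z_pos v_pos by auto
  have "z r powr (p / (p - 1)) \<le> ?K * (w r powr \<sigma> * v r powr (\<beta> + 1))"
    using mult_left_mono[OF z_power_le[OF r], of "p / (p - 1)"] p_gt beta_nonneg by simp
  then have "(z r powr (p / (p - 1))) powr (1 / p)
      \<le> (?K * (w r powr \<sigma> * v r powr (\<beta> + 1))) powr (1 / p)"
    using p_gt by (intro powr_mono2) auto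
  also have "(z r powr (p / (p - 1))) powr (1 / p) = z r powr (1 / (p - 1))"
    using p_gt by (simp add: powr_powr)
  also have "(?K * (w r powr \<sigma> * v r powr (\<beta> + 1))) powr (1 / p)
      = ?K powr (1 / p) * (w r powr (\<sigma> / p) * v r powr ((\<beta> + 1) / p))"
    using p_gt beta_nonneg pos by (simp only: powr_mult powr_powr) simp
  finally show "z r powr (1 / (p - 1)) \<le> ?K powr (1 / p) * (w r powr (\<sigma> / p) * v r powr ((\<beta> + 1) / p))" .
qed

text \<open>
  Dividing the energy estimate by \<open>w' \<ge> c v\<^sup>m/(A+1)\<close> separates the variables: the derivative of the power of
  \<open>v\<close> is at most a constant times \<open>w\<^sup>\<sigma>\<^sup>/\<^sup>p w'\<close>. The exponent \<open>(mp+p-1-\<beta>)/p\<close> is positive thanks to \<open>\<beta> \<le> m\<close>.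
\<close>

lemma v_power_le:
  "\<exists>C>0. \<forall>r. 0 < r \<and> r < R \<longrightarrow>
     v r powr ((m * p + p - 1 - \<beta>) / p) \<le> C * (1 + w r) powr ((\<sigma> + p) / p)"
proof -
  let ?\<kappa> = "(m * p + p - 1 - \<beta>) / p"
  obtain C where C: "0 < C" and v': "\<And>r. 0 < r \<Longrightarrow> r < R \<Longrightarrow>
     z r powr (1 / (p - 1)) \<le> C * (w r powr (\<sigma> / p) * v r powr ((\<beta> + 1) / p))"
    using v'_le by blast
  have \<kappa>: "0 < ?\<kappa>" using denom_pos p_gt by simp
  \<comment> \<open>The factor that makes the derivative of \<open>D w\<^sup>\<sigma>\<^sup>/\<^sup>p\<^sup>+\<^sup>1\<close> dominate that of the power of \<open>v\<close>.\<close>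
  define D where "D = ?\<kappa> * C * (A + 1) / c / (\<sigma> / p + 1)"
  have D: "0 < D" unfolding D_def using C A_pos c_pos sigma_pos p_gt denom_pos
    by (intro divide_pos_pos mult_pos_pos) (auto simp: add_pos_pos)
  have main: "v r powr ?\<kappa> \<le> v 0 powr ?\<kappa> + D * w r powr (\<sigma> / p + 1)" if r: "0 < r" "r < R" for r
  proof -
    define h where "h = (\<lambda>t. D * w t powr (\<sigma> / p + 1) - v t powr ?\<kappa>)"
    have "D * 0 - v 0 powr ?\<kappa> \<le> h r"
    proof (rule limit_at_0_le_of_deriv_nonneg[OF _ _ _ r(1)])
      fix t assume t: "0 < t" "t \<le> r"
      then have tR: "t < R" using r by simp
      have pos: "0 < w t" "0 < z t" "0 < v t" using t tR w_pos z_pos v_pos by auto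
      show "(h has_real_derivative D * ((\<sigma> / p + 1) * w t powr (\<sigma> / p + 1 - 1) * w' t)
           - ?\<kappa> * v t powr (?\<kappa> - 1) * z t powr (1 / (p - 1))) (at t)"
        unfolding h_def
        using DERIV_fun_powr[OF dw, of t "\<sigma> / p + 1"] DERIV_fun_powr[OF dv, of t ?\<kappa>] t tR pos
        by (intro DERIV_diff DERIV_cmult) auto
      have "?\<kappa> * v t powr (?\<kappa> - 1) * z t powr (1 / (p - 1))
          \<le> ?\<kappa> * v t powr (?\<kappa> - 1) * (C * (w t powr (\<sigma> / p) * v t powr ((\<beta> + 1) / p)))"
        using v'[OF t(1) tR] denom_pos p_gt by (intro mult_left_mono) auto
      also have "\<dots> = ?\<kappa> * C * w t powr (\<sigma> / p) * (v t powr (?\<kappa> - 1) * v t powr ((\<beta> + 1) / p))"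
        by (simp add: mult_ac)
      also have "v t powr (?\<kappa> - 1) * v t powr ((\<beta> + 1) / p) = v t powr m"
      proof -
        have "?\<kappa> - 1 + (\<beta> + 1) / p = m" using p_gt by (simp add: field_simps)
        then show ?thesis by (simp flip: powr_add)
      qed
      also have "?\<kappa> * C * w t powr (\<sigma> / p) * v t powr m
          = ?\<kappa> * C * (A + 1) / c * w t powr (\<sigma> / p) * (c * v t powr m / (A + 1))"
        using A_pos c_pos by simp
      also have "\<dots> \<le> ?\<kappa> * C * (A + 1) / c * w t powr (\<sigma> / p) * w' t"
        using w'_ge[OF t(1) tR] denom_pos p_gt C A_pos c_pos by (intro mult_left_mono) auto
      also have "?\<kappa> * C * (A + 1) / c = D * (\<sigma> / p + 1)"
      proof -
        have "0 < \<sigma> / p + 1" using sigma_pos p_gt by (simp add: add_pos_pos)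
        moreover have "x = x / y * y" if "0 < y" for x y :: real using that by simp
        ultimately show ?thesis unfolding D_def by blast
      qed
      finally show "0 \<le> D * ((\<sigma> / p + 1) * w t powr (\<sigma> / p + 1 - 1) * w' t)
           - ?\<kappa> * v t powr (?\<kappa> - 1) * z t powr (1 / (p - 1))"
        by (simp add: mult_ac)
    next
      show "(h \<longlongrightarrow> D * 0 - v 0 powr ?\<kappa>) (at_right 0)"
        unfolding h_def
        by (intro tendsto_intros v0 w_powr_tendsto_0)
        (use v0_pos p_gt sigma_pos in \<open>auto simp: add_pos_pos\<close>)
    qed
    then show ?thesis unfolding h_def by simp
  qed
  show ?thesis
  proof (intro exI[of _ "v 0 powr ?\<kappa> + D"] conjI allI impI)
    show "0 < v 0 powr ?\<kappa> + D" using v0_pos D by (simp add: add_pos_pos)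
    fix r assume "0 < r \<and> r < R"
    then have r: "0 < r" "r < R" by auto
    have e: "\<sigma> / p + 1 = (\<sigma> + p) / p" using p_gt by (simp add: field_simps)
    have nn: "0 \<le> (\<sigma> + p) / p" using sigma_pos p_gt by simp
    have "v r powr ?\<kappa> \<le> v 0 powr ?\<kappa> * 1 + D * w r powr ((\<sigma> + p) / p)"
      using main[OF r] unfolding e by simp
    also have "\<dots> \<le> v 0 powr ?\<kappa> * (1 + w r) powr ((\<sigma> + p) / p) + D * (1 + w r) powr ((\<sigma> + p) / p)"
      using w_pos[OF r] D nn by (intro add_mono mult_left_mono powr_mono2 ge_one_powr_ge_zero) auto
    finally show "v r powr ?\<kappa> \<le> (v 0 powr ?\<kappa> + D) * (1 + w r) powr ((\<sigma> + p) / p)"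
      by (simp add: algebra_simps)
  qed
qed

lemma v_le: "\<exists>C>0. \<forall>r. 0 < r \<and> r < R \<longrightarrow> v r \<le> C * (1 + w r) powr (critical_exp / m)"
proof -
  let ?\<kappa> = "(m * p + p - 1 - \<beta>) / p"
  obtain C where C: "0 < C" and le: "\<And>r. 0 < r \<Longrightarrow> r < R \<Longrightarrow>
     v r powr ?\<kappa> \<le> C * (1 + w r) powr ((\<sigma> + p) / p)" using v_power_le by blast
  have \<kappa>: "0 < ?\<kappa>" using denom_pos p_gt by simp
  show ?thesis
  proof (intro exI[of _ "C powr (1 / ?\<kappa>)"] conjI allI impI)
    show "0 < C powr (1 / ?\<kappa>)" using C by simp
    fix r assume "0 < r \<and> r < R"
    then have r: "0 < r" "r < R" by auto
    have pos: "0 < w r" "0 < v r" using r w_pos v_pos by auto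
    have "v r = (v r powr ?\<kappa>) powr (1 / ?\<kappa>)"
      using denom_pos p_gt pos by (simp add: powr_powr)
    also have "\<dots> \<le> (C * (1 + w r) powr ((\<sigma> + p) / p)) powr (1 / ?\<kappa>)"
      using denom_pos p_gt le[OF r] by (intro powr_mono2) auto
    also have "\<dots> = C powr (1 / ?\<kappa>) * (1 + w r) powr ((\<sigma> + p) / p * (1 / ?\<kappa>))"
      using C pos by (simp add: powr_mult powr_powr)
    also have "(\<sigma> + p) / p * (1 / ?\<kappa>) = critical_exp / m"
      unfolding critical_exp_def using m_pos p_gt denom_pos by (simp add: divide_simps)
    finally show "v r \<le> C powr (1 / ?\<kappa>) * (1 + w r) powr (critical_exp / m)" .
  qed
qed

lemma w'_le_power: "\<exists>C>0. \<forall>r. 0 < r \<and> r < R \<longrightarrow> w' r \<le> C * (1 + w r) powr critical_exp"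
proof -
  obtain C where C: "0 < C" and le: "\<And>r. 0 < r \<Longrightarrow> r < R \<Longrightarrow>
     v r \<le> C * (1 + w r) powr (critical_exp / m)" using v_le by blast
  show ?thesis
  proof (intro exI[of _ "c * C powr m"] conjI allI impI)
    show "0 < c * C powr m" using C c_pos by simp
    fix r assume "0 < r \<and> r < R"
    then have r: "0 < r" "r < R" by auto
    have pos: "0 < w r" "0 < v r" using r w_pos v_pos by auto
    have "w' r \<le> c * v r powr m" using w'_le[OF r] .
    also have "\<dots> \<le> c * (C * (1 + w r) powr (critical_exp / m)) powr m"
      using le[OF r] c_pos pos m_pos by (intro mult_left_mono powr_mono2) auto
    also have "\<dots> = c * C powr m * (1 + w r) powr critical_exp"
      using C pos m_pos by (simp add: powr_mult powr_powr)
    finally show "w' r \<le> c * C powr m * (1 + w r) powr critical_exp" .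
  qed
qed

text \<open>
  The product \<open>v\<^sup>\<beta>\<^sup>-\<^sup>m w\<^sup>\<sigma>\<^sup>+\<^sup>1\<close> has the homogeneity of \<open>z\<close> under the scaling of the system. In its derivative the
  term with \<open>v'\<close> carries the factor \<open>\<beta> - m \<le> 0\<close>, and the term with \<open>w' \<le> c v\<^sup>m\<close> is at most
  \<open>(\<sigma>+1) c v\<^sup>\<beta> w\<^sup>\<sigma>\<close>, a multiple of the lower bound for \<open>z'\<close>. As \<open>v(0) > 0\<close>, the product vanishes at the origin
  together with \<open>z\<close>, so that no constant of integration appears.
\<close>

lemma z_ge:
  assumes r: "0 < r" "r < R"
  shows "z_rate * (v r powr (\<beta> - m) * w r powr (\<sigma> + 1)) \<le> z r"
proof -
  define h where "h = (\<lambda>t. z t - z_rate * (v t powr (\<beta> - m) * w t powr (\<sigma> + 1)))"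
  have "0 - z_rate * (v 0 powr (\<beta> - m) * 0) \<le> h r"
  proof (rule limit_at_0_le_of_deriv_nonneg[OF _ _ _ r(1)])
    fix t assume t: "0 < t" "t \<le> r"
    then have tR: "t < R" using r by simp
    have pos: "0 < w t" "0 < z t" "0 < v t" using t tR w_pos z_pos v_pos by auto
    show "(h has_real_derivative z' t -
        z_rate * (((\<beta> - m) * v t powr (\<beta> - m - 1) * z t powr (1 / (p - 1))) * w t powr (\<sigma> + 1)
             + ((\<sigma> + 1) * w t powr \<sigma> * w' t) * v t powr (\<beta> - m))) (at t)"
      unfolding h_def
      using DERIV_fun_powr[OF dw, of t "\<sigma> + 1"] DERIV_fun_powr[OF dv, of t "\<beta> - m"] t tR pos
      by (intro DERIV_diff DERIV_cmult DERIV_mult dz) auto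
    have "((\<sigma> + 1) * w t powr \<sigma> * w' t) * v t powr (\<beta> - m)
        \<le> ((\<sigma> + 1) * w t powr \<sigma> * (c * v t powr m)) * v t powr (\<beta> - m)"
      using w'_le[OF t(1) tR] sigma_pos by (intro mult_right_mono mult_left_mono) auto
    also have "\<dots> = (\<sigma> + 1) * c * w t powr \<sigma> * (v t powr m * v t powr (\<beta> - m))"
      by (simp add: mult_ac)
    also have "v t powr m * v t powr (\<beta> - m) = v t powr \<beta>" by (simp flip: powr_add)
    finally have "z_rate * (((\<sigma> + 1) * w t powr \<sigma> * w' t) * v t powr (\<beta> - m))
        \<le> z_rate * ((\<sigma> + 1) * c * w t powr \<sigma> * v t powr \<beta>)" using z_rate_pos by (intro mult_left_mono) auto
    also have "\<dots> = v t powr \<beta> * w t powr \<sigma> / (B + 1)"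
    proof -
      have "B + 1 \<noteq> 0" "\<sigma> + 1 \<noteq> 0" "c \<noteq> 0" using B_pos c_pos sigma_pos by auto
      then show ?thesis unfolding z_rate_def by (simp add: divide_simps)
    qed
    also have "\<dots> \<le> z' t" using z'_ge[OF t(1) tR] .
    finally have 1: "z_rate * (((\<sigma> + 1) * w t powr \<sigma> * w' t) * v t powr (\<beta> - m)) \<le> z' t" .
    have 2: "z_rate * (((\<beta> - m) * v t powr (\<beta> - m - 1) * z t powr (1 / (p - 1))) * w t powr (\<sigma> + 1)) \<le> 0"
      using z_rate_pos beta_le by (intro mult_nonneg_nonpos mult_nonpos_nonneg) auto
    show "0 \<le> z' t -
        z_rate * (((\<beta> - m) * v t powr (\<beta> - m - 1) * z t powr (1 / (p - 1))) * w t powr (\<sigma> + 1)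
             + ((\<sigma> + 1) * w t powr \<sigma> * w' t) * v t powr (\<beta> - m))"
      using 1 2 unfolding distrib_left by linarith
  next
    show "(h \<longlongrightarrow> 0 - z_rate * (v 0 powr (\<beta> - m) * 0)) (at_right 0)"
      unfolding h_def
      by (intro tendsto_intros v0 z0 w_powr_tendsto_0)
        (use v0_pos sigma_pos in auto)
  qed
  then show ?thesis unfolding h_def by simp
qed

text \<open>
  Inserting the bound for \<open>z\<close> into \<open>v' = z\<^sup>1\<^sup>/\<^sup>(\<^sup>p\<^sup>-\<^sup>1\<^sup>)\<close> and using \<open>w' \<le> c v\<^sup>m\<close> separates the variables again.
\<close>

lemma v_power_ge:
  assumes r: "0 < r" "r < R"
  shows "v_rate * w r powr ((\<sigma> + p) / (p - 1)) \<le> v r powr ((m * p + p - 1 - \<beta>) / (p - 1))"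
proof -
  let ?\<kappa> = "(m * p + p - 1 - \<beta>) / (p - 1)" and ?\<tau> = "(\<sigma> + p) / (p - 1)"
  have \<kappa>: "0 < ?\<kappa>" using denom_pos p_gt by simp
  have \<tau>: "0 < ?\<tau>" using sigma_pos p_gt by simp
    define h where "h = (\<lambda>t. v t powr ?\<kappa> - v_rate * w t powr ?\<tau>)"
    have "v 0 powr ?\<kappa> - v_rate * 0 \<le> h r"
    proof (rule limit_at_0_le_of_deriv_nonneg[OF _ _ _ r(1)])
      fix t assume t: "0 < t" "t \<le> r"
      then have tR: "t < R" using r by simp
      have pos: "0 < w t" "0 < z t" "0 < v t" using t tR w_pos z_pos v_pos by auto
      show "(h has_real_derivative ?\<kappa> * v t powr (?\<kappa> - 1) * z t powr (1 / (p - 1))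
          - v_rate * (?\<tau> * w t powr (?\<tau> - 1) * w' t)) (at t)"
        unfolding h_def
        using DERIV_fun_powr[OF dw, of t ?\<tau>] DERIV_fun_powr[OF dv, of t ?\<kappa>] t tR pos
        by (intro DERIV_diff DERIV_cmult) auto
      have "v_rate * (?\<tau> * w t powr (?\<tau> - 1) * w' t) \<le> v_rate * (?\<tau> * w t powr (?\<tau> - 1) * (c * v t powr m))"
        using w'_le[OF t(1) tR] v_rate_pos sigma_pos p_gt by (intro mult_left_mono) auto
      also have "\<dots> = ?\<kappa> * (z_rate powr (1 / (p - 1)) * (w t powr (?\<tau> - 1) * v t powr m))"
      proof -
        have "v_rate * ?\<tau> * c = ?\<kappa> * z_rate powr (1 / (p - 1))"
        proof -
          have e: "x / c / y * y * c = x" if "0 < y" for x y using that c_pos by simp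
          show ?thesis unfolding v_rate_def by (rule e[OF \<tau>])
        qed
        then have "v_rate * ?\<tau> * c * (w t powr (?\<tau> - 1) * v t powr m)
            = ?\<kappa> * z_rate powr (1 / (p - 1)) * (w t powr (?\<tau> - 1) * v t powr m)" by (rule arg_cong)
        then show ?thesis by (simp only: mult.assoc mult.left_commute)
      qed
      also have "\<dots> = ?\<kappa> * (z_rate powr (1 / (p - 1)) * (w t powr ((\<sigma> + 1) / (p - 1)) *
          (v t powr (?\<kappa> - 1) * v t powr ((\<beta> - m) / (p - 1)))))"
      proof -
        have "?\<kappa> - 1 + (\<beta> - m) / (p - 1) = m" using p_gt by (simp add: divide_simps) (simp add: algebra_simps)
        moreover have "?\<tau> - 1 = (\<sigma> + 1) / (p - 1)" using p_gt by (simp add: divide_simps)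
        ultimately show ?thesis by (simp flip: powr_add)
      qed
      also have "z_rate powr (1 / (p - 1)) * (w t powr ((\<sigma> + 1) / (p - 1)) *
             (v t powr (?\<kappa> - 1) * v t powr ((\<beta> - m) / (p - 1))))
          = v t powr (?\<kappa> - 1) * (z_rate * (v t powr (\<beta> - m) * w t powr (\<sigma> + 1))) powr (1 / (p - 1))"
        using z_rate_pos pos by (simp add: powr_mult powr_powr mult_ac)
      also have "?\<kappa> * \<dots> \<le> ?\<kappa> * (v t powr (?\<kappa> - 1) * z t powr (1 / (p - 1)))"
        using \<kappa> z_ge[OF t(1) tR] p_gt z_rate_pos
        by (intro mult_left_mono powr_mono2) auto
      finally show "0 \<le> ?\<kappa> * v t powr (?\<kappa> - 1) * z t powr (1 / (p - 1))
          - v_rate * (?\<tau> * w t powr (?\<tau> - 1) * w' t)" by (simp add: mult_ac)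
    next
      show "(h \<longlongrightarrow> v 0 powr ?\<kappa> - v_rate * 0) (at_right 0)"
        unfolding h_def
        by (intro tendsto_intros v0 w_powr_tendsto_0)
        (use v0_pos \<tau> in auto)
    qed
    moreover have "0 < v 0 powr ?\<kappa>" using v0_pos by simp
    ultimately show ?thesis unfolding h_def by linarith
qed

lemma w'_ge_power:
  assumes r: "0 < r" "r < R"
  shows "w_rate * w r powr critical_exp \<le> w' r"
proof -
  let ?\<kappa> = "(m * p + p - 1 - \<beta>) / (p - 1)" and ?\<tau> = "(\<sigma> + p) / (p - 1)"
  have \<kappa>: "0 < ?\<kappa>" using denom_pos p_gt by simp
    have pos: "0 < w r" "0 < v r" using r w_pos v_pos by auto
    have e: "critical_exp = ?\<tau> * (m / ?\<kappa>)"
      unfolding critical_exp_def using p_gt denom_pos by (simp add: divide_simps)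
    have "v_rate powr (m / ?\<kappa>) * w r powr critical_exp = (v_rate * w r powr ?\<tau>) powr (m / ?\<kappa>)"
      using v_rate_pos pos unfolding e by (simp add: powr_mult powr_powr)
    also have "\<dots> \<le> (v r powr ?\<kappa>) powr (m / ?\<kappa>)"
      using v_power_ge[OF r] v_rate_pos \<kappa> m_pos by (intro powr_mono2 divide_nonneg_pos) auto
    also have "\<dots> = v r powr m" using denom_pos p_gt by (simp add: powr_powr)
    finally have "c / (A + 1) * (v_rate powr (m / ?\<kappa>) * w r powr critical_exp) \<le> c / (A + 1) * v r powr m"
      using c_pos A_pos by (intro mult_left_mono) auto
    also have "\<dots> \<le> w' r" using w'_ge[OF r] by simp
    finally show ?thesis unfolding w_rate_def by simp
qed

end

section \<open>Boundedness and blow-up of radial solutions\<close>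

context radial_solution
begin

text \<open>
  Gronwall: for \<open>\<Theta> \<le> 1\<close> the estimate \<open>w' \<le> C (1+w)\<^sup>\<Theta>\<close> implies \<open>(ln (1+w))' \<le> C\<close>.
\<close>

lemma w_bounded_of_critical_exp_le_1:
  assumes "critical_exp \<le> 1"
  shows "\<exists>M. \<forall>r. 0 < r \<and> r < R \<longrightarrow> w r \<le> M"
proof -
  obtain C where C: "0 < C" and le: "\<And>r. 0 < r \<Longrightarrow> r < R \<Longrightarrow> w' r \<le> C * (1 + w r) powr critical_exp"
    using w'_le_power by blast
  have "w r \<le> exp (C * R)" if r: "0 < r" "r < R" for r
  proof -
    define h where "h = (\<lambda>t. C * t - ln (1 + w t))"
    have "C * 0 - ln (1 + 0) \<le> h r"
    proof (rule limit_at_0_le_of_deriv_nonneg[OF _ _ _ r(1)])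
      fix t assume t: "0 < t" "t \<le> r"
      then have tR: "t < R" using r by simp
      have pos: "0 < w t" using w_pos t tR by simp
      show "(h has_real_derivative C - w' t / (1 + w t)) (at t)"
        unfolding h_def using pos t tR by (auto intro!: derivative_eq_intros dw)
      have "w' t \<le> C * (1 + w t) powr critical_exp" using le t tR by simp
      also have "\<dots> \<le> C * (1 + w t) powr 1" using assms C pos by (intro mult_left_mono powr_mono) auto
      finally show "0 \<le> C - w' t / (1 + w t)" using pos by (simp add: divide_le_eq)
    next
      show "(h \<longlongrightarrow> C * 0 - ln (1 + 0)) (at_right 0)"
        unfolding h_def by (intro tendsto_intros w0) auto
    qed
    then have "ln (1 + w r) \<le> C * r" unfolding h_def by simp
    also have "\<dots> \<le> C * R" using C r by simp
    finally have "1 + w r \<le> exp (C * R)"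
      using w_pos[OF r] by (metis exp_le_cancel_iff exp_ln add_pos_pos zero_less_one)
    then show ?thesis by simp
  qed
  then show ?thesis by blast
qed

lemma v_bounded_of_w_bounded:
  assumes "\<And>r. 0 < r \<Longrightarrow> r < R \<Longrightarrow> w r \<le> M"
  shows "\<exists>M. \<forall>r. 0 < r \<and> r < R \<longrightarrow> v r \<le> M"
proof -
  obtain C where C: "0 < C" and le: "\<And>r. 0 < r \<Longrightarrow> r < R \<Longrightarrow> v r \<le> C * (1 + w r) powr (critical_exp / m)"
    using v_le by blast
  have "v r \<le> C * (1 + M) powr (critical_exp / m)" if r: "0 < r" "r < R" for r
    using le[OF r] assms[OF r] C w_pos[OF r] critical_exp_pos m_pos
    by (elim order_trans) (intro mult_left_mono powr_mono2, auto)
  then show ?thesis by blast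
qed

lemma w_bounded_of_v_bounded:
  assumes M: "\<And>r. 0 < r \<Longrightarrow> r < R \<Longrightarrow> v r \<le> M"
  shows "\<exists>M. \<forall>r. 0 < r \<and> r < R \<longrightarrow> w r \<le> M"
proof -
  have "w r \<le> c * M powr m * R" if r: "0 < r" "r < R" for r
  proof -
    define h where "h = (\<lambda>t. c * M powr m * t - w t)"
    have "c * M powr m * 0 - 0 \<le> h r"
    proof (rule limit_at_0_le_of_deriv_nonneg[OF _ _ _ r(1)])
      fix t assume t: "0 < t" "t \<le> r"
      then have tR: "t < R" using r by simp
      have pos: "0 < v t" using v_pos t tR by simp
      show "(h has_real_derivative c * M powr m - w' t) (at t)"
        unfolding h_def using t tR by (auto intro!: derivative_eq_intros dw)
      have "w' t \<le> c * v t powr m" using w'_le t tR by simp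
      also have "\<dots> \<le> c * M powr m" using M[of t] t tR pos c_pos m_pos by (intro mult_left_mono powr_mono2) auto
      finally show "0 \<le> c * M powr m - w' t" by simp
    next
      show "(h \<longlongrightarrow> c * M powr m * 0 - 0) (at_right 0)"
        unfolding h_def by (intro tendsto_intros w0)
    qed
    then have "w r \<le> c * M powr m * r" unfolding h_def by simp
    also have "\<dots> \<le> c * M powr m * R" using c_pos r by (intro mult_left_mono) auto
    finally show ?thesis .
  qed
  then show ?thesis by blast
qed

text \<open>
  From \<open>w' \<ge> k w\<^sup>\<Theta>\<close> the function \<open>w\<^sup>1\<^sup>-\<^sup>\<Theta> + (\<Theta>-1) k t\<close> is nonincreasing. A single value of \<open>w\<close> thus bounds the
  length of every interval of existence, and this forces blow-up.
\<close>

lemma lifespan_bound: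
  assumes crit: "1 < critical_exp" and r: "0 < r" "r < R"
  shows "(critical_exp - 1) * w_rate * (R - r) \<le> w r powr (1 - critical_exp)"
proof (rule tendsto_upperbound)
  show "((\<lambda>s. (critical_exp - 1) * w_rate * (s - r)) \<longlongrightarrow> (critical_exp - 1) * w_rate * (R - r)) (at_left R)"
    by (intro tendsto_intros)
  have "(critical_exp - 1) * w_rate * (s - r) \<le> w r powr (1 - critical_exp)" if s: "r < s" "s < R" for s
  proof -
    define h where "h = (\<lambda>t. w t powr (1 - critical_exp) + (critical_exp - 1) * w_rate * t)"
    have "h s \<le> h r"
    proof (rule DERIV_nonpos_imp_nonincreasing[where f = h])
      fix t assume "r \<le> t" "t \<le> s"
      then have t: "0 < t" "t < R" using r s by auto
      have pos: "0 < w t" using t w_pos by simp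
      have dh: "(h has_real_derivative (1 - critical_exp) * w t powr (1 - critical_exp - 1) * w' t
          + (critical_exp - 1) * w_rate * 1) (at t)"
        unfolding h_def using DERIV_fun_powr[OF dw, of t "1 - critical_exp"] t pos
        by (intro DERIV_add DERIV_cmult DERIV_ident) auto
      have "w_rate * w t powr critical_exp * w t powr (- critical_exp) \<le> w' t * w t powr (- critical_exp)"
        by (intro mult_right_mono w'_ge_power t) auto
      then have "w_rate \<le> w' t * w t powr (- critical_exp)"
        using pos by (simp add: mult.assoc flip: powr_add)
      then have "(critical_exp - 1) * w_rate \<le> (critical_exp - 1) * (w' t * w t powr (- critical_exp))"
        using crit by (intro mult_left_mono) auto
      moreover have "(1 - critical_exp) * w t powr (1 - critical_exp - 1) * w' t
          = - ((critical_exp - 1) * (w' t * w t powr (- critical_exp)))"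
      proof -
        have e: "1 - critical_exp - 1 = - critical_exp" by simp
        have "(1 - x) * a * b = - ((x - 1) * (b * a))" for x a b :: real by (simp add: algebra_simps)
        then show ?thesis unfolding e .
      qed
      ultimately have "(1 - critical_exp) * w t powr (1 - critical_exp - 1) * w' t + (critical_exp - 1) * w_rate * 1 \<le> 0"
        by linarith
      with dh show "\<exists>y. (h has_real_derivative y) (at t) \<and> y \<le> 0" by blast
    qed (use s in simp)
    moreover have "0 \<le> w s powr (1 - critical_exp)" by simp
    ultimately show ?thesis unfolding h_def right_diff_distrib by linarith
  qed
  then show "\<forall>\<^sub>F s in at_left R. (critical_exp - 1) * w_rate * (s - r) \<le> w r powr (1 - critical_exp)"
    unfolding eventually_at_left_field using r by blast
qed simp

text \<open>
  In the application \<open>U\<close> is the profile of \<open>u\<close> and \<open>\<rho> = 1/\<kappa>\<close>. Its growth is compared with functions of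
  \<open>w\<close>, which avoids any computation of blow-up rates in terms of \<open>R - r\<close>.
\<close>

context
  fixes U :: "real \<Rightarrow> real" and \<rho> :: real
  assumes dU: "\<And>r. 0 < r \<Longrightarrow> r < R \<Longrightarrow> (U has_real_derivative w r powr \<rho>) (at r)"
    and rho_pos: "0 < \<rho>"
begin

lemma primitive_mono:
  assumes "0 < s" "s \<le> r" "r < R"
  shows "U s \<le> U r"
proof (rule DERIV_nonneg_imp_nondecreasing[OF assms(2)])
  fix t assume "s \<le> t" "t \<le> r"
  then show "\<exists>y. (U has_real_derivative y) (at t) \<and> 0 \<le> y"
    using dU[of t] assms by (intro exI[of _ "w t powr \<rho>"]) auto
qed

lemma primitive_bounded_of_bound_on_half:
  assumes "\<And>r. R / 2 \<le> r \<Longrightarrow> r < R \<Longrightarrow> U r \<le> M"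
  shows "\<exists>M. \<forall>r. 0 < r \<and> r < R \<longrightarrow> U r \<le> M"
proof (intro exI allI impI)
  fix r assume r: "0 < r \<and> r < R"
  then have "U r \<le> U (max r (R / 2))" using R_pos by (intro primitive_mono) auto
  also have "\<dots> \<le> M" using r R_pos by (intro assms) auto
  finally show "U r \<le> M" .
qed

lemma primitive_bounded_of_w_bounded:
  assumes M: "\<And>r. 0 < r \<Longrightarrow> r < R \<Longrightarrow> w r \<le> M"
  shows "\<exists>M. \<forall>r. 0 < r \<and> r < R \<longrightarrow> U r \<le> M"
proof -
  define h where "h = (\<lambda>t. U t - M powr \<rho> * t)"
  have "U r \<le> h (R / 2) + M powr \<rho> * R" if r: "R / 2 \<le> r" "r < R" for r
  proof -
  have "h r \<le> h (R / 2)"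
  proof (rule DERIV_nonpos_imp_nonincreasing[where f = h])
    fix t assume "R / 2 \<le> t" "t \<le> r"
    then have t: "0 < t" "t < R" using r R_pos by auto
    have "(h has_real_derivative w t powr \<rho> - M powr \<rho>) (at t)"
      unfolding h_def using t by (auto intro!: derivative_eq_intros dU)
    moreover have "w t powr \<rho> \<le> M powr \<rho>"
      using M[OF t] w_pos[OF t] rho_pos by (intro powr_mono2) auto
    ultimately show "\<exists>y. (h has_real_derivative y) (at t) \<and> y \<le> 0" by (intro exI conjI) auto
  qed (rule r)
  moreover have "M powr \<rho> * r \<le> M powr \<rho> * R" using r by (intro mult_left_mono) auto
  ultimately show ?thesis unfolding h_def by linarith
  qed
  then show ?thesis by (rule primitive_bounded_of_bound_on_half)
qed

text \<open>
  Along the solution \<open>dU/dw = w\<^sup>\<rho>/w' \<le> w\<^sup>\<rho>\<^sup>-\<^sup>\<Theta>/k\<close>, where \<open>\<rho> - \<Theta> < -1\<close>. Therefore a multiple of the decaying power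
  \<open>w\<^sup>\<rho>\<^sup>+\<^sup>1\<^sup>-\<^sup>\<Theta>\<close> absorbs the growth of \<open>U\<close>.
\<close>

lemma primitive_bounded_of_large_critical_exp:
  assumes "\<rho> < critical_exp - 1"
  shows "\<exists>M. \<forall>r. 0 < r \<and> r < R \<longrightarrow> U r \<le> M"
proof -
  \<comment> \<open>\<open>- e\<close> is the exponent of \<open>w\<close> after integrating \<open>w\<^sup>\<rho>\<^sup>-\<^sup>\<Theta>\<close>.\<close>
  define e where "e = critical_exp - 1 - \<rho>"
  have e: "0 < e" using assms by (simp add: e_def)
  define K where "K = 1 / (e * w_rate)"
  have K: "0 < K" using e w_rate_pos by (simp add: K_def)
  define h where "h = (\<lambda>t. U t + K * w t powr (- e))"
  have "U r \<le> h (R / 2)" if r: "R / 2 \<le> r" "r < R" for r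
  proof -
  have "h r \<le> h (R / 2)"
  proof (rule DERIV_nonpos_imp_nonincreasing[where f = h])
    fix t assume "R / 2 \<le> t" "t \<le> r"
    then have t: "0 < t" "t < R" using r R_pos by auto
    have pos: "0 < w t" using t w_pos by simp
    have "(h has_real_derivative w t powr \<rho> + K * (- e * w t powr (- e - 1) * w' t)) (at t)"
      unfolding h_def using DERIV_fun_powr[OF dw, of t "- e"] t pos
      by (intro DERIV_add DERIV_cmult dU) auto
    moreover have "w t powr \<rho> + K * (- e * w t powr (- e - 1) * w' t) \<le> 0"
    proof -
      have "w t powr \<rho> = K * e * (w t powr (- e - 1) * (w_rate * w t powr critical_exp))"
      proof -
        have "- e - 1 + critical_exp = \<rho>" by (simp add: e_def)
        then have "w t powr (- e - 1) * w t powr critical_exp = w t powr \<rho>" by (simp flip: powr_add)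
        moreover have "K * e * w_rate = 1" using e w_rate_pos by (simp add: K_def)
        ultimately show ?thesis by (metis mult.left_commute mult.assoc mult_1)
      qed
      also have "\<dots> \<le> K * e * (w t powr (- e - 1) * w' t)"
        using K e w'_ge_power[OF t] by (intro mult_left_mono) auto
      finally show ?thesis by (simp add: algebra_simps)
    qed
    ultimately show "\<exists>y. (h has_real_derivative y) (at t) \<and> y \<le> 0" by blast
  qed (rule r)
  moreover have "0 \<le> K * w r powr (- e)" using K by simp
  ultimately show ?thesis unfolding h_def by linarith
  qed
  then show ?thesis by (rule primitive_bounded_of_bound_on_half)
qed

text \<open>
  In the opposite case \<open>dU/dw \<ge> const / (1+w)\<close>, so that \<open>U\<close> grows at least like \<open>ln (1+w)\<close>, hence like \<open>ln v\<close> by the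
  upper bound for \<open>v\<close>. Starting at \<open>R/2\<close> keeps \<open>w\<close> away from \<open>0\<close> and makes \<open>w\<close> and \<open>1+w\<close> comparable.
\<close>

lemma primitive_unbounded:
  assumes exp_le: "critical_exp - 1 \<le> \<rho>" and v_lim: "filterlim v at_top (at_left R)"
  shows "filterlim U at_top (at_left R)"
proof -
  obtain C where C: "0 < C" and w'C: "\<And>r. 0 < r \<Longrightarrow> r < R \<Longrightarrow> w' r \<le> C * (1 + w r) powr critical_exp"
    using w'_le_power by blast
  obtain D where D: "0 < D" and vD: "\<And>r. 0 < r \<Longrightarrow> r < R \<Longrightarrow> v r \<le> D * (1 + w r) powr (critical_exp / m)"
    using v_le by blast
  define \<theta> where "\<theta> = critical_exp / m"
  have \<theta>: "0 < \<theta>" using critical_exp_pos m_pos by (simp add: \<theta>_def)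
  define w1 where "w1 = w (R / 2)"
  have w1: "0 < w1" unfolding w1_def using w_pos R_pos by simp
  define K where "K = C * ((1 + w1) / w1) powr \<rho>"
  have K: "0 < K" using C w1 by (simp add: K_def)
  \<comment> \<open>With this \<open>K\<close> the function \<open>K U - ln (1+w)\<close> is nondecreasing on \<open>[R/2, R)\<close>.\<close>
  define h where "h = (\<lambda>t. K * U t - ln (1 + w t))"
  have h: "h (R / 2) \<le> h r" if r: "R / 2 \<le> r" "r < R" for r
  proof (rule DERIV_nonneg_imp_nondecreasing[where f = h])
    fix t assume t': "R / 2 \<le> t" "t \<le> r"
    then have t: "0 < t" "t < R" using r R_pos by auto
    have pos: "0 < w t" using t w_pos by simp
    have "(h has_real_derivative K * w t powr \<rho> - w' t / (1 + w t)) (at t)"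
      unfolding h_def using pos t by (auto intro!: derivative_eq_intros dw dU)
    moreover have "w' t / (1 + w t) \<le> K * w t powr \<rho>"
    proof -
      have "w' t \<le> C * (1 + w t) powr critical_exp" using w'C t by simp
      also have "\<dots> \<le> C * (1 + w t) powr (\<rho> + 1)"
        using exp_le C pos by (intro mult_left_mono powr_mono) auto
      also have "\<dots> = C * (1 + w t) powr \<rho> * (1 + w t)" using pos by (simp add: powr_add)
      finally have "w' t / (1 + w t) \<le> C * (1 + w t) powr \<rho>" using pos by (simp add: divide_le_eq)
      also have "\<dots> \<le> C * ((1 + w1) / w1 * w t) powr \<rho>"
      proof (intro mult_left_mono powr_mono2)
        have "w1 \<le> w t" unfolding w1_def using t' t R_pos by (intro w_mono) auto
        then show "1 + w t \<le> (1 + w1) / w1 * w t" using w1 by (simp add: field_simps)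
      qed (use rho_pos C pos in auto)
      also have "\<dots> = K * w t powr \<rho>" unfolding K_def using w1 pos by (subst powr_mult) auto
      finally show ?thesis .
    qed
    ultimately show "\<exists>y. (h has_real_derivative y) (at t) \<and> 0 \<le> y" by (intro exI conjI) auto
  qed (rule r)
  have lower: "(h (R / 2) + (ln (v r) - ln D) / \<theta>) / K \<le> U r" if r: "R / 2 \<le> r" "r < R" for r
  proof -
    have r0: "0 < r" using r R_pos by auto
    have pos: "0 < w r" "0 < v r" using r r0 w_pos v_pos by auto
    have "ln (v r) \<le> ln (D * (1 + w r) powr \<theta>)"
      using vD[OF r0 r(2)] pos D by (simp add: \<theta>_def)
    also have "\<dots> = ln D + \<theta> * ln (1 + w r)"
      using D pos by (simp add: ln_mult ln_powr)
    finally have "(ln (v r) - ln D) / \<theta> \<le> ln (1 + w r)" using \<theta> by (simp add: field_simps)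
    with h[OF r] show ?thesis using K unfolding h_def by (simp add: field_simps)
  qed
  have "filterlim (\<lambda>r. (h (R / 2) + (ln (v r) - ln D) / \<theta>) / K) at_top (at_left R)"
  proof -
    have "filterlim (\<lambda>x. (h (R / 2) + (x - ln D) / \<theta>) / K) at_top at_top"
      unfolding filterlim_at_top
    proof
      fix Z
      show "\<forall>\<^sub>F x in at_top. Z \<le> (h (R / 2) + (x - ln D) / \<theta>) / K"
        using eventually_ge_at_top[of "(Z * K - h (R / 2)) * \<theta> + ln D"]
        by eventually_elim (use \<theta> K in \<open>simp add: field_simps\<close>)
    qed
    from filterlim_compose[OF this filterlim_compose[OF ln_at_top v_lim]] show ?thesis .
  qed
  moreover have "\<forall>\<^sub>F r in at_left R. (h (R / 2) + (ln (v r) - ln D) / \<theta>) / K \<le> U r"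
    unfolding eventually_at_left_field using lower R_pos by (intro exI[of _ "R / 2"]) auto
  ultimately show ?thesis by (rule filterlim_at_top_mono)
qed

end

end

section \<open>Solutions that blow up at a prescribed radius\<close>

text \<open>
  The solution of \<open>y' + (a/t) y = g\<close> that vanishes at the origin. At \<open>t = 0\<close> the formula yields \<open>0\<close>, because
  \<open>0 powr (- a) = 0\<close>, and this is the continuous extension.
\<close>

definition damped_primitive :: "real \<Rightarrow> (real \<Rightarrow> real) \<Rightarrow> real \<Rightarrow> real" where
  "damped_primitive a g t = t powr (- a) * integral {0..t} (\<lambda>s. s powr a * g s)"

context
  fixes a :: real
  assumes a_pos: "0 < a"
begin

lemma continuous_on_weighted:
  assumes "continuous_on {0..T} g"
  shows "continuous_on {0..T} (\<lambda>s. s powr a * g s)"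
  using a_pos by (intro continuous_on_mult assms continuous_on_powr' continuous_intros) auto

lemma weighted_integrable:
  assumes "continuous_on {0..T} g"
  shows "(\<lambda>s. s powr a * g s) integrable_on {0..T}"
  by (rule integrable_continuous_real[OF continuous_on_weighted[OF assms]])

lemma damped_primitive_has_derivative:
  assumes g: "continuous_on {0..T} g" and t: "0 < t" "t < T"
  shows "(damped_primitive a g has_real_derivative g t - a / t * damped_primitive a g t) (at t)"
proof -
  let ?I = "\<lambda>t. integral {0..t} (\<lambda>s. s powr a * g s)"
  have "(?I has_real_derivative t powr a * g t) (at t)"
    using integral_has_real_derivative[OF continuous_on_weighted[OF g], of t] t
    by (simp add: at_within_Icc_at)
  moreover have "((\<lambda>t. t powr (- a)) has_real_derivative (- a) * t powr (- a - 1)) (at t)"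
    by (rule has_real_derivative_powr[OF t(1)])
  ultimately have "((\<lambda>t. t powr (- a) * ?I t) has_real_derivative
      ((- a) * t powr (- a - 1)) * ?I t + (t powr a * g t) * t powr (- a)) (at t)"
    by (intro DERIV_mult)
  moreover have "t powr (- a - 1) = t powr (- a) / t" "t powr a * t powr (- a) = 1"
    using t by (simp_all add: powr_diff flip: powr_add)
  then have "((- a) * t powr (- a - 1)) * ?I t + (t powr a * g t) * t powr (- a)
      = g t - a / t * damped_primitive a g t"
    by (simp add: damped_primitive_def field_simps)
  ultimately show ?thesis unfolding damped_primitive_def[abs_def] by simp
qed

lemma damped_primitive_mono:
  assumes "continuous_on {0..t} g" "continuous_on {0..t} h" "\<And>s. s \<in> {0..t} \<Longrightarrow> g s \<le> h s"
  shows "damped_primitive a g t \<le> damped_primitive a h t"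
  unfolding damped_primitive_def
  by (intro mult_left_mono integral_le weighted_integrable assms) auto

lemma damped_primitive_nonneg:
  assumes "\<And>s. s \<in> {0..t} \<Longrightarrow> 0 \<le> g s"
  shows "0 \<le> damped_primitive a g t"
proof (cases "(\<lambda>s. s powr a * g s) integrable_on {0..t}")
  case True
  then show ?thesis unfolding damped_primitive_def
    using assms by (intro mult_nonneg_nonneg integral_nonneg) auto
qed (simp add: damped_primitive_def not_integrable_integral)

lemma damped_primitive_pos:
  assumes g: "continuous_on {0..t} g" and t: "0 < t" and pos: "\<And>s. s \<in> {0<..t} \<Longrightarrow> 0 < g s"
  shows "0 < damped_primitive a g t"
proof -
  have nonneg: "0 \<le> s powr a * g s" if "s \<in> {0..t}" for s
    using pos[of s] that by (cases "s = 0") auto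
  have "integral {0..t} (\<lambda>s. s powr a * g s) \<noteq> 0"
  proof
    assume "integral {0..t} (\<lambda>s. s powr a * g s) = 0"
    then have "\<forall>s\<in>{0..t}. s powr a * g s = 0"
      by (subst (asm) integral_eq_0_iff[OF continuous_on_weighted[OF g] t nonneg])
    then have "t powr a * g t = 0" using t by (rule_tac bspec) auto
    then show False using pos[of t] t by simp
  qed
  moreover have "0 \<le> integral {0..t} (\<lambda>s. s powr a * g s)"
    by (intro integral_nonneg weighted_integrable g nonneg)
  ultimately show ?thesis unfolding damped_primitive_def using t by simp
qed

text \<open>
  The weight satisfies \<open>(s/t)\<^sup>a \<le> 1\<close> for \<open>s \<le> t\<close>. Besides uniform bounds this gives the continuity at the origin.
\<close>

lemma abs_damped_primitive_le:
  assumes g: "continuous_on {0..t} g" and t: "0 \<le> t" and K: "\<And>s. s \<in> {0..t} \<Longrightarrow> \<bar>g s\<bar> \<le> K"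
  shows "\<bar>damped_primitive a g t\<bar> \<le> K * t"
proof (cases "t = 0")
  case False
  then have t: "0 < t" using t by simp
  have K0: "0 \<le> K" using K[of t] t by auto
  have "\<bar>integral {0..t} (\<lambda>s. s powr a * g s)\<bar> \<le> integral {0..t} (\<lambda>_. t powr a * K)"
    unfolding real_norm_def[symmetric]
  proof (rule integral_norm_bound_integral[OF weighted_integrable[OF g]])
    fix s assume s: "s \<in> {0..t}"
    have "norm (s powr a * g s) = s powr a * \<bar>g s\<bar>" by (simp add: abs_mult)
    also have "\<dots> \<le> t powr a * K" using s K a_pos by (intro mult_mono powr_mono2) auto
    finally show "norm (s powr a * g s) \<le> t powr a * K" .
  qed auto
  also have "\<dots> = t powr a * (K * t)" using t by simp
  finally have "t powr (- a) * \<bar>integral {0..t} (\<lambda>s. s powr a * g s)\<bar> \<le> t powr (- a) * (t powr a * (K * t))"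
    by (intro mult_left_mono) auto
  also have "\<dots> = K * t" using t by (simp add: mult.assoc[symmetric] flip: powr_add)
  finally show ?thesis by (simp add: damped_primitive_def abs_mult)
qed (simp add: damped_primitive_def)

lemma continuous_on_damped_primitive:
  assumes g: "continuous_on {0..T} g"
  shows "continuous_on {0..T} (damped_primitive a g)"
proof -
  have sub: "continuous_on {0..t} g" if "t \<le> T" for t
    using continuous_on_subset[OF g] that by auto
  have "bounded (g ` {0..T})"
    by (rule compact_imp_bounded[OF compact_continuous_image[OF g compact_Icc]])
  then obtain K where "\<forall>x\<in>g ` {0..T}. norm x \<le> K" unfolding bounded_iff by blast
  then have K: "\<bar>g s\<bar> \<le> K" if "s \<in> {0..T}" for s using that by simp
  have I: "continuous_on {0..T} (\<lambda>t. integral {0..t} (\<lambda>s. s powr a * g s))"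
    by (rule indefinite_integral_continuous_1[OF weighted_integrable[OF g]])
  show ?thesis unfolding continuous_on_eq_continuous_within
  proof
    fix t assume t: "t \<in> {0..T}"
    show "continuous (at t within {0..T}) (damped_primitive a g)"
    proof (cases "t = 0")
      case True
      have "(damped_primitive a g \<longlongrightarrow> 0) (at 0 within {0..T})"
      proof (rule Lim_null_comparison)
        show "\<forall>\<^sub>F t in at 0 within {0..T}. norm (damped_primitive a g t) \<le> K * t"
          unfolding eventually_at_filter
          using K by (intro always_eventually) (auto intro!: abs_damped_primitive_le sub)
        have "((\<lambda>t. K * t) \<longlongrightarrow> K * 0) (at 0 within {0..T})" by (intro tendsto_intros)
        then show "((\<lambda>t. K * t) \<longlongrightarrow> 0) (at 0 within {0..T})" by simp
      qed
      then show ?thesis using True by (simp add: continuous_within damped_primitive_def)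
    next
      case False
      then have "continuous (at t within {0..T}) (\<lambda>t. t powr (- a) * integral {0..t} (\<lambda>s. s powr a * g s))"
        using I t by (intro continuous_intros) (auto simp: continuous_on_eq_continuous_within)
      then show ?thesis by (simp add: damped_primitive_def[abs_def])
    qed
  qed
qed

lemma damped_primitive_tendsto:
  assumes f: "\<And>n::nat. continuous_on {0..t} (f n)" and t: "0 \<le> t"
    and K: "\<And>n s. s \<in> {0..t} \<Longrightarrow> \<bar>f n s\<bar> \<le> K"
    and lim: "\<And>s. s \<in> {0..t} \<Longrightarrow> (\<lambda>n. f n s) \<longlonglongrightarrow> g s"
  shows "(\<lambda>n. damped_primitive a (f n) t) \<longlonglongrightarrow> damped_primitive a g t"
  unfolding damped_primitive_def
proof (intro tendsto_mult_left dominated_convergence(2)[where h = "\<lambda>_. t powr a * K"])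
  fix n s assume s: "s \<in> {0..t}"
  have "norm (s powr a * f n s) = s powr a * \<bar>f n s\<bar>" by (simp add: abs_mult)
  also have "\<dots> \<le> t powr a * K" using s K a_pos by (intro mult_mono powr_mono2) auto
  finally show "norm (s powr a * f n s) \<le> t powr a * K" .
qed (auto intro!: weighted_integrable f tendsto_mult_left lim)

end

text \<open>
  The set on which the Picard operator acts. The bound below keeps real powers of \<open>f\<close> continuous for
  all exponents, including \<open>\<beta> = 0\<close>.
\<close>

definition continuous_ge_1 :: "real \<Rightarrow> (real \<Rightarrow> real) \<Rightarrow> bool" where
  "continuous_ge_1 T f \<longleftrightarrow> continuous_on {0..T} f \<and> (\<forall>s\<in>{0..T}. 1 \<le> f s)"

lemma continuous_ge_1_pos: "continuous_ge_1 T f \<Longrightarrow> s \<in> {0..T} \<Longrightarrow> 0 < f s"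
  unfolding continuous_ge_1_def by (rule less_le_trans[OF zero_less_one]) blast

lemma continuous_ge_1_mono: "continuous_ge_1 T f \<Longrightarrow> t \<le> T \<Longrightarrow> continuous_ge_1 t f"
  unfolding continuous_ge_1_def by (auto intro: continuous_on_subset)

context radial_system
begin

text \<open>
  The unknowns \<open>w\<close> and \<open>z\<close> as functionals of \<open>v\<close>. With them the system is the fixed point equation
  \<open>v = picard v\<close>, normalised by \<open>v(0) = 1\<close>. All exponents are nonnegative, hence \<open>picard\<close> is monotone; this replaces
  a contraction argument, which would fail because the powers need not be Lipschitz at \<open>0\<close>.
\<close>

definition "w_of f s = c * damped_primitive A (\<lambda>x. f x powr m) s"
definition "z_of f s = damped_primitive B (\<lambda>x. f x powr \<beta> * w_of f x powr \<sigma>) s"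
definition "picard f r = 1 + integral {0..r} (\<lambda>s. z_of f s powr (1 / (p - 1)))"

lemma continuous_on_powr_of_ge_1:
  assumes "continuous_ge_1 T f"
  shows "continuous_on {0..T} (\<lambda>x. f x powr e)"
proof (rule continuous_on_powr')
  show "\<forall>x\<in>{0..T}. 0 \<le> f x \<and> (f x = 0 \<longrightarrow> 0 < e)"
    using continuous_ge_1_pos[OF assms] by (auto simp: order_less_le)
qed (use assms in \<open>auto simp: continuous_ge_1_def\<close>)

lemma continuous_on_w_of: "continuous_ge_1 T f \<Longrightarrow> continuous_on {0..T} (w_of f)"
  unfolding w_of_def[abs_def] using A_pos
  by (intro continuous_intros continuous_on_damped_primitive continuous_on_powr_of_ge_1)

lemma w_of_nonneg: "0 \<le> w_of f s"
  unfolding w_of_def using c_pos A_pos by (intro mult_nonneg_nonneg damped_primitive_nonneg) auto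

lemma continuous_on_source:
  assumes "continuous_ge_1 T f"
  shows "continuous_on {0..T} (\<lambda>x. f x powr \<beta> * w_of f x powr \<sigma>)"
  using sigma_pos w_of_nonneg
  by (intro continuous_on_mult continuous_on_powr_of_ge_1[OF assms] continuous_on_powr'
      continuous_on_w_of[OF assms] continuous_on_const) auto

lemma continuous_on_z_of: "continuous_ge_1 T f \<Longrightarrow> continuous_on {0..T} (z_of f)"
  unfolding z_of_def[abs_def] using B_pos
  by (intro continuous_on_damped_primitive continuous_on_source)

lemma z_of_nonneg: "0 \<le> z_of f s"
  unfolding z_of_def using B_pos by (intro damped_primitive_nonneg) auto

lemma continuous_on_slope:
  assumes "continuous_ge_1 T f"
  shows "continuous_on {0..T} (\<lambda>s. z_of f s powr (1 / (p - 1)))"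
  using p_gt z_of_nonneg
  by (intro continuous_on_powr' continuous_on_z_of[OF assms] continuous_on_const) auto

lemmas slope_integrable = integrable_continuous_real[OF continuous_on_slope]

lemma w_of_pos:
  assumes f: "continuous_ge_1 t f" and t: "0 < t"
  shows "0 < w_of f t"
  unfolding w_of_def
proof (intro mult_pos_pos c_pos damped_primitive_pos A_pos continuous_on_powr_of_ge_1 f t)
  fix s assume "s \<in> {0<..t}"
  then show "0 < f s powr m" using continuous_ge_1_pos[OF f, of s] by simp
qed

lemma z_of_pos:
  assumes f: "continuous_ge_1 t f" and t: "0 < t"
  shows "0 < z_of f t"
  unfolding z_of_def
proof (rule damped_primitive_pos[OF B_pos continuous_on_source[OF f] t])
  fix s assume s: "s \<in> {0<..t}"
  then have "0 < w_of f s" using continuous_ge_1_mono[OF f, of s] by (intro w_of_pos) auto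
  moreover have "1 \<le> f s" using f s by (simp add: continuous_ge_1_def)
  ultimately show "0 < f s powr \<beta> * w_of f s powr \<sigma>" by simp
qed

lemma picard_has_derivative:
  assumes f: "continuous_ge_1 T f" and r: "0 < r" "r < T"
  shows "(picard f has_real_derivative z_of f r powr (1 / (p - 1))) (at r)"
proof -
  have "((\<lambda>r. integral {0..r} (\<lambda>s. z_of f s powr (1 / (p - 1)))) has_real_derivative
      z_of f r powr (1 / (p - 1))) (at r)"
    using integral_has_real_derivative[OF continuous_on_slope[OF f], of r] r
    by (simp add: at_within_Icc_at)
  then show ?thesis unfolding picard_def[abs_def] by (auto intro!: derivative_eq_intros)
qed

lemma picard_mono_arg:
  assumes f: "continuous_ge_1 T f" and "0 \<le> s" "s \<le> r" "r \<le> T"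
  shows "picard f s \<le> picard f r"
  unfolding picard_def using assms z_of_nonneg
  by (intro add_left_mono integral_subset_le slope_integrable[OF continuous_ge_1_mono[OF f]]) auto

lemma picard_0 [simp]: "picard f 0 = 1"
  by (simp add: picard_def)

lemma continuous_ge_1_picard:
  assumes f: "continuous_ge_1 T f"
  shows "continuous_ge_1 T (picard f)"
  unfolding continuous_ge_1_def
proof
  show "continuous_on {0..T} (picard f)" unfolding picard_def[abs_def]
    by (intro continuous_intros indefinite_integral_continuous_1 slope_integrable[OF f])
  show "\<forall>s\<in>{0..T}. 1 \<le> picard f s" using picard_mono_arg[OF f, of 0] by auto
qed

lemma w_of_mono:
  assumes f: "continuous_ge_1 t f" and g: "continuous_ge_1 t g" and le: "\<And>s. s \<in> {0..t} \<Longrightarrow> f s \<le> g s"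
  shows "w_of f t \<le> w_of g t"
proof -
  have "f s powr m \<le> g s powr m" if "s \<in> {0..t}" for s
  proof (rule powr_mono2)
    show "0 \<le> f s" using continuous_ge_1_pos[OF f that] by simp
  qed (use le that m_pos in auto)
  then show ?thesis unfolding w_of_def using c_pos A_pos
    by (intro mult_left_mono damped_primitive_mono continuous_on_powr_of_ge_1 f g) auto
qed

lemma z_of_mono:
  assumes f: "continuous_ge_1 t f" and g: "continuous_ge_1 t g" and le: "\<And>s. s \<in> {0..t} \<Longrightarrow> f s \<le> g s"
  shows "z_of f t \<le> z_of g t"
  unfolding z_of_def
proof (rule damped_primitive_mono[OF B_pos continuous_on_source[OF f] continuous_on_source[OF g]])
  fix s assume s: "s \<in> {0..t}"
  have "w_of f s \<le> w_of g s"
    using s le by (intro w_of_mono continuous_ge_1_mono[OF f] continuous_ge_1_mono[OF g]) auto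
  moreover have "1 \<le> f s" using f s by (simp add: continuous_ge_1_def)
  ultimately show "f s powr \<beta> * w_of f s powr \<sigma> \<le> g s powr \<beta> * w_of g s powr \<sigma>"
    using le[OF s] beta_nonneg sigma_pos w_of_nonneg by (intro mult_mono powr_mono2) auto
qed

lemma picard_mono:
  assumes f: "continuous_ge_1 r f" and g: "continuous_ge_1 r g" and le: "\<And>s. s \<in> {0..r} \<Longrightarrow> f s \<le> g s"
  shows "picard f r \<le> picard g r"
  unfolding picard_def
proof (intro add_left_mono integral_le slope_integrable f g)
  fix s assume s: "s \<in> {0..r}"
  have "z_of f s \<le> z_of g s"
    using s le by (intro z_of_mono continuous_ge_1_mono[OF f] continuous_ge_1_mono[OF g]) auto
  then show "z_of f s powr (1 / (p - 1)) \<le> z_of g s powr (1 / (p - 1))"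
    using p_gt z_of_nonneg by (intro powr_mono2) auto
qed

definition "w_bound L T = c * (L powr m * T)"
definition "z_bound L T = L powr \<beta> * w_bound L T powr \<sigma> * T"
definition "slope_bound L T = z_bound L T powr (1 / (p - 1))"

lemma w_of_le:
  assumes f: "continuous_ge_1 T f" and L: "\<And>s. s \<in> {0..T} \<Longrightarrow> f s \<le> L" and t: "t \<in> {0..T}"
  shows "w_of f t \<le> w_bound L T"
proof -
  have f_pos: "0 < f s" if "s \<in> {0..T}" for s using continuous_ge_1_pos[OF f that] .
  have "\<bar>damped_primitive A (\<lambda>x. f x powr m) t\<bar> \<le> L powr m * t"
  proof (rule abs_damped_primitive_le[OF A_pos])
    show "continuous_on {0..t} (\<lambda>x. f x powr m)"
      using t by (intro continuous_on_powr_of_ge_1 continuous_ge_1_mono[OF f]) auto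
    fix s assume "s \<in> {0..t}"
    then have s: "s \<in> {0..T}" using t by auto
    show "\<bar>f s powr m\<bar> \<le> L powr m" using f_pos[OF s] L[OF s] m_pos by (auto intro: powr_mono2)
  qed (use t in auto)
  also have "\<dots> \<le> L powr m * T" using t by (intro mult_left_mono) auto
  finally show ?thesis unfolding w_of_def w_bound_def using c_pos by (intro mult_left_mono) auto
qed

lemma z_of_le:
  assumes f: "continuous_ge_1 T f" and L: "\<And>s. s \<in> {0..T} \<Longrightarrow> f s \<le> L" and t: "t \<in> {0..T}"
  shows "z_of f t \<le> z_bound L T"
proof -
  have f_pos: "0 < f s" if "s \<in> {0..T}" for s using continuous_ge_1_pos[OF f that] .
  have "\<bar>z_of f t\<bar> \<le> L powr \<beta> * w_bound L T powr \<sigma> * t"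
    unfolding z_of_def
  proof (rule abs_damped_primitive_le[OF B_pos])
    show "continuous_on {0..t} (\<lambda>x. f x powr \<beta> * w_of f x powr \<sigma>)"
      using t by (intro continuous_on_source continuous_ge_1_mono[OF f]) auto
    fix s assume "s \<in> {0..t}"
    then have s: "s \<in> {0..T}" using t by auto
    have "f s powr \<beta> * w_of f s powr \<sigma> \<le> L powr \<beta> * w_bound L T powr \<sigma>"
      using f_pos[OF s] L[OF s] w_of_le[OF f L s] w_of_nonneg beta_nonneg sigma_pos
      by (intro mult_mono powr_mono2) auto
    then show "\<bar>f s powr \<beta> * w_of f s powr \<sigma>\<bar> \<le> L powr \<beta> * w_bound L T powr \<sigma>" by simp
  qed (use t in auto)
  also have "\<dots> \<le> z_bound L T" unfolding z_bound_def using t by (intro mult_left_mono) auto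
  finally show ?thesis by simp
qed

lemma slope_le:
  assumes "continuous_ge_1 T f" "\<And>s. s \<in> {0..T} \<Longrightarrow> f s \<le> L" "t \<in> {0..T}"
  shows "z_of f t powr (1 / (p - 1)) \<le> slope_bound L T"
  unfolding slope_bound_def using z_of_le[OF assms] z_of_nonneg p_gt by (intro powr_mono2) auto

lemma picard_increment_le:
  assumes f: "continuous_ge_1 T f" and L: "\<And>s. s \<in> {0..T} \<Longrightarrow> f s \<le> L"
    and r: "0 \<le> s" "s \<le> r" "r \<le> T"
  shows "picard f r - picard f s \<le> slope_bound L T * (r - s)"
proof -
  let ?y = "\<lambda>s. z_of f s powr (1 / (p - 1))"
  have int: "?y integrable_on {0..r}" using r by (intro slope_integrable continuous_ge_1_mono[OF f]) auto
  have "picard f r - picard f s = integral {s..r} ?y"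
    unfolding picard_def using Henstock_Kurzweil_Integration.integral_combine[OF r(1,2) int] by simp
  also have "\<dots> \<le> integral {s..r} (\<lambda>_. slope_bound L T)"
  proof (rule integral_le)
    show "?y integrable_on {s..r}" using int r by (rule_tac integrable_on_subinterval) auto
    show "?y x \<le> slope_bound L T" if "x \<in> {s..r}" for x
      using slope_le[OF f L, of x] that r by simp
  qed auto
  also have "\<dots> = slope_bound L T * (r - s)" using r by simp
  finally show ?thesis .
qed

definition "iterate n = (picard ^^ n) (\<lambda>_. 1)"

lemma iterate_0 [simp]: "iterate 0 r = 1" and iterate_Suc: "iterate (Suc n) = picard (iterate n)"
  by (simp_all add: iterate_def)

lemma continuous_ge_1_iterate: "continuous_ge_1 T (iterate n)"
proof (induction n)
  case 0 then show ?case by (simp add: continuous_ge_1_def)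
next
  case (Suc n) then show ?case unfolding iterate_Suc by (rule continuous_ge_1_picard)
qed

lemma iterate_mono_arg: "0 \<le> s \<Longrightarrow> s \<le> r \<Longrightarrow> iterate n s \<le> iterate n r"
  by (cases n) (auto simp: iterate_Suc intro: picard_mono_arg[OF continuous_ge_1_iterate order.refl[THEN order.trans]])

lemma iterate_le_Suc: "0 \<le> r \<Longrightarrow> iterate n r \<le> iterate (Suc n) r"
proof (induction n arbitrary: r)
  case 0
  then show ?case using continuous_ge_1_iterate[of r "Suc 0"] by (simp add: continuous_ge_1_def)
next
  case (Suc n)
  have "picard (iterate n) r \<le> picard (iterate (Suc n)) r"
    by (rule picard_mono[OF continuous_ge_1_iterate continuous_ge_1_iterate]) (use Suc in auto)
  then show ?case by (simp only: iterate_Suc)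
qed

text \<open>
  A bound at \<open>T\<close> that is uniform in \<open>n\<close> persists slightly beyond \<open>T\<close>: as long as the iterates stay below \<open>2 L\<close> their
  slopes are bounded, and the additional growth over a short interval is at most \<open>L\<close>. The case \<open>T = 0\<close> is local
  existence, the general case is the continuation principle.
\<close>

lemma iterate_extend:
  assumes T: "0 \<le> T" and L: "\<And>n. iterate n T \<le> L"
  shows "\<exists>e>0. \<forall>n. iterate n (T + e) \<le> 2 * L"
proof -
  have L1: "1 \<le> L" using L[of 0] by simp
  define K where "K = slope_bound (2 * L) (T + 1)"
  have K: "0 \<le> K" unfolding K_def slope_bound_def by simp
  \<comment> \<open>The slopes are at most \<open>K\<close>, so an interval of length \<open>L / (K + 1)\<close> adds at most \<open>L\<close>.\<close>
  define e where "e = min 1 (L / (K + 1))"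
  have e: "0 < e" "e \<le> 1" using L1 K by (auto simp: e_def)
  have "K * e \<le> (K + 1) * (L / (K + 1))" unfolding e_def using K L1 by (intro mult_mono) auto
  then have Ke: "K * e \<le> L" using K by simp
  have bound_mono: "slope_bound (2 * L) (T + e) \<le> K"
    unfolding K_def slope_bound_def z_bound_def w_bound_def
    using T e c_pos sigma_pos p_gt L1 m_pos beta_nonneg by (intro powr_mono2 mult_mono) auto
  have "iterate n (T + e) \<le> 2 * L" for n
  proof (induction n)
    case 0 then show ?case using L1 by simp
  next
    case (Suc n)
    have "iterate n s \<le> 2 * L" if "s \<in> {0..T + e}" for s
      using iterate_mono_arg[of s "T + e" n] Suc that by simp
    then have "picard (iterate n) (T + e) - picard (iterate n) T \<le> slope_bound (2 * L) (T + e) * (T + e - T)"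
      using T e by (intro picard_increment_le[OF continuous_ge_1_iterate]) auto
    also have "\<dots> \<le> K * e" using bound_mono e by (simp add: mult_right_mono)
    finally have "iterate (Suc n) (T + e) \<le> iterate (Suc n) T + K * e" by (simp add: iterate_Suc)
    then show ?case using L[of "Suc n"] Ke by simp
  qed
  with e show ?thesis by blast
qed

text \<open>
  At radii where the iterates are unbounded the value is arbitrary; the function is used only below the
  blow-up radius.
\<close>

definition "iterate_limit r = lim (\<lambda>n. iterate n r)"

context
  fixes T L :: real
  assumes T_nonneg: "0 \<le> T" and L: "\<And>n. iterate n T \<le> L"
begin

lemma iterate_le: "s \<in> {0..T} \<Longrightarrow> iterate n s \<le> L"
  using iterate_mono_arg[of s T n] L[of n] by simp

lemma iterate_tendsto:
  assumes s: "s \<in> {0..T}"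
  shows "(\<lambda>n. iterate n s) \<longlonglongrightarrow> iterate_limit s"
proof -
  have "incseq (\<lambda>n. iterate n s)" using s iterate_le_Suc by (intro incseq_SucI) auto
  then obtain l where "(\<lambda>n. iterate n s) \<longlonglongrightarrow> l"
    using incseq_convergent[of "\<lambda>n. iterate n s" L] iterate_le[OF s] by blast
  then show ?thesis unfolding iterate_limit_def by (simp add: limI)
qed

text \<open>
  The slopes of the iterates are bounded uniformly, so that a Lipschitz bound passes to the pointwise limit.
\<close>

lemma continuous_ge_1_iterate_limit: "continuous_ge_1 T iterate_limit"
  unfolding continuous_ge_1_def
proof
  define K where "K = slope_bound L T"
  have K: "0 \<le> K" unfolding K_def slope_bound_def by simp
  have lip: "iterate_limit r - iterate_limit s \<le> K * (r - s) \<and> iterate_limit s \<le> iterate_limit r"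
    if "0 \<le> s" "s \<le> r" "r \<le> T" for r s
  proof
    have "iterate n r - iterate n s \<le> K * (r - s)" for n
    proof (cases n)
      case 0 then show ?thesis using that K by simp
    next
      case (Suc k)
      then show ?thesis unfolding K_def iterate_Suc Suc
        using that iterate_le by (intro picard_increment_le[OF continuous_ge_1_iterate]) auto
    qed
    then show "iterate_limit r - iterate_limit s \<le> K * (r - s)"
      using that by (intro LIMSEQ_le_const2[OF tendsto_diff[OF iterate_tendsto iterate_tendsto]]) auto
    show "iterate_limit s \<le> iterate_limit r"
      using that iterate_mono_arg by (intro LIMSEQ_le[OF iterate_tendsto iterate_tendsto]) auto
  qed
  have "K-lipschitz_on {0..T} iterate_limit"
  proof (rule lipschitz_onI)
    fix r s assume "r \<in> {0..T}" "s \<in> {0..T}"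
    then show "dist (iterate_limit r) (iterate_limit s) \<le> K * dist r s"
      using lip[of r s] lip[of s r] by (cases "r \<le> s") (auto simp: dist_real_def)
  qed (rule K)
  then show "continuous_on {0..T} iterate_limit" by (rule lipschitz_on_continuous_on)
  show "\<forall>s\<in>{0..T}. 1 \<le> iterate_limit s"
    using continuous_ge_1_iterate[of T] unfolding continuous_ge_1_def
    by (intro ballI LIMSEQ_le_const[OF iterate_tendsto]) auto
qed

lemma w_of_iterate_tendsto:
  assumes s: "s \<in> {0..T}"
  shows "(\<lambda>n. w_of (iterate n) s) \<longlonglongrightarrow> w_of iterate_limit s"
  unfolding w_of_def
proof (intro tendsto_mult_left damped_primitive_tendsto[OF A_pos, where K = "L powr m"])
  fix n x assume "x \<in> {0..s}"
  then have x: "x \<in> {0..T}" using s by auto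
  have "1 \<le> iterate n x" using continuous_ge_1_iterate[of T n] x by (simp add: continuous_ge_1_def)
  then show "\<bar>iterate n x powr m\<bar> \<le> L powr m"
    using iterate_le[OF x, of n] m_pos by (auto intro: powr_mono2)
next
  fix x assume "x \<in> {0..s}"
  then have x: "x \<in> {0..T}" using s by auto
  have "1 \<le> iterate_limit x" using continuous_ge_1_iterate_limit x by (simp add: continuous_ge_1_def)
  then show "(\<lambda>n. iterate n x powr m) \<longlonglongrightarrow> iterate_limit x powr m"
    by (intro tendsto_powr iterate_tendsto[OF x] tendsto_const) auto
qed (use s in \<open>auto intro: continuous_on_powr_of_ge_1 continuous_ge_1_iterate\<close>)

lemma z_of_iterate_tendsto:
  assumes s: "s \<in> {0..T}"
  shows "(\<lambda>n. z_of (iterate n) s) \<longlonglongrightarrow> z_of iterate_limit s"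
  unfolding z_of_def
proof (intro damped_primitive_tendsto[OF B_pos, where K = "L powr \<beta> * w_bound L T powr \<sigma>"])
  fix n x assume "x \<in> {0..s}"
  then have x: "x \<in> {0..T}" using s by auto
  have "1 \<le> iterate n x" using continuous_ge_1_iterate[of T n] x by (simp add: continuous_ge_1_def)
  then have "iterate n x powr \<beta> * w_of (iterate n) x powr \<sigma> \<le> L powr \<beta> * w_bound L T powr \<sigma>"
    using iterate_le[OF x, of n] w_of_le[OF continuous_ge_1_iterate iterate_le x]
      w_of_nonneg beta_nonneg sigma_pos by (intro mult_mono powr_mono2) auto
  then show "\<bar>iterate n x powr \<beta> * w_of (iterate n) x powr \<sigma>\<bar> \<le> L powr \<beta> * w_bound L T powr \<sigma>" by simp
next
  fix x assume "x \<in> {0..s}"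
  then have x: "x \<in> {0..T}" using s by auto
  have "1 \<le> iterate_limit x" using continuous_ge_1_iterate_limit x by (simp add: continuous_ge_1_def)
  then show "(\<lambda>n. iterate n x powr \<beta> * w_of (iterate n) x powr \<sigma>)
      \<longlonglongrightarrow> iterate_limit x powr \<beta> * w_of iterate_limit x powr \<sigma>"
    using sigma_pos w_of_nonneg
    by (intro tendsto_mult tendsto_powr' iterate_tendsto[OF x] w_of_iterate_tendsto[OF x] tendsto_const) auto
qed (use s in \<open>auto intro: continuous_on_source continuous_ge_1_iterate\<close>)

lemma iterate_limit_fixpoint:
  assumes r: "r \<in> {0..T}"
  shows "iterate_limit r = picard iterate_limit r"
proof (rule LIMSEQ_unique)
  show "(\<lambda>n. iterate (Suc n) r) \<longlonglongrightarrow> iterate_limit r"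
    using iterate_tendsto[OF r] by (rule LIMSEQ_Suc)
  show "(\<lambda>n. iterate (Suc n) r) \<longlonglongrightarrow> picard iterate_limit r"
    unfolding iterate_Suc picard_def
  proof (intro tendsto_add tendsto_const dominated_convergence(2)[where h = "\<lambda>_. slope_bound L T"])
    fix n s assume "s \<in> {0..r}"
    then have s: "s \<in> {0..T}" using r by auto
    show "norm (z_of (iterate n) s powr (1 / (p - 1))) \<le> slope_bound L T"
      using slope_le[OF continuous_ge_1_iterate iterate_le s] by simp
  next
    fix s assume "s \<in> {0..r}"
    then have s: "s \<in> {0..T}" using r by auto
    show "(\<lambda>n. z_of (iterate n) s powr (1 / (p - 1))) \<longlonglongrightarrow> z_of iterate_limit s powr (1 / (p - 1))"
      using p_gt z_of_nonneg by (intro tendsto_powr' z_of_iterate_tendsto[OF s] tendsto_const) auto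
  qed (auto intro: slope_integrable continuous_ge_1_iterate)
qed

lemma radial_solution_iterate_limit:
  assumes T: "0 < T"
  shows "radial_solution A B c m \<beta> \<sigma> p T (w_of iterate_limit) (z_of iterate_limit) iterate_limit"
proof
  note v = continuous_ge_1_iterate_limit
  show "0 < T" by (rule T)
  have v0: "iterate_limit 0 = 1" using iterate_limit_fixpoint[of 0] T by simp
  then show "0 < iterate_limit 0" by simp
  show "(iterate_limit \<longlongrightarrow> iterate_limit 0) (at_right 0)"
    using v T by (intro continuous_on_Icc_at_rightD[where b = T]) (auto simp: continuous_ge_1_def)
  show "(w_of iterate_limit \<longlongrightarrow> 0) (at_right 0)"
    using continuous_on_Icc_at_rightD[OF continuous_on_w_of[OF v] T]
    by (simp add: w_of_def damped_primitive_def)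
  show "(z_of iterate_limit \<longlongrightarrow> 0) (at_right 0)"
    using continuous_on_Icc_at_rightD[OF continuous_on_z_of[OF v] T]
    by (simp add: z_of_def damped_primitive_def)
  fix r assume r: "0 < r" "r < T"
  have vr: "continuous_ge_1 r iterate_limit" using v r by (intro continuous_ge_1_mono[OF v]) auto
  show "0 < w_of iterate_limit r" using w_of_pos[OF vr r(1)] .
  show "0 < z_of iterate_limit r" using z_of_pos[OF vr r(1)] .
  show "0 < iterate_limit r" using continuous_ge_1_pos[OF v] r by simp
  have "(w_of iterate_limit has_real_derivative
      c * (iterate_limit r powr m - A / r * damped_primitive A (\<lambda>x. iterate_limit x powr m) r)) (at r)"
    unfolding w_of_def[abs_def]
    by (intro DERIV_cmult damped_primitive_has_derivative[OF A_pos continuous_on_powr_of_ge_1[OF v] r])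
  then show "(w_of iterate_limit has_real_derivative
      c * iterate_limit r powr m - A / r * w_of iterate_limit r) (at r)"
    by (simp add: w_of_def algebra_simps)
  show "(z_of iterate_limit has_real_derivative
      iterate_limit r powr \<beta> * w_of iterate_limit r powr \<sigma> - B / r * z_of iterate_limit r) (at r)"
    using damped_primitive_has_derivative[OF B_pos continuous_on_source[OF v] r]
    by (simp add: z_of_def[abs_def])
  show "(iterate_limit has_real_derivative z_of iterate_limit r powr (1 / (p - 1))) (at r)"
    by (rule has_field_derivative_transform_within_open[OF picard_has_derivative[OF v r], of "{0<..<T}"])
      (use r iterate_limit_fixpoint in auto)
qed

end

text \<open>
  Let \<open>S\<close> be the set of radii at which the iterates are bounded. It is an interval, bounded by the life
  span estimate, and open on the right by \<open>iterate_extend\<close>. So at \<open>T = Sup S\<close> the iterates are unbounded, and as each of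
  them is continuous and below the limit, the limit tends to infinity at \<open>T\<close>.
\<close>

theorem exists_blowup_solution:
  assumes crit: "1 < critical_exp"
  shows "\<exists>T w z v. radial_solution A B c m \<beta> \<sigma> p T w z v \<and> filterlim v at_top (at_left T)"
proof -
  define S where "S = {r. 0 \<le> r \<and> (\<exists>L. \<forall>n. iterate n r \<le> L)}"
  have S_down: "s \<in> S" if "r \<in> S" "0 \<le> s" "s \<le> r" for r s
    using that iterate_mono_arg[of s r] unfolding S_def by (blast intro: order_trans)
  have S_extend: "\<exists>e>0. T + e \<in> S" if "T \<in> S" for T
  proof -
    from that obtain L where "0 \<le> T" "\<And>n. iterate n T \<le> L" unfolding S_def by auto
    from iterate_extend[OF this] obtain e where "0 < e" "\<forall>n. iterate n (T + e) \<le> 2 * L" by blast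
    with \<open>0 \<le> T\<close> show ?thesis unfolding S_def by (intro exI[of _ e]) auto
  qed
  have "iterate n 0 \<le> 1" for n by (cases n) (auto simp: iterate_Suc)
  then have "0 \<in> S" unfolding S_def by auto
  from S_extend[OF this] obtain e where e: "0 < e" "e \<in> S" by auto
  let ?v = iterate_limit and ?w = "w_of iterate_limit" and ?z = "z_of iterate_limit"
  have sol: "radial_solution A B c m \<beta> \<sigma> p T ?w ?z ?v" if "T \<in> S" "0 < T" for T
    using that radial_solution_iterate_limit[of T] unfolding S_def by auto
  have bdd: "bdd_above S"
  proof (rule bdd_aboveI)
    let ?k = "(critical_exp - 1) * w_rate"
    fix T assume T: "T \<in> S"
    have k: "0 < ?k" using crit w_rate_pos by simp
    have nn: "0 \<le> ?w e powr (1 - critical_exp) / ?k" using k by simp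
    show "T \<le> e + ?w e powr (1 - critical_exp) / ?k"
    proof (cases "e < T")
      case True
      then interpret radial_solution A B c m \<beta> \<sigma> p T ?w ?z ?v using sol T e by simp
      have "?k * (T - e) \<le> ?w e powr (1 - critical_exp)" by (rule lifespan_bound[OF crit e(1) True])
      then have "T - e \<le> ?w e powr (1 - critical_exp) / ?k" using k by (simp only: pos_le_divide_eq mult.commute)
      then show ?thesis by simp
    next
      case False
      with nn show ?thesis by linarith
    qed
  qed
  define T where "T = Sup S"
  have T: "0 < T" unfolding T_def using e bdd by (meson cSup_upper less_le_trans)
  have below: "r \<in> S" if r: "0 \<le> r" "r < T" for r
  proof -
    obtain s where "s \<in> S" "r < s" using r e less_cSupE[of r S] unfolding T_def by blast
    then show ?thesis using S_down r by (meson less_imp_le)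
  qed
  have "T \<notin> S"
  proof
    assume "T \<in> S"
    from S_extend[OF this] obtain d where "0 < d" "T + d \<in> S" by auto
    then have "T + d \<le> T" unfolding T_def using bdd by (intro cSup_upper)
    with \<open>0 < d\<close> show False by simp
  qed
  have sol_below: "\<exists>s>r. radial_solution A B c m \<beta> \<sigma> p s ?w ?z ?v" if r: "0 < r" "r < T" for r
    using sol[OF below, of "(r + T) / 2"] r by (intro exI[of _ "(r + T) / 2"]) auto
  have "radial_solution A B c m \<beta> \<sigma> p T ?w ?z ?v"
  proof (rule radial_solution.intro[OF radial_system_axioms], rule radial_solution_axioms.intro)
    show "0 < T" by (rule T)
    from sol_below[of "T / 2"] T obtain s where "radial_solution A B c m \<beta> \<sigma> p s ?w ?z ?v" by auto
    then interpret S: radial_solution A B c m \<beta> \<sigma> p s ?w ?z ?v .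
    show "(?w \<longlongrightarrow> 0) (at_right 0)" "(?z \<longlongrightarrow> 0) (at_right 0)"
      "(?v \<longlongrightarrow> ?v 0) (at_right 0)" "0 < ?v 0"
      by (rule S.w0 S.z0 S.v0 S.v0_pos)+
  next
    fix r assume r: "0 < r" "r < T"
    from sol_below[OF this] obtain s where s: "r < s" "radial_solution A B c m \<beta> \<sigma> p s ?w ?z ?v" by auto
    then interpret S: radial_solution A B c m \<beta> \<sigma> p s ?w ?z ?v by simp
    show "0 < ?w r" "0 < ?z r" "0 < ?v r" using S.w_pos S.z_pos S.v_pos r s by auto
    show "(?w has_real_derivative c * ?v r powr m - A / r * ?w r) (at r)"
      "(?z has_real_derivative ?v r powr \<beta> * ?w r powr \<sigma> - B / r * ?z r) (at r)"
      "(?v has_real_derivative ?z r powr (1 / (p - 1))) (at r)"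
      using S.dw S.dz S.dv r s by auto
  qed
  moreover have "filterlim ?v at_top (at_left T)"
    unfolding filterlim_at_top_gt[where c = 0]
  proof (intro allI impI)
    fix Y :: real
    obtain n where n: "Y < iterate n T"
      using \<open>T \<notin> S\<close> T unfolding S_def by (auto simp: not_le)
    have "(iterate n \<longlongrightarrow> iterate n T) (at_left T)"
      using continuous_ge_1_iterate[of T n] T
      by (intro continuous_on_Icc_at_leftD[where a = 0]) (auto simp: continuous_ge_1_def)
    then have "\<forall>\<^sub>F r in at_left T. Y < iterate n r" using n by (rule order_tendstoD)
    moreover have "\<forall>\<^sub>F r in at_left T. 0 < r \<and> r < T"
      unfolding eventually_at_left_field using T by auto
    ultimately show "\<forall>\<^sub>F r in at_left T. Y \<le> ?v r"
    proof eventually_elim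
      case (elim r)
      then have "r \<in> S" using below by simp
      then obtain L where L: "\<And>n. iterate n r \<le> L" unfolding S_def by auto
      have "iterate n r \<le> ?v r"
        by (rule LIMSEQ_le_const[OF iterate_tendsto[where T = r and L = L]])
          (use elim L iterate_le_Suc lift_Suc_mono_le[of "\<lambda>n. iterate n r"] in \<open>auto intro!: exI[of _ n]\<close>)
      with elim show ?case by simp
    qed
  qed
  ultimately show ?thesis by blast
qed

text \<open>
  The conditions on \<open>a\<close> and \<open>b\<close> express that the powers of \<open>l\<close> on both sides of the first two equations agree; the
  exponent of \<open>z\<close> is dictated by the third.
\<close>

lemma rescaled_radial_solution:
  assumes "radial_solution A B c m \<beta> \<sigma> p T w z v" and l: "0 < l"
    and ab: "a + 1 = m * b" "(b + 1) * (p - 1) + 1 = \<beta> * b + \<sigma> * a"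
  shows "radial_solution A B c m \<beta> \<sigma> p (T / l) (\<lambda>r. l powr a * w (l * r))
    (\<lambda>r. l powr ((b + 1) * (p - 1)) * z (l * r)) (\<lambda>r. l powr b * v (l * r))"
proof -
  interpret S: radial_solution A B c m \<beta> \<sigma> p T w z v by fact
  have lim: "((\<lambda>r. f (l * r)) \<longlongrightarrow> y) (at_right 0)" if "(f \<longlongrightarrow> y) (at_right 0)" for f :: "real \<Rightarrow> real" and y
  proof (rule filterlim_compose[OF that])
    show "filterlim ((*) l) (at_right 0) (at_right 0)"
      unfolding filterlim_at using l
      by (auto intro!: tendsto_eq_intros simp: eventually_at_filter)
  qed
  show ?thesis
  proof (rule radial_solution.intro[OF radial_system_axioms], rule radial_solution_axioms.intro)
    show "0 < T / l" using S.R_pos l by simp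
    show "((\<lambda>r. l powr a * w (l * r)) \<longlongrightarrow> 0) (at_right 0)"
      using tendsto_mult_left[OF lim[OF S.w0], of "l powr a"] by simp
    show "((\<lambda>r. l powr ((b + 1) * (p - 1)) * z (l * r)) \<longlongrightarrow> 0) (at_right 0)"
      using tendsto_mult_left[OF lim[OF S.z0], of "l powr ((b + 1) * (p - 1))"] by simp
    show "((\<lambda>r. l powr b * v (l * r)) \<longlongrightarrow> l powr b * v (l * 0)) (at_right 0)"
      using tendsto_mult_left[OF lim[OF S.v0], of "l powr b"] by simp
    show "0 < l powr b * v (l * 0)" using l S.v0_pos by simp
  next
    fix r assume "0 < r" "r < T / l"
    then have r: "0 < r" "0 < l * r" "l * r < T" using l by (auto simp: field_simps)
    have pos: "0 < w (l * r)" "0 < z (l * r)" "0 < v (l * r)" using S.w_pos S.z_pos S.v_pos r by auto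
    then show "0 < l powr a * w (l * r)" "0 < l powr ((b + 1) * (p - 1)) * z (l * r)"
      "0 < l powr b * v (l * r)" using l by auto
    have chain: "((\<lambda>r. l powr k * f (l * r)) has_real_derivative l powr (k + 1) * D) (at r)"
      if "(f has_real_derivative D) (at (l * r))" for k f D
    proof -
      have "((\<lambda>r. f (l * r)) has_real_derivative D * l) (at r)"
        using DERIV_chain2[OF that DERIV_cmult_Id[of l r]] .
      from DERIV_cmult[OF this, of "l powr k"] show ?thesis
        using l by (simp add: powr_add mult_ac)
    qed
    have "l powr (a + 1) * (c * v (l * r) powr m - A / (l * r) * w (l * r))
        = c * (l powr b * v (l * r)) powr m - A / r * (l powr a * w (l * r))"
    proof -
      have "l powr (a + 1) * v (l * r) powr m = (l powr b * v (l * r)) powr m"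
        using l pos ab(1) by (simp add: powr_mult powr_powr mult.commute)
      moreover have "l powr (a + 1) * (A / (l * r) * w (l * r)) = A / r * (l powr a * w (l * r))"
        using l r by (simp add: powr_add)
      ultimately show ?thesis by (simp add: right_diff_distrib mult.left_commute)
    qed
    with chain[OF S.dw[OF r(2,3)], of a]
    show "((\<lambda>r. l powr a * w (l * r)) has_real_derivative
        c * (l powr b * v (l * r)) powr m - A / r * (l powr a * w (l * r))) (at r)" by simp
    have "l powr ((b + 1) * (p - 1) + 1) * (v (l * r) powr \<beta> * w (l * r) powr \<sigma> - B / (l * r) * z (l * r))
        = (l powr b * v (l * r)) powr \<beta> * (l powr a * w (l * r)) powr \<sigma>
          - B / r * (l powr ((b + 1) * (p - 1)) * z (l * r))"
    proof -
      have "l powr ((b + 1) * (p - 1) + 1) * (v (l * r) powr \<beta> * w (l * r) powr \<sigma>)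
          = (l powr b * v (l * r)) powr \<beta> * (l powr a * w (l * r)) powr \<sigma>"
        unfolding ab(2) using l pos by (simp add: powr_mult powr_powr powr_add mult_ac)
      moreover have "l powr ((b + 1) * (p - 1) + 1) * (B / (l * r) * z (l * r))
          = B / r * (l powr ((b + 1) * (p - 1)) * z (l * r))"
        using l r by (simp add: powr_add)
      ultimately show ?thesis by (simp add: right_diff_distrib)
    qed
    with chain[OF S.dz[OF r(2,3)], of "(b + 1) * (p - 1)"]
    show "((\<lambda>r. l powr ((b + 1) * (p - 1)) * z (l * r)) has_real_derivative
        (l powr b * v (l * r)) powr \<beta> * (l powr a * w (l * r)) powr \<sigma>
          - B / r * (l powr ((b + 1) * (p - 1)) * z (l * r))) (at r)" by simp
    have "l powr (b + 1) * z (l * r) powr (1 / (p - 1))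
        = (l powr ((b + 1) * (p - 1)) * z (l * r)) powr (1 / (p - 1))"
      using l pos p_gt by (simp add: powr_mult powr_powr)
    with chain[OF S.dv[OF r(2,3)], of b]
    show "((\<lambda>r. l powr b * v (l * r)) has_real_derivative
        (l powr ((b + 1) * (p - 1)) * z (l * r)) powr (1 / (p - 1))) (at r)" by simp
  qed
qed

theorem exists_blowup_solution_at:
  assumes crit: "1 < critical_exp" and R: "0 < R"
  shows "\<exists>w z v. radial_solution A B c m \<beta> \<sigma> p R w z v \<and> filterlim v at_top (at_left R)"
proof -
  obtain T w z v where sol: "radial_solution A B c m \<beta> \<sigma> p T w z v"
    and lim: "filterlim v at_top (at_left T)" using exists_blowup_solution[OF crit] by blast
  have T: "0 < T" using sol by (simp add: radial_solution.R_pos)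
  define l where "l = T / R"
  have l: "0 < l" "T / l = R" using T R by (auto simp: l_def)
  define d where "d = \<sigma> * m - (p - 1 - \<beta>)"
  have d: "0 < d" using crit denom_pos unfolding critical_exp_def d_def
    by (simp add: less_divide_eq algebra_simps)
  \<comment> \<open>The solution \<open>b\<close> of the two linear scaling conditions; \<open>d \<noteq> 0\<close> makes them solvable.\<close>
  define b where "b = (p + \<sigma>) / d"
  have bd: "b * d = p + \<sigma>" using d by (simp add: b_def)
  have ab: "(m * b - 1) + 1 = m * b" "(b + 1) * (p - 1) + 1 = \<beta> * b + \<sigma> * (m * b - 1)"
    using bd unfolding d_def by (simp_all add: algebra_simps)
  have "filterlim (\<lambda>r. v (l * r)) at_top (at_left R)"
  proof (rule filterlim_compose[OF lim])
    have "((*) l \<longlongrightarrow> l * R) (at_left R)" by (intro tendsto_intros)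
    moreover have "\<forall>\<^sub>F r in at_left R. l * r < T"
      using l R by (auto simp: eventually_at_filter l_def field_simps)
    ultimately show "filterlim ((*) l) (at_left T) (at_left R)"
      unfolding filterlim_at using R by (auto simp: l_def elim: eventually_mono)
  qed
  then have "filterlim (\<lambda>r. l powr b * v (l * r)) at_top (at_left R)"
    using l by (intro filterlim_tendsto_pos_mult_at_top[OF tendsto_const]) auto
  then show ?thesis
    using rescaled_radial_solution[OF sol l(1) ab] unfolding l(2) by blast
qed

end

section \<open>Calculus of radial fields\<close>

lemma filterlim_norm_at_right_0: "filterlim norm (at_right 0) (at (0::'a::real_normed_vector))"
  unfolding filterlim_at by (auto intro!: tendsto_norm_zero tendsto_ident_at eventually_at_ball[of 1 0 UNIV, THEN eventually_mono] simp: eventually_at_filter)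

text \<open>
  At the origin the field is \<open>0\<close> for every \<open>G\<close>, since the scalar factor multiplies \<open>x = 0\<close>.
\<close>

definition radial_field :: "(real \<Rightarrow> real) \<Rightarrow> 'a::euclidean_space \<Rightarrow> 'a" where
  "radial_field G x = (G (norm x) / norm x) *\<^sub>R x"

text \<open>
  The form that the derivative of a radial field has at \<open>x\<close>: \<open>a\<close> is the rate tangentially to the sphere, and the
  second term corrects it in the radial direction. It is a bounded linear function because second order
  regularity asks for continuity in the operator norm.
\<close>

definition scaling_plus_projection :: "real \<Rightarrow> real \<Rightarrow> 'a::euclidean_space \<Rightarrow> 'a \<Rightarrow>\<^sub>L 'a" where
  "scaling_plus_projection a b x =
     a *\<^sub>R id_blinfun + b *\<^sub>R (blinfun_scaleR_left x o\<^sub>L blinfun_inner_left x)"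

lemma scaling_plus_projection_apply [simp]:
  "blinfun_apply (scaling_plus_projection a b x) y = a *\<^sub>R y + (b * (y \<bullet> x)) *\<^sub>R x"
  by (simp add: scaling_plus_projection_def blinfun.add_left blinfun.scaleR_left)

lemma radial_field_zero [simp]: "radial_field G 0 = 0"
  by (simp add: radial_field_def)

lemma radial_field_has_derivative:
  fixes x :: "'a::euclidean_space"
  assumes x: "x \<noteq> 0" and G: "(G has_real_derivative G') (at (norm x))"
  shows "(radial_field G has_derivative
      blinfun_apply (scaling_plus_projection (G (norm x) / norm x)
        ((G' - G (norm x) / norm x) / (norm x)\<^sup>2) x)) (at x)"
proof -
  define r where "r = norm x"
  have r: "0 < r" using x by (simp add: r_def)
  have "((\<lambda>t. G t / t) has_real_derivative (G' * r - G r) / (r * r)) (at r)"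
    using DERIV_divide[OF G[folded r_def] DERIV_ident] r by simp
  then have Q: "((\<lambda>t. G t / t) has_derivative (\<lambda>h. (G' * r - G r) / (r * r) * h)) (at (norm x))"
    unfolding has_field_derivative_def r_def .
  have "((\<lambda>y. G (norm y) / norm y) has_derivative
      (\<lambda>h. (G' * r - G r) / (r * r) * (h \<bullet> sgn x))) (at x)"
    using has_derivative_compose[OF has_derivative_norm[OF x] Q] .
  from has_derivative_scaleR[OF this has_derivative_ident]
  have "((\<lambda>y. (G (norm y) / norm y) *\<^sub>R y) has_derivative
      (\<lambda>h. (G r / r) *\<^sub>R h + ((G' * r - G r) / (r * r) * (h \<bullet> sgn x)) *\<^sub>R x)) (at x)"
    by (simp add: r_def)
  moreover have "(G' * r - G r) / (r * r) * (h \<bullet> sgn x) = (G' - G r / r) / r\<^sup>2 * (h \<bullet> x)" for h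
    using r by (simp add: sgn_div_norm flip: r_def) (simp add: field_simps power2_eq_square)
  ultimately have "((\<lambda>y. (G (norm y) / norm y) *\<^sub>R y) has_derivative
      (\<lambda>h. (G r / r) *\<^sub>R h + ((G' - G r / r) / r\<^sup>2 * (h \<bullet> x)) *\<^sub>R x)) (at x)" by simp
  moreover have "(\<lambda>h. (G r / r) *\<^sub>R h + ((G' - G r / r) / r\<^sup>2 * (h \<bullet> x)) *\<^sub>R x)
      = blinfun_apply (scaling_plus_projection (G r / r) ((G' - G r / r) / r\<^sup>2) x)"
    by (rule ext) simp
  ultimately show ?thesis unfolding radial_field_def[abs_def] r_def by simp
qed

lemma radial_field_has_derivative_at_0:
  assumes "((\<lambda>r. G r / r) \<longlongrightarrow> L) (at_right 0)"
  shows "(radial_field G has_derivative blinfun_apply (scaling_plus_projection L 0 0))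
    (at (0::'a::euclidean_space))"
  unfolding has_derivative_at
proof
  show "bounded_linear (blinfun_apply (scaling_plus_projection L 0 (0::'a)))"
    by (rule blinfun.bounded_linear_right)
  have "((\<lambda>h. G (norm h) / norm h) \<longlongrightarrow> L) (at (0::'a))"
    by (rule filterlim_compose[OF assms filterlim_norm_at_right_0])
  then have "((\<lambda>h. \<bar>G (norm h) / norm h - L\<bar>) \<longlongrightarrow> 0) (at (0::'a))"
    by (simp add: LIM_zero tendsto_rabs_zero)
  moreover have "\<forall>\<^sub>F h in at (0::'a). \<bar>G (norm h) / norm h - L\<bar> =
      norm (radial_field G (0 + h) - radial_field G 0 - scaling_plus_projection L 0 0 h) / norm h"
    unfolding eventually_at_filter
  proof (intro always_eventually allI impI)
    fix h :: 'a assume "h \<noteq> 0"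
    have "radial_field G (0 + h) - radial_field G 0 - scaling_plus_projection L 0 0 h
        = (G (norm h) / norm h - L) *\<^sub>R h"
      by (simp add: radial_field_def scaleR_diff_left)
    with \<open>h \<noteq> 0\<close> show "\<bar>G (norm h) / norm h - L\<bar> =
      norm (radial_field G (0 + h) - radial_field G 0 - scaling_plus_projection L 0 0 h) / norm h"
      by simp
  qed
  ultimately show "(\<lambda>h. norm (radial_field G (0 + h) - radial_field G 0 -
      scaling_plus_projection L 0 0 h) / norm h) \<midarrow>(0::'a)\<rightarrow> 0"
    by (rule Lim_transform_eventually)
qed

text \<open>
  The trace of \<open>a I + b x x\<^sup>T\<close>. For a radial field away from the origin it gives \<open>G' + (N-1) G/r\<close>, and at the
  origin \<open>N\<close> times the limit of \<open>G/r\<close>.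
\<close>

lemma divergence_eq_of_derivative:
  fixes x :: "'a::euclidean_space"
  assumes "(F has_derivative blinfun_apply (scaling_plus_projection a b x)) (at x)"
  shows "divergence F x = real DIM('a) * a + b * (norm x)\<^sup>2"
proof -
  have "divergence F x = (\<Sum>i\<in>Basis. (scaling_plus_projection a b x) i \<bullet> i)"
    unfolding divergence_def frechet_derivative_at[OF assms, symmetric] ..
  also have "\<dots> = (\<Sum>i\<in>Basis. a + b * ((x \<bullet> i) * (x \<bullet> i)))"
    by (intro sum.cong) (auto simp: inner_add_left inner_commute[of _ x])
  also have "\<dots> = real DIM('a) * a + b * (norm x)\<^sup>2"
    by (simp add: sum.distrib power2_norm_eq_inner flip: sum_distrib_left euclidean_inner)
  finally show ?thesis .
qed

lemma grad_eqI:
  assumes "GDERIV f x :> D"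
  shows "grad f x = D"
  unfolding grad_def
proof (rule the_equality[where P = "\<lambda>D. GDERIV f x :> D", OF assms])
  fix E assume "GDERIV f x :> E"
  then have "(\<lambda>h. h \<bullet> E) = (\<lambda>h. h \<bullet> D)"
    using assms unfolding gderiv_def by (rule has_derivative_unique)
  then show "E = D" by (metis inner_commute vector_eq_ldot)
qed

lemma GDERIV_radial:
  fixes x :: "'a::euclidean_space"
  assumes f: "\<And>y. y \<in> ball 0 R \<Longrightarrow> f y = \<phi> (norm y)"
    and x: "x \<in> ball 0 R" "x \<noteq> 0" and \<phi>: "(\<phi> has_real_derivative G (norm x)) (at (norm x))"
  shows "GDERIV f x :> radial_field G x"
proof -
  have "(\<phi> has_derivative (\<lambda>h. G (norm x) * h)) (at (norm x))"
    using \<phi> by (simp add: has_field_derivative_def)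
  from has_derivative_compose[OF has_derivative_norm[OF x(2)] this]
  have "((\<lambda>y. \<phi> (norm y)) has_derivative (\<lambda>h. h \<bullet> radial_field G x)) (at x)"
    by (simp add: radial_field_def sgn_div_norm divide_inverse mult_ac)
  then show ?thesis unfolding gderiv_def
    by (rule has_derivative_transform_within_open[of _ _ _ _ "ball 0 R"]) (use x f in auto)
qed

lemma GDERIV_radial_at_0:
  fixes f :: "'a::euclidean_space \<Rightarrow> real"
  assumes f: "\<And>y. y \<in> ball 0 R \<Longrightarrow> f y = \<phi> (norm y)" and R: "0 < R"
    and lim: "((\<lambda>r. (\<phi> r - \<phi> 0) / r) \<longlongrightarrow> 0) (at_right 0)"
  shows "GDERIV f 0 :> 0"
  unfolding gderiv_def has_derivative_at
proof
  show "bounded_linear (\<lambda>h::'a. h \<bullet> 0)" by simp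
  have "((\<lambda>h. (\<phi> (norm h) - \<phi> 0) / norm h) \<longlongrightarrow> 0) (at (0::'a))"
    by (rule filterlim_compose[OF lim filterlim_norm_at_right_0])
  then have "((\<lambda>h. \<bar>(\<phi> (norm h) - \<phi> 0) / norm h\<bar>) \<longlongrightarrow> 0) (at (0::'a))"
    by (rule tendsto_rabs_zero)
  moreover have "\<forall>\<^sub>F h in at (0::'a). \<bar>(\<phi> (norm h) - \<phi> 0) / norm h\<bar> =
      norm (f (0 + h) - f 0 - h \<bullet> 0) / norm h"
    using eventually_at_ball[OF R, of 0 UNIV] by eventually_elim (use R in \<open>simp add: f\<close>)
  ultimately show "(\<lambda>h. norm (f (0 + h) - f 0 - h \<bullet> 0) / norm h) \<midarrow>0\<rightarrow> 0"
    by (rule Lim_transform_eventually)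
qed

text \<open>
  At the origin, limits of the profile and of \<open>G = \<phi>'\<close> take the place of derivatives. That \<open>G\<close> tends to \<open>0\<close> there is
  what makes \<open>f\<close> differentiable at \<open>0\<close> instead of having the shape of a cone.
\<close>

locale radial_function =
  fixes R :: real and f :: "'a::euclidean_space \<Rightarrow> real" and \<phi> G G' :: "real \<Rightarrow> real"
  assumes R_pos: "0 < R"
    and f_eq: "\<And>y. y \<in> ball 0 R \<Longrightarrow> f y = \<phi> (norm y)"
    and d\<phi>: "\<And>r. 0 < r \<Longrightarrow> r < R \<Longrightarrow> (\<phi> has_real_derivative G r) (at r)"
    and dG: "\<And>r. 0 < r \<Longrightarrow> r < R \<Longrightarrow> (G has_real_derivative G' r) (at r)"
    and \<phi>_0: "(\<phi> \<longlongrightarrow> \<phi> 0) (at_right 0)"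
    and G_0: "(G \<longlongrightarrow> 0) (at_right 0)"
begin

lemma GDERIV_f:
  assumes x: "x \<in> ball 0 R"
  shows "GDERIV f x :> radial_field G x"
proof (cases "x = 0")
  case True
  have "((\<lambda>r. (\<phi> r - \<phi> 0) / r) \<longlongrightarrow> 0) (at_right 0)"
  proof (rule lhopital_right_0[where f' = G and g' = "\<lambda>_. 1"])
    show "((\<lambda>r. \<phi> r - \<phi> 0) \<longlongrightarrow> 0) (at_right 0)" using \<phi>_0 by (rule LIM_zero)
    show "\<forall>\<^sub>F r in at_right 0. ((\<lambda>r. \<phi> r - \<phi> 0) has_real_derivative G r) (at r)"
      using eventually_at_right_0_less[OF R_pos] by eventually_elim (auto intro!: derivative_eq_intros d\<phi>)
    show "\<forall>\<^sub>F x in at_right 0. (x::real) \<noteq> 0" by (simp add: eventually_at_filter)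
  qed (use G_0 in \<open>auto intro!: tendsto_ident_at\<close>)
  then show ?thesis using True R_pos by (auto intro!: GDERIV_radial_at_0[where \<phi> = \<phi> and R = R] f_eq)
next
  case False
  then show ?thesis using x by (intro GDERIV_radial[where \<phi> = \<phi> and R = R] f_eq d\<phi>) auto
qed

lemma grad_f: "x \<in> ball 0 R \<Longrightarrow> grad f x = radial_field G x"
  by (rule grad_eqI[OF GDERIV_f])

lemma grad_f_has_derivative:
  assumes x: "x \<in> ball 0 R" "x \<noteq> 0"
  shows "(grad f has_derivative blinfun_apply (scaling_plus_projection (G (norm x) / norm x)
        ((G' (norm x) - G (norm x) / norm x) / (norm x)\<^sup>2) x)) (at x)"
proof (rule has_derivative_transform_within_open[of _ _ _ _ "ball 0 R"])
  show "(radial_field G has_derivative blinfun_apply (scaling_plus_projection (G (norm x) / norm x)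
        ((G' (norm x) - G (norm x) / norm x) / (norm x)\<^sup>2) x)) (at x)"
    using x by (intro radial_field_has_derivative dG) auto
qed (use x grad_f in auto)

lemma C1_on_ball: "C1_on (ball 0 R) f"
  unfolding C1_on_def
proof
  show "\<forall>x\<in>ball 0 R. f differentiable (at x)"
    using GDERIV_f unfolding gderiv_def differentiable_def by blast
  have "isCont (grad f) x" if x: "x \<in> ball 0 R" for x
  proof (cases "x = 0")
    case True
    have "((\<lambda>h. \<bar>G (norm h)\<bar>) \<longlongrightarrow> 0) (at (0::'a))"
      by (rule tendsto_rabs_zero[OF filterlim_compose[OF G_0 filterlim_norm_at_right_0]])
    moreover have "\<forall>\<^sub>F h in at (0::'a). norm (grad f h) = \<bar>G (norm h)\<bar>"
      using eventually_at_ball'[OF R_pos, of 0 UNIV]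
      by eventually_elim (simp add: grad_f radial_field_def)
    ultimately have "((\<lambda>h. norm (grad f h)) \<longlongrightarrow> 0) (at 0)"
      by (simp add: tendsto_cong)
    then show ?thesis using True R_pos
      by (simp add: isCont_def tendsto_norm_zero_iff grad_f)
  qed (use grad_f_has_derivative[OF x] has_derivative_continuous in blast)
  then show "continuous_on (ball 0 R) (grad f)" by (simp add: continuous_at_imp_continuous_on)
qed

definition "hessian_op x = scaling_plus_projection (G (norm x) / norm x)
        ((G' (norm x) - G (norm x) / norm x) / (norm x)\<^sup>2) (x::'a)"

lemma continuous_on_hessian_op:
  assumes "continuous_on {0<..<R} G'"
  shows "continuous_on (ball 0 R - {0}) hessian_op"
proof -
  have G: "continuous_on {0<..<R} G"
    using dG by (intro DERIV_continuous_on[of _ _ G'])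
      (auto intro: has_field_derivative_at_within)
  have "continuous_on (ball 0 R - {0}) (\<lambda>x::'a. G (norm x))"
    "continuous_on (ball 0 R - {0}) (\<lambda>x::'a. G' (norm x))"
    by (rule continuous_on_compose2[OF G continuous_on_norm_id]
        continuous_on_compose2[OF assms continuous_on_norm_id]; force)+
  then show ?thesis
    unfolding hessian_op_def[abs_def] scaling_plus_projection_def
    by (intro continuous_intros bounded_linear.continuous_on[OF bounded_linear_blinfun_scaleR_left]
        bounded_linear.continuous_on[OF bounded_linear_blinfun_inner_left]
        bounded_bilinear.continuous_on[OF bounded_bilinear_blinfun_compose]) auto
qed

lemma C2_on_punctured_ball:
  assumes "continuous_on {0<..<R} G'"
  shows "C2_on (ball 0 R - {0}) f"
  unfolding C2_on_def
proof
  show "C1_on (ball 0 R - {0}) f"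
    using C1_on_ball unfolding C1_on_def by (auto intro: continuous_on_subset)
  show "\<exists>H. continuous_on (ball 0 R - {0}) H \<and>
      (\<forall>x\<in>ball 0 R - {0}. (grad f has_derivative blinfun_apply (H x)) (at x))"
    using continuous_on_hessian_op[OF assms] grad_f_has_derivative
    unfolding hessian_op_def by blast
qed

text \<open>
  The Hessian away from the origin is \<open>(G/r) I + (G' - G/r) x x\<^sup>T/r\<^sup>2\<close>. Its second part has norm at most
  \<open>|G' - G/r|\<close>. So the Hessian extends continuously by \<open>L I\<close> if \<open>G/r\<close> and \<open>G'\<close> have the same limit \<open>L\<close>.
\<close>

lemma C2_on_ball:
  assumes cont: "continuous_on {0<..<R} G'"
    and L: "((\<lambda>r. G r / r) \<longlongrightarrow> L) (at_right 0)" and L': "(G' \<longlongrightarrow> L) (at_right 0)"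
  shows "C2_on (ball 0 R) f"
  unfolding C2_on_def
proof (intro conjI exI[of _ "\<lambda>x. if x = 0 then scaling_plus_projection L 0 0 else hessian_op x"] ballI)
  let ?H = "\<lambda>x. if x = 0 then scaling_plus_projection L 0 0 else hessian_op x"
  show "C1_on (ball 0 R) f" by (rule C1_on_ball)
  show "(grad f has_derivative blinfun_apply (?H x)) (at x)" if x: "x \<in> ball 0 R" for x
  proof (cases "x = 0")
    case True
    have "(grad f has_derivative blinfun_apply (scaling_plus_projection L 0 0)) (at 0)"
      by (rule has_derivative_transform_within_open[OF radial_field_has_derivative_at_0[OF L], of "ball 0 R"])
        (use R_pos grad_f in auto)
    then show ?thesis using True by simp
  next
    case False
    then show ?thesis using grad_f_has_derivative[OF x] by (simp add: hessian_op_def)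
  qed
  have "isCont ?H x" if x: "x \<in> ball 0 R" for x
  proof (cases "x = 0")
    case True
    have "(hessian_op \<longlongrightarrow> scaling_plus_projection L 0 0) (at (0::'a))"
    proof (rule Lim_null[THEN iffD2], rule Lim_null_comparison)
      have lim: "((\<lambda>h. \<bar>G (norm h) / norm h - L\<bar> + \<bar>G' (norm h) - G (norm h) / norm h\<bar>) \<longlongrightarrow> \<bar>L - L\<bar> + \<bar>L - L\<bar>) (at (0::'a))"
        by (intro tendsto_intros filterlim_compose[OF L filterlim_norm_at_right_0]
            filterlim_compose[OF L' filterlim_norm_at_right_0])
      then show "((\<lambda>h. \<bar>G (norm h) / norm h - L\<bar> + \<bar>G' (norm h) - G (norm h) / norm h\<bar>) \<longlongrightarrow> 0) (at (0::'a))"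
        by simp
      show "\<forall>\<^sub>F h in at (0::'a). norm (hessian_op h - scaling_plus_projection L 0 0)
          \<le> \<bar>G (norm h) / norm h - L\<bar> + \<bar>G' (norm h) - G (norm h) / norm h\<bar>"
        unfolding eventually_at_filter
      proof (intro always_eventually allI impI)
        fix h :: 'a assume h: "h \<noteq> 0"
        let ?a = "G (norm h) / norm h - L" and ?b = "G' (norm h) - G (norm h) / norm h"
        show "norm (hessian_op h - scaling_plus_projection L 0 0) \<le> \<bar>?a\<bar> + \<bar>?b\<bar>"
        proof (rule norm_blinfun_bound)
          fix y
          have "norm ((hessian_op h - scaling_plus_projection L 0 0) y)
              = norm (?a *\<^sub>R y + (?b / (norm h)\<^sup>2 * (y \<bullet> h)) *\<^sub>R h)"
            by (simp add: hessian_op_def blinfun.diff_left scaleR_diff_left[of _ _ y] algebra_simps)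
          also have "\<dots> \<le> \<bar>?a\<bar> * norm y + \<bar>?b\<bar> / (norm h)\<^sup>2 * \<bar>y \<bullet> h\<bar> * norm h"
            by (rule norm_triangle_le) (simp add: abs_mult)
          also have "\<dots> \<le> \<bar>?a\<bar> * norm y + \<bar>?b\<bar> / (norm h)\<^sup>2 * (norm y * norm h) * norm h"
            by (intro add_left_mono mult_right_mono mult_left_mono Cauchy_Schwarz_ineq2) auto
          also have "\<dots> = (\<bar>?a\<bar> + \<bar>?b\<bar>) * norm y"
            using h by (simp add: power2_eq_square distrib_right)
          finally show "norm ((hessian_op h - scaling_plus_projection L 0 0) y) \<le> (\<bar>?a\<bar> + \<bar>?b\<bar>) * norm y" .
        qed simp
      qed
    qed
    moreover have "\<forall>\<^sub>F h in at (0::'a). hessian_op h = ?H h" by (simp add: eventually_at_filter)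
    ultimately show ?thesis using True by (simp add: isCont_def tendsto_cong)
  next
    case False
    have "isCont hessian_op x"
      using continuous_on_hessian_op[OF cont] x False
      by (simp add: continuous_on_eq_continuous_at open_delete)
    moreover have "\<forall>\<^sub>F y in nhds x. hessian_op y = ?H y"
      using t1_space_nhds[OF False] by eventually_elim simp
    ultimately show ?thesis by (simp add: isCont_cong)
  qed
  then show "continuous_on (ball 0 R) ?H" by (rule continuous_at_imp_continuous_on[rule_format])
qed

lemma p_flux_f:
  assumes G_pos: "\<And>r. 0 < r \<Longrightarrow> r < R \<Longrightarrow> 0 < G r" and x: "x \<in> ball 0 R"
  shows "p_flux p f x = radial_field (\<lambda>r. G r powr (p - 1)) x"
proof (cases "x = 0")
  case False
  with x G_pos have "0 < G (norm x)" by simp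
  moreover have "G (norm x) powr (p - 1) = npow (G (norm x)) (p - 2) * G (norm x)"
    using \<open>0 < G (norm x)\<close> by (simp add: npow_def powr_mult_base flip: mult.commute[of "G (norm x)"])
  ultimately show ?thesis using False by (simp add: p_flux_def grad_f[OF x] radial_field_def)
qed (use x grad_f in \<open>simp add: p_flux_def\<close>)

lemma p_laplacian_f:
  assumes G_pos: "\<And>r. 0 < r \<Longrightarrow> r < R \<Longrightarrow> 0 < G r" and x: "x \<in> ball 0 R" "x \<noteq> 0"
    and \<Phi>: "((\<lambda>r. G r powr (p - 1)) has_real_derivative \<Phi>') (at (norm x))"
  shows "p_flux p f differentiable (at x)"
    and "p_laplacian p f x = \<Phi>' + (real DIM('a) - 1) / norm x * G (norm x) powr (p - 1)"
proof -
  let ?\<Phi> = "\<lambda>r. G r powr (p - 1)"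
  have d: "(p_flux p f has_derivative blinfun_apply (scaling_plus_projection (?\<Phi> (norm x) / norm x)
        ((\<Phi>' - ?\<Phi> (norm x) / norm x) / (norm x)\<^sup>2) x)) (at x)"
    by (rule has_derivative_transform_within_open[OF radial_field_has_derivative[OF x(2) \<Phi>], of "ball 0 R"])
      (use x p_flux_f G_pos in auto)
  then show "p_flux p f differentiable (at x)" by (auto simp: differentiable_def)
  show "p_laplacian p f x = \<Phi>' + (real DIM('a) - 1) / norm x * G (norm x) powr (p - 1)"
    unfolding p_laplacian_def divergence_eq_of_derivative[OF d] using x(2) by (simp add: field_simps)
qed

lemma p_laplacian_f_at_0:
  assumes G_pos: "\<And>r. 0 < r \<Longrightarrow> r < R \<Longrightarrow> 0 < G r"
    and L: "((\<lambda>r. G r powr (p - 1) / r) \<longlongrightarrow> L) (at_right 0)"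
  shows "p_flux p f differentiable (at 0)" and "p_laplacian p f 0 = real DIM('a) * L"
proof -
  have d: "(p_flux p f has_derivative blinfun_apply (scaling_plus_projection L 0 0)) (at 0)"
    by (rule has_derivative_transform_within_open[OF radial_field_has_derivative_at_0[OF L], of "ball 0 R"])
      (use R_pos p_flux_f G_pos in auto)
  then show "p_flux p f differentiable (at 0)" by (auto simp: differentiable_def)
  show "p_laplacian p f 0 = real DIM('a) * L"
    unfolding p_laplacian_def divergence_eq_of_derivative[OF d] by simp
qed

end

section \<open>From the radial system to the ball\<close>

text \<open>
  L'Hospital's rule for the quotient of \<open>r\<^sup>A y\<close> and \<open>r\<^sup>A\<^sup>+\<^sup>1\<^sup>+\<^sup>b\<close>: the damping term cancels in the derivative of
  the numerator. The equation then gives the limit for the derivative of \<open>y\<close>.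
\<close>

lemma damped_asymptotics:
  fixes y h :: "real \<Rightarrow> real"
  assumes A: "0 < A" and b: "0 \<le> b" and R: "0 < R"
    and der: "\<And>r. 0 < r \<Longrightarrow> r < R \<Longrightarrow> (y has_real_derivative h r - A / r * y r) (at r)"
    and y0: "(y \<longlongrightarrow> 0) (at_right 0)"
    and h: "((\<lambda>r. h r / r powr b) \<longlongrightarrow> \<eta>) (at_right 0)"
  shows "((\<lambda>r. y r / r powr (b + 1)) \<longlongrightarrow> \<eta> / (A + 1 + b)) (at_right 0)"
    and "((\<lambda>r. (h r - A / r * y r) / r powr b) \<longlongrightarrow> (b + 1) * (\<eta> / (A + 1 + b))) (at_right 0)"
proof -
  note ev = eventually_at_right_0_less[OF R]
  have "((\<lambda>r. (r powr A * y r) / r powr (A + 1 + b)) \<longlongrightarrow> \<eta> / (A + 1 + b)) (at_right 0)"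
  proof (rule lhopital_right_0[where f' = "\<lambda>r. r powr A * h r" and g' = "\<lambda>r. (A + 1 + b) * r powr (A + b)"])
    show "((\<lambda>r. r powr A * y r) \<longlongrightarrow> 0) (at_right 0)"
      using tendsto_mult[OF tendsto_powr_zero_at_right[OF A] y0] by simp
    show "((\<lambda>r. r powr (A + 1 + b)) \<longlongrightarrow> 0) (at_right 0)"
      using A b by (intro tendsto_powr_zero_at_right) auto
    show "\<forall>\<^sub>F r in at_right 0. r powr (A + 1 + b) \<noteq> 0"
      "\<forall>\<^sub>F r in at_right 0. (A + 1 + b) * r powr (A + b) \<noteq> 0"
      using ev by (eventually_elim, use A b in simp)+
    show "\<forall>\<^sub>F r in at_right 0. ((\<lambda>r. r powr A * y r) has_real_derivative r powr A * h r) (at r)"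
      using ev
    proof eventually_elim
      case (elim r)
      have "((\<lambda>r. r powr A * y r) has_real_derivative
          A * r powr (A - 1) * y r + (h r - A / r * y r) * r powr A) (at r)"
        using elim by (intro DERIV_mult has_real_derivative_powr der) auto
      moreover have "r powr (A - 1) = r powr A / r" using elim by (simp add: powr_diff)
      ultimately show ?case by (simp add: algebra_simps)
    qed
    show "\<forall>\<^sub>F r in at_right 0. ((\<lambda>r. r powr (A + 1 + b)) has_real_derivative (A + 1 + b) * r powr (A + b)) (at r)"
      using ev
    proof eventually_elim
      case (elim r)
      then show ?case using has_real_derivative_powr[of r "A + 1 + b"] by (simp add: algebra_simps)
    qed
    have "((\<lambda>r. h r / r powr b / (A + 1 + b)) \<longlongrightarrow> \<eta> / (A + 1 + b)) (at_right 0)"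
      using A b by (intro tendsto_divide h tendsto_const) auto
    moreover have "\<forall>\<^sub>F r in at_right 0. h r / r powr b / (A + 1 + b)
        = r powr A * h r / ((A + 1 + b) * r powr (A + b))"
      using ev by eventually_elim (simp add: powr_add)
    ultimately show "((\<lambda>r. r powr A * h r / ((A + 1 + b) * r powr (A + b))) \<longlongrightarrow> \<eta> / (A + 1 + b)) (at_right 0)"
      by (rule Lim_transform_eventually)
  qed
  moreover have "\<forall>\<^sub>F r in at_right 0. (r powr A * y r) / r powr (A + 1 + b) = y r / r powr (b + 1)"
    using ev by eventually_elim (simp add: powr_add)
  ultimately show y: "((\<lambda>r. y r / r powr (b + 1)) \<longlongrightarrow> \<eta> / (A + 1 + b)) (at_right 0)"
    by (rule Lim_transform_eventually)
  have "((\<lambda>r. h r / r powr b - A * (y r / r powr (b + 1))) \<longlongrightarrow> \<eta> - A * (\<eta> / (A + 1 + b))) (at_right 0)"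
    by (intro tendsto_intros h y)
  moreover have "\<eta> - A * (\<eta> / (A + 1 + b)) = (b + 1) * (\<eta> / (A + 1 + b))"
    using A b by (simp add: field_simps)
  moreover have "\<forall>\<^sub>F r in at_right 0. h r / r powr b - A * (y r / r powr (b + 1)) = (h r - A / r * y r) / r powr b"
    using ev by eventually_elim (simp add: powr_add diff_divide_distrib)
  ultimately show "((\<lambda>r. (h r - A / r * y r) / r powr b) \<longlongrightarrow> (b + 1) * (\<eta> / (A + 1 + b))) (at_right 0)"
    by (simp add: tendsto_cong)
qed

text \<open>
  The profile of \<open>u'\<close>, \<open>v'\<close> and of the fluxes is a power \<open>y\<^sup>\<rho>\<close>, where \<open>y \<sim> \<zeta> r\<^sup>b\<^sup>+\<^sup>1\<close>. The assumption that \<open>y\<^sup>\<rho>\<close> vanishes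
  at least linearly is the condition for second derivatives to stay bounded. The limits of \<open>y\<^sup>\<rho>/r\<close> and of
  \<open>(y\<^sup>\<rho>)'\<close> agree: they differ by the factor \<open>(b+1)\<rho>\<close>, which is \<open>1\<close> in the only case of a nonzero limit.
\<close>

lemma power_asymptotics:
  fixes y y' :: "real \<Rightarrow> real"
  assumes R: "0 < R" and pos: "\<And>r. 0 < r \<Longrightarrow> r < R \<Longrightarrow> 0 < y r"
    and y: "((\<lambda>r. y r / r powr (b + 1)) \<longlongrightarrow> \<zeta>) (at_right 0)"
    and y': "((\<lambda>r. y' r / r powr b) \<longlongrightarrow> (b + 1) * \<zeta>) (at_right 0)"
    and \<zeta>: "0 < \<zeta>" and e: "1 \<le> (b + 1) * \<rho>"
  defines "L \<equiv> if (b + 1) * \<rho> = 1 then \<zeta> powr \<rho> else 0"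
  shows "((\<lambda>r. y r powr \<rho> / r) \<longlongrightarrow> L) (at_right 0)"
    and "((\<lambda>r. \<rho> * y r powr (\<rho> - 1) * y' r) \<longlongrightarrow> L) (at_right 0)"
proof -
  note ev = eventually_at_right_0_less[OF R]
  define E :: real where "E = (if (b + 1) * \<rho> = 1 then 1 else 0)"
  have E: "((\<lambda>r. r powr ((b + 1) * \<rho> - 1)) \<longlongrightarrow> E) (at_right 0)"
  proof (cases "(b + 1) * \<rho> = 1")
    case True
    have "\<forall>\<^sub>F r in at_right 0. 1 = r powr ((b + 1) * \<rho> - 1)"
      using ev by eventually_elim (simp add: True)
    then show ?thesis using True unfolding E_def
      by (simp add: Lim_transform_eventually[OF tendsto_const])
  next
    case False
    then show ?thesis unfolding E_def using e
      by (auto intro!: tendsto_powr_zero_at_right)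
  qed
  have "((\<lambda>r. (y r / r powr (b + 1)) powr \<rho> * r powr ((b + 1) * \<rho> - 1)) \<longlongrightarrow> \<zeta> powr \<rho> * E) (at_right 0)"
    using \<zeta> by (intro tendsto_mult tendsto_powr y tendsto_const E) auto
  moreover have "\<forall>\<^sub>F r in at_right 0. (y r / r powr (b + 1)) powr \<rho> * r powr ((b + 1) * \<rho> - 1) = y r powr \<rho> / r"
    using ev
  proof eventually_elim
    case (elim r)
    then show ?case using pos[of r] by (simp add: powr_divide powr_powr powr_diff)
  qed
  moreover have "\<zeta> powr \<rho> * E = L" by (simp add: L_def E_def)
  ultimately show "((\<lambda>r. y r powr \<rho> / r) \<longlongrightarrow> L) (at_right 0)"
    by (simp add: tendsto_cong)
  have "((\<lambda>r. \<rho> * (y r / r powr (b + 1)) powr (\<rho> - 1) * (y' r / r powr b) * r powr ((b + 1) * \<rho> - 1))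
      \<longlongrightarrow> \<rho> * \<zeta> powr (\<rho> - 1) * ((b + 1) * \<zeta>) * E) (at_right 0)"
    using \<zeta> by (intro tendsto_mult tendsto_powr y y' tendsto_const E) auto
  moreover have "\<forall>\<^sub>F r in at_right 0. \<rho> * (y r / r powr (b + 1)) powr (\<rho> - 1) * (y' r / r powr b) * r powr ((b + 1) * \<rho> - 1)
      = \<rho> * y r powr (\<rho> - 1) * y' r"
    using ev
  proof eventually_elim
    case (elim r)
    have 1: "(y r / r powr (b + 1)) powr (\<rho> - 1) = y r powr (\<rho> - 1) * r powr (- ((b + 1) * (\<rho> - 1)))"
      using elim pos[of r] by (simp add: powr_divide powr_powr powr_minus_divide)
    have 2: "y' r / r powr b = y' r * r powr (- b)" by (simp add: powr_minus_divide)
    have 3: "r powr (- ((b + 1) * (\<rho> - 1))) * (r powr (- b) * r powr ((b + 1) * \<rho> - 1)) = 1"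
    proof -
      have "- ((b + 1) * (\<rho> - 1)) + (- b + ((b + 1) * \<rho> - 1)) = 0" by (simp add: algebra_simps)
      then show ?thesis using elim by (simp only: powr_add[symmetric]) simp
    qed
    have "\<rho> * (P * X) * (D * Y) * Z = \<rho> * P * D * (X * (Y * Z))" for P X D Y Z :: real
      by (simp only: mult.assoc mult.left_commute)
    then show ?case unfolding 1 2 by (simp only: 3 mult_1_right)
  qed
  moreover have "\<rho> * \<zeta> powr (\<rho> - 1) * ((b + 1) * \<zeta>) * E = L"
  proof -
    have e: "\<zeta> powr (\<rho> - 1) * \<zeta> = \<zeta> powr \<rho>" using \<zeta> by (simp add: powr_diff)
    have "\<rho> * x * ((b + 1) * \<zeta>) * E = (b + 1) * \<rho> * (x * \<zeta>) * E" for x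
      by (simp only: mult.assoc mult.left_commute)
    from this[of "\<zeta> powr (\<rho> - 1)"]
    have "\<rho> * \<zeta> powr (\<rho> - 1) * ((b + 1) * \<zeta>) * E = (b + 1) * \<rho> * \<zeta> powr \<rho> * E"
      unfolding e .
    also have "\<dots> = L" by (simp add: L_def E_def)
    finally show ?thesis .
  qed
  ultimately show "((\<lambda>r. \<rho> * y r powr (\<rho> - 1) * y' r) \<longlongrightarrow> L) (at_right 0)"
    by (simp add: tendsto_cong)
qed

context radial_solution
begin

definition "w_coeff = c * v 0 powr m / (A + 1)"
definition "z_coeff = v 0 powr \<beta> * w_coeff powr \<sigma> / (B + 1 + \<sigma>)"

lemma w_coeff_pos: "0 < w_coeff"
  unfolding w_coeff_def using c_pos v0_pos A_pos by simp

lemma z_coeff_pos: "0 < z_coeff"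
  unfolding z_coeff_def using w_coeff_pos v0_pos B_pos sigma_pos by simp

lemma w_asymptotics:
  "((\<lambda>r. w r / r powr (0 + 1)) \<longlongrightarrow> w_coeff) (at_right 0)"
  "((\<lambda>r. w' r / r powr 0) \<longlongrightarrow> (0 + 1) * w_coeff) (at_right 0)"
proof -
  have "((\<lambda>r. c * v r powr m) \<longlongrightarrow> c * v 0 powr m) (at_right 0)"
    using v0_pos by (intro tendsto_intros v0) auto
  moreover have "\<forall>\<^sub>F r in at_right 0. c * v r powr m = c * v r powr m / r powr 0"
    using eventually_at_right_0_less[OF R_pos] by eventually_elim simp
  ultimately have "((\<lambda>r. c * v r powr m / r powr 0) \<longlongrightarrow> c * v 0 powr m) (at_right 0)"
    by (rule Lim_transform_eventually)
  from damped_asymptotics[OF A_pos _ R_pos dw w0 this]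
  show "((\<lambda>r. w r / r powr (0 + 1)) \<longlongrightarrow> w_coeff) (at_right 0)"
    "((\<lambda>r. w' r / r powr 0) \<longlongrightarrow> (0 + 1) * w_coeff) (at_right 0)"
    by (simp_all add: w_coeff_def)
qed

lemma z_asymptotics:
  "((\<lambda>r. z r / r powr (\<sigma> + 1)) \<longlongrightarrow> z_coeff) (at_right 0)"
  "((\<lambda>r. z' r / r powr \<sigma>) \<longlongrightarrow> (\<sigma> + 1) * z_coeff) (at_right 0)"
proof -
  have "((\<lambda>r. v r powr \<beta> * (w r / r powr (0 + 1)) powr \<sigma>) \<longlongrightarrow> v 0 powr \<beta> * w_coeff powr \<sigma>) (at_right 0)"
    using v0_pos w_coeff_pos by (intro tendsto_mult tendsto_powr v0 w_asymptotics tendsto_const) auto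
  moreover have "\<forall>\<^sub>F r in at_right 0. v r powr \<beta> * (w r / r powr (0 + 1)) powr \<sigma>
      = v r powr \<beta> * w r powr \<sigma> / r powr \<sigma>"
    using eventually_at_right_0_less[OF R_pos]
  proof eventually_elim
    case (elim r)
    then show ?case using w_pos[of r] by (simp add: powr_divide)
  qed
  ultimately have "((\<lambda>r. v r powr \<beta> * w r powr \<sigma> / r powr \<sigma>) \<longlongrightarrow> v 0 powr \<beta> * w_coeff powr \<sigma>) (at_right 0)"
    by (rule Lim_transform_eventually)
  from damped_asymptotics[OF B_pos _ R_pos dz z0 this] sigma_pos
  show "((\<lambda>r. z r / r powr (\<sigma> + 1)) \<longlongrightarrow> z_coeff) (at_right 0)"
    "((\<lambda>r. z' r / r powr \<sigma>) \<longlongrightarrow> (\<sigma> + 1) * z_coeff) (at_right 0)"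
    by (simp_all add: z_coeff_def)
qed

lemma w_powr_has_derivative:
  "0 < r \<Longrightarrow> r < R \<Longrightarrow> ((\<lambda>r. w r powr e) has_real_derivative e * w r powr (e - 1) * w' r) (at r)"
  using DERIV_fun_powr[OF dw, of r e] w_pos by simp

lemma z_powr_has_derivative:
  "0 < r \<Longrightarrow> r < R \<Longrightarrow> ((\<lambda>r. z r powr e) has_real_derivative e * z r powr (e - 1) * z' r) (at r)"
  using DERIV_fun_powr[OF dz, of r e] z_pos by simp

lemma continuous_on_wzv:
  "continuous_on {0<..<R} w" "continuous_on {0<..<R} z" "continuous_on {0<..<R} v"
  using DERIV_isCont[OF dw] DERIV_isCont[OF dz] DERIV_isCont[OF dv]
  by (auto intro!: continuous_at_imp_continuous_on)

lemma continuous_on_derivative_of_w_powr: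
  "continuous_on {0<..<R} (\<lambda>r. e * w r powr (e - 1) * w' r)"
  by (intro continuous_intros continuous_on_wzv) (use w_pos v_pos in \<open>force+\<close>)

lemma continuous_on_derivative_of_z_powr:
  "continuous_on {0<..<R} (\<lambda>r. e * z r powr (e - 1) * z' r)"
  by (intro continuous_intros continuous_on_wzv) (use w_pos v_pos z_pos in \<open>force+\<close>)

end

text \<open>
  Used to recover \<open>u\<close> from its derivative; the initial value \<open>1\<close> makes \<open>u\<close> positive.
\<close>

lemma exists_primitive:
  fixes g :: "real \<Rightarrow> real"
  assumes R: "0 < R" and cont: "continuous_on {0<..<R} g" and g0: "(g \<longlongrightarrow> 0) (at_right 0)"
    and nonneg: "\<And>r. 0 < r \<Longrightarrow> r < R \<Longrightarrow> 0 \<le> g r"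
  shows "\<exists>U. U 0 = 1 \<and> (U \<longlongrightarrow> U 0) (at_right 0) \<and>
    (\<forall>r. 0 < r \<and> r < R \<longrightarrow> 1 \<le> U r \<and> (U has_real_derivative g r) (at r))"
proof -
  define h where "h = (\<lambda>r. if r = 0 then 0 else g r)"
  define U where "U = (\<lambda>r. 1 + integral {0..r} h)"
  have h_cont: "continuous_on {0..T} h" if "T < R" for T
    unfolding continuous_on_eq_continuous_within
  proof
    fix t assume t: "t \<in> {0..T}"
    show "continuous (at t within {0..T}) h"
    proof (cases "t = 0")
      case True
      have "(h \<longlongrightarrow> 0) (at_right 0)"
        using g0 by (rule Lim_transform_eventually) (simp add: eventually_at_filter h_def)
      then have "(h \<longlongrightarrow> 0) (at 0 within {0..T})"
      proof (cases "0 < T")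
        case True
        then show ?thesis using \<open>(h \<longlongrightarrow> 0) (at_right 0)\<close> by (simp add: at_within_Icc_at_right)
      qed (use t in \<open>auto simp: True not_less tendsto_def eventually_at_filter\<close>)
      then show ?thesis using True by (simp add: continuous_within h_def)
    next
      case False
      then have t: "0 < t" "t < R" using t that by auto
      then have "isCont g t" using cont by (simp add: continuous_on_eq_continuous_at)
      moreover have "\<forall>\<^sub>F s in nhds t. g s = h s"
        using t1_space_nhds[OF False] by eventually_elim (simp add: h_def)
      ultimately have "isCont h t" by (simp add: isCont_cong)
      then show ?thesis by (rule continuous_at_imp_continuous_at_within)
    qed
  qed
  have "U 0 = 1" by (simp add: U_def)
  moreover have "(U \<longlongrightarrow> U 0) (at_right 0)"
    unfolding U_def using R h_cont[of "R / 2"]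
    by (intro continuous_on_Icc_at_rightD[where b = "R / 2"] continuous_intros
        indefinite_integral_continuous_1 integrable_continuous_real) auto
  moreover have "1 \<le> U r \<and> (U has_real_derivative g r) (at r)" if r: "0 < r" "r < R" for r
  proof
    have "0 \<le> integral {0..r} h"
      using nonneg r by (intro integral_nonneg integrable_continuous_real h_cont) (auto simp: h_def)
    then show "1 \<le> U r" by (simp add: U_def)
    have "((\<lambda>r. integral {0..r} h) has_real_derivative h r) (at r)"
      using integral_has_real_derivative[OF h_cont[of "(r + R) / 2"], of r] r
      by (simp add: at_within_Icc_at)
    then show "(U has_real_derivative g r) (at r)"
      unfolding U_def using r by (auto intro!: derivative_eq_intros simp: h_def)
  qed
  ultimately show ?thesis by blast
qed

lemma radial_profile_eq:
  fixes f :: "'a::euclidean_space \<Rightarrow> real"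
  assumes "radial_on S f" and "\<And>y. norm y = norm x \<Longrightarrow> y \<in> S"
  shows "radial_profile f (norm x) = f x"
  unfolding radial_profile_def
proof (rule the_equality)
  show "\<forall>y. norm y = norm x \<longrightarrow> f y = f x" using assms unfolding radial_on_def by blast
qed auto

lemma not_constant_of_increasing_profile:
  fixes f :: "'a::euclidean_space \<Rightarrow> real"
  assumes f: "\<And>x. x \<in> ball 0 R \<Longrightarrow> f x = \<phi> (norm x)"
    and inc: "\<And>r. 0 < r \<Longrightarrow> r < R \<Longrightarrow> \<exists>D. (\<phi> has_real_derivative D) (at r) \<and> 0 < D"
    and W: "open W" "0 \<in> W" "W \<subseteq> ball 0 R"
  shows "\<not> f constant_on W"
proof
  assume "f constant_on W"
  then obtain k where k: "\<And>x. x \<in> W \<Longrightarrow> f x = k" unfolding constant_on_def by blast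
  from W obtain d where d: "0 < d" "ball 0 d \<subseteq> W" unfolding open_contains_ball by blast
  obtain e :: 'a where e: "norm e = 1" using nonempty_Basis norm_Basis by blast
  have val: "\<phi> r = k" "r < R" if "0 < r" "r < d" for r
  proof -
    have "r *\<^sub>R e \<in> W" using that d e by auto
    then show "\<phi> r = k" "r < R" using k[of "r *\<^sub>R e"] f[of "r *\<^sub>R e"] W that e by auto
  qed
  have "\<phi> (d / 3) < \<phi> (d / 2)"
  proof (rule DERIV_pos_imp_increasing[where f = \<phi>])
    fix r assume "d / 3 \<le> r" "r \<le> d / 2"
    then have r: "0 < r" "r < d" using d by auto
    show "\<exists>D. (\<phi> has_real_derivative D) (at r) \<and> 0 < D" by (rule inc[OF r(1) val(2)[OF r]])
  qed (use d in simp)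
  then show False using val(1)[of "d / 3"] val(1)[of "d / 2"] d by simp
qed

text \<open>
  The system in dimension \<open>N\<close>. The sublocale below records the coefficients and exponents that it has in the
  unknowns \<open>w = (u')\<^sup>\<kappa>\<close>, \<open>z = (v')\<^sup>p\<^sup>-\<^sup>1\<close> and \<open>v\<close>.
\<close>

locale elliptic_system =
  fixes N :: nat and p m q \<alpha> \<beta> :: real
  assumes N: "2 \<le> N" and p: "1 < p" and m: "0 < m" and q: "0 < q"
    and alpha: "0 \<le> \<alpha>" "\<alpha> < p - 1" and beta: "0 \<le> \<beta>" "\<beta> \<le> m"
begin

definition "\<kappa> = p - 1 - \<alpha>"

lemma kappa_pos: "0 < \<kappa>" using alpha by (simp add: \<kappa>_def)

sublocale radial_system "(real N - 1) * \<kappa> / (p - 1)" "real N - 1" "\<kappa> / (p - 1)" m \<beta> "q / \<kappa>" p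
  using N p m q beta kappa_pos by unfold_locales auto

lemma critical_exp_gt_1_iff: "1 < critical_exp \<longleftrightarrow> \<kappa> * (p - 1 - \<beta>) < m * q"
proof -
  have "1 < critical_exp \<longleftrightarrow> m * p + p - 1 - \<beta> < m * (q / \<kappa> + p)"
    unfolding critical_exp_def using denom_pos by (simp add: less_divide_eq)
  also have "\<dots> \<longleftrightarrow> p - 1 - \<beta> < m * q / \<kappa>" by (simp add: algebra_simps)
  also have "\<dots> \<longleftrightarrow> \<kappa> * (p - 1 - \<beta>) < m * q" using kappa_pos by (simp add: less_divide_eq mult.commute)
  finally show ?thesis .
qed

lemma critical_exp_threshold_iff:
  "1 / \<kappa> < critical_exp - 1 \<longleftrightarrow> m * p + (p - \<alpha>) * (p - 1 - \<beta>) < m * q"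
proof -
  have "critical_exp - 1 = (m * q / \<kappa> - (p - 1 - \<beta>)) / (m * p + p - 1 - \<beta>)"
    unfolding critical_exp_def using denom_pos by (simp add: divide_simps) (simp add: algebra_simps)
  then have "1 / \<kappa> < critical_exp - 1 \<longleftrightarrow> 1 / \<kappa> * (m * p + p - 1 - \<beta>) < m * q / \<kappa> - (p - 1 - \<beta>)"
    using denom_pos by (simp only: pos_less_divide_eq)
  also have "\<dots> \<longleftrightarrow> \<kappa> * (1 / \<kappa> * (m * p + p - 1 - \<beta>)) < \<kappa> * (m * q / \<kappa> - (p - 1 - \<beta>))"
    using kappa_pos by (simp only: mult_less_cancel_left_pos)
  also have "\<dots> \<longleftrightarrow> (m * p + p - 1 - \<beta>) + \<kappa> * (p - 1 - \<beta>) < m * q"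
    using kappa_pos by (simp add: right_diff_distrib) argo
  also have "(m * p + p - 1 - \<beta>) + \<kappa> * (p - 1 - \<beta>) = m * p + (p - \<alpha>) * (p - 1 - \<beta>)"
    by (simp add: \<kappa>_def algebra_simps)
  finally show ?thesis .
qed

abbreviation "radial_sol \<equiv>
  radial_solution ((real N - 1) * \<kappa> / (p - 1)) (real N - 1) (\<kappa> / (p - 1)) m \<beta> (q / \<kappa>) p"

text \<open>
  Away from the origin the equations are the radial system read backwards. At the origin the flux of
  \<open>u\<close> behaves like \<open>w\<^sup>(\<^sup>p\<^sup>-\<^sup>1\<^sup>)\<^sup>/\<^sup>\<kappa>\<close>, which is linear in \<open>r\<close> exactly for \<open>\<alpha> = 0\<close>: then its divergence is \<open>v(0)\<^sup>m\<close>, and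
  otherwise it is \<open>0\<close>, in agreement with the factor \<open>|\<nabla>u|\<^sup>\<alpha>\<close>. The two inequalities in the regularity
  condition are precisely the assumptions of \<open>power_asymptotics\<close> for \<open>u'\<close> and \<open>v'\<close>.
\<close>

theorem exists_pde_solution:
  assumes sol: "radial_sol R w z v" and dim: "DIM('a::euclidean_space) = N"
  shows "\<exists>(u :: 'a \<Rightarrow> real) V. nonconst_pos_radial_sol p m q \<alpha> \<beta> (ball 0 R) u V \<and>
    (\<forall>r. 0 < r \<and> r < R \<longrightarrow> radial_profile V r = v r \<and>
      (radial_profile u has_real_derivative w r powr (1 / \<kappa>)) (at r))"
proof -
  interpret S: radial_solution "(real N - 1) * \<kappa> / (p - 1)" "real N - 1" "\<kappa> / (p - 1)" m \<beta> "q / \<kappa>" p R w z v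
    by fact
  define \<rho> where "\<rho> = 1 / \<kappa>"
  have \<rho>: "0 < \<rho>" using kappa_pos by (simp add: \<rho>_def)
  define \<tau> where "\<tau> = 1 / (p - 1)"
  have \<tau>: "0 < \<tau>" using p by (simp add: \<tau>_def)
  have "continuous_on {0<..<R} (\<lambda>r. w r powr \<rho>)"
    using S.w_pos by (intro continuous_intros S.continuous_on_wzv) force+
  from exists_primitive[OF S.R_pos this S.w_powr_tendsto_0[OF \<rho>]]
  obtain U where U0: "U 0 = 1" "(U \<longlongrightarrow> U 0) (at_right 0)"
    and U: "\<And>r. 0 < r \<Longrightarrow> r < R \<Longrightarrow> 1 \<le> U r"
    and dU: "\<And>r. 0 < r \<Longrightarrow> r < R \<Longrightarrow> (U has_real_derivative w r powr \<rho>) (at r)" by auto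
  define u where "u = (\<lambda>x::'a. U (norm x))"
  define V where "V = (\<lambda>x::'a. v (norm x))"
  let ?G = "\<lambda>r. w r powr \<rho>" and ?G' = "\<lambda>r. \<rho> * w r powr (\<rho> - 1) * S.w' r"
  let ?H = "\<lambda>r. z r powr \<tau>" and ?H' = "\<lambda>r. \<tau> * z r powr (\<tau> - 1) * S.z' r"
  interpret u: radial_function R u U ?G ?G'
    by unfold_locales (rule S.R_pos, simp add: u_def, rule dU, assumption+,
        rule S.w_powr_has_derivative, assumption+, rule U0(2), rule S.w_powr_tendsto_0[OF \<rho>])
  interpret V: radial_function R V v ?H ?H'
    by unfold_locales (rule S.R_pos, simp add: V_def, rule S.dv[folded \<tau>_def], assumption+,
        rule S.z_powr_has_derivative, assumption+, rule S.v0, rule S.z_powr_tendsto_0[OF \<tau>])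
  have G_pos: "0 < ?G r" and H_pos: "0 < ?H r" if "0 < r" "r < R" for r
    using S.w_pos[OF that] S.z_pos[OF that] by simp_all
  have B: "0 < real N - 1" using N by simp
  have norm_grad: "norm (grad u x) = w (norm x) powr \<rho>" if "x \<in> ball 0 R" "x \<noteq> 0" for x
    using that u.grad_f[OF that(1)] by (simp add: radial_field_def)
  have u_reg: "solution_regularity p q \<alpha> (ball 0 R) u"
  proof -
    have "C2_on (ball 0 R) u" if "p \<le> 2 + \<alpha>"
    proof -
      have "1 \<le> (0 + 1) * \<rho>" using that kappa_pos by (simp add: \<rho>_def \<kappa>_def)
      from power_asymptotics[OF S.R_pos S.w_pos S.w_asymptotics S.w_coeff_pos this]
      show ?thesis by (intro u.C2_on_ball S.continuous_on_derivative_of_w_powr)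
    qed
    then show ?thesis unfolding solution_regularity_def
      using u.C1_on_ball u.C2_on_punctured_ball[OF S.continuous_on_derivative_of_w_powr] by auto
  qed
  have V_reg: "solution_regularity p q \<alpha> (ball 0 R) V"
  proof -
    have "C2_on (ball 0 R) V" if "(p - 2) * (p - 1 - \<alpha>) \<le> q"
    proof -
      have "p - 2 \<le> q / \<kappa>" using that kappa_pos by (simp add: \<kappa>_def pos_le_divide_eq)
      then have "1 \<le> (q / \<kappa> + 1) * \<tau>" using p by (simp add: \<tau>_def pos_le_divide_eq)
      from power_asymptotics[OF S.R_pos S.z_pos S.z_asymptotics S.z_coeff_pos this]
      show ?thesis by (intro V.C2_on_ball S.continuous_on_derivative_of_z_powr)
    qed
    then show ?thesis unfolding solution_regularity_def
      using V.C1_on_ball V.C2_on_punctured_ball[OF S.continuous_on_derivative_of_z_powr] by auto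
  qed
  have pos: "0 < u x \<and> 0 < V x" if "x \<in> ball 0 R" for x
    using that U[of "norm x"] S.v_pos[of "norm x"] U0 S.v0_pos unfolding u_def V_def
    by (cases "x = 0") (auto intro: less_le_trans[OF zero_less_one])
  have G_power: "?G r powr (p - 1) = w r powr ((p - 1) / \<kappa>)" for r
    by (simp add: powr_powr \<rho>_def)
  have u_eq: "p_flux p u differentiable (at x) \<and>
      p_laplacian p u x = npow (V x) m * npow (norm (grad u x)) \<alpha>" if x: "x \<in> ball 0 R" for x
  proof (cases "x = 0")
    case False
    define r where "r = norm x"
    have r: "0 < r" "r < R" using False x by (auto simp: r_def)
    note wr = S.w_pos[OF r] and vr = S.v_pos[OF r]
    have d: "((\<lambda>r. ?G r powr (p - 1)) has_real_derivative
        (p - 1) / \<kappa> * w r powr ((p - 1) / \<kappa> - 1) * S.w' r) (at (norm x))"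
      unfolding G_power r_def[symmetric] by (rule S.w_powr_has_derivative[OF r])
    have "(p - 1) / \<kappa> - 1 = \<alpha> / \<kappa>" using kappa_pos by (simp add: \<kappa>_def field_simps)
    moreover have "w r powr (\<alpha> / \<kappa>) * w r = w r powr ((p - 1) / \<kappa>)"
    proof -
      have "\<alpha> / \<kappa> + 1 = (p - 1) / \<kappa>" using kappa_pos by (simp add: \<kappa>_def field_simps)
      moreover have "w r powr (\<alpha> / \<kappa>) * w r powr 1 = w r powr (\<alpha> / \<kappa> + 1)" by (simp only: powr_add)
      ultimately show ?thesis using wr by simp
    qed
    moreover have "(p - 1) / \<kappa> * y * (\<kappa> / (p - 1) * a - (real N - 1) * \<kappa> / (p - 1) / r * b)
        = a * y - (real N - 1) / r * (y * b)" for y a b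
    proof -
      have "M / K * y * (K / M * a - X * K / M / r * b) = a * y - X / r * (y * b)"
        if "0 < M" "0 < K" for M K X using that by (simp add: right_diff_distrib)
      then show ?thesis using kappa_pos p by simp
    qed
    ultimately have "(p - 1) / \<kappa> * w r powr ((p - 1) / \<kappa> - 1) * S.w' r + (real N - 1) / r * w r powr ((p - 1) / \<kappa>)
        = v r powr m * w r powr (\<alpha> / \<kappa>)" by simp
    then have "p_laplacian p u x = v r powr m * w r powr (\<alpha> / \<kappa>)"
      using u.p_laplacian_f(2)[OF G_pos x False d] by (simp add: dim G_power r_def)
    also have "\<dots> = npow (V x) m * npow (norm (grad u x)) \<alpha>"
      using m wr norm_grad[OF x False] by (auto simp: npow_def V_def r_def powr_powr \<rho>_def)
    finally show ?thesis using u.p_laplacian_f(1)[OF G_pos x False d] by simp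
  next
    case True
    define L where "L = (if (0 + 1) * ((p - 1) / \<kappa>) = 1 then S.w_coeff powr ((p - 1) / \<kappa>) else 0)"
    have "1 \<le> (0 + 1) * ((p - 1) / \<kappa>)" using alpha kappa_pos by (simp add: \<kappa>_def)
    from power_asymptotics(1)[OF S.R_pos S.w_pos S.w_asymptotics S.w_coeff_pos this]
    have "((\<lambda>r. ?G r powr (p - 1) / r) \<longlongrightarrow> L) (at_right 0)" unfolding G_power L_def .
    note lap = u.p_laplacian_f_at_0[OF G_pos this]
    have "real N * L = npow (v 0) m * npow 0 \<alpha>"
    proof (cases "\<alpha> = 0")
      case True
      then have k: "\<kappa> = p - 1" unfolding \<kappa>_def by simp
      have "S.w_coeff = v 0 powr m / real N" unfolding S.w_coeff_def using k p by simp
      moreover have "L = S.w_coeff" unfolding L_def using k p S.w_coeff_pos by simp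
      ultimately have "real N * L = v 0 powr m" using N by simp
      then show ?thesis using m True unfolding npow_def by simp
    next
      case False
      then have "(0 + 1) * ((p - 1) / \<kappa>) \<noteq> 1" using kappa_pos by (simp add: \<kappa>_def)
      then have "L = 0" unfolding L_def by (rule if_not_P)
      then show ?thesis using False by (simp add: npow_def)
    qed
    then show ?thesis using lap True S.R_pos u.grad_f[of 0] by (simp add: dim V_def)
  qed
  have H_power: "?H r powr (p - 1) = z r" if "0 < r" "r < R" for r
    using S.z_pos[OF that] p by (simp add: powr_powr \<tau>_def)
  have V_eq: "p_flux p V differentiable (at x) \<and>
      p_laplacian p V x = npow (V x) \<beta> * npow (norm (grad u x)) q" if x: "x \<in> ball 0 R" for x
  proof (cases "x = 0")
    case False
    define r where "r = norm x"
    have r: "0 < r" "r < R" using False x by (auto simp: r_def)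
    note wr = S.w_pos[OF r] and vr = S.v_pos[OF r]
    have d: "((\<lambda>r. ?H r powr (p - 1)) has_real_derivative S.z' r) (at (norm x))"
      unfolding r_def[symmetric]
      by (rule has_field_derivative_transform_within_open[OF S.dz[OF r], of "{0<..<R}"])
        (use r H_power in auto)
    have "p_laplacian p V x = v r powr \<beta> * w r powr (q / \<kappa>)"
      using V.p_laplacian_f(2)[OF H_pos x False d] H_power[OF r] by (simp add: dim r_def)
    also have "\<dots> = npow (V x) \<beta> * npow (norm (grad u x)) q"
      using q wr vr norm_grad[OF x False] by (auto simp: npow_def V_def r_def powr_powr \<rho>_def)
    finally show ?thesis using V.p_laplacian_f(1)[OF H_pos x False d] by simp
  next
    case True
    have e: "1 \<le> (q / \<kappa> + 1) * 1" "(q / \<kappa> + 1) * 1 \<noteq> 1" using q kappa_pos by auto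
    from power_asymptotics(1)[OF S.R_pos S.z_pos S.z_asymptotics S.z_coeff_pos e(1)] e(2)
    have "((\<lambda>r. z r powr 1 / r) \<longlongrightarrow> 0) (at_right 0)" by simp
    moreover have "\<forall>\<^sub>F r in at_right 0. z r powr 1 / r = ?H r powr (p - 1) / r"
      using eventually_at_right_0_less[OF S.R_pos]
    proof eventually_elim
      case (elim r)
      then show ?case using S.z_pos[of r] H_power[of r] by simp
    qed
    ultimately have "((\<lambda>r. ?H r powr (p - 1) / r) \<longlongrightarrow> 0) (at_right 0)"
      by (rule Lim_transform_eventually)
    note lap = V.p_laplacian_f_at_0[OF H_pos this]
    then show ?thesis using True S.R_pos u.grad_f[of 0] q by (simp add: npow_def)
  qed
  have radial: "radial_on S (\<lambda>x::'a. f (norm x))" for f :: "real \<Rightarrow> real" and S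
    by (simp add: radial_on_def)
  have profile: "radial_profile (\<lambda>x::'a. f (norm x)) r = f r" if r0: "0 \<le> r" for f r
  proof -
    obtain x :: 'a where "norm x = r" using vector_choose_size[OF r0] by blast
    then show ?thesis using radial_profile_eq[OF radial, of x UNIV f] by simp
  qed
  have nonconst: "\<not> u constant_on W \<and> \<not> V constant_on W" if "open W" "0 \<in> W" "W \<subseteq> ball 0 R" for W
  proof
    have "\<exists>D. (U has_real_derivative D) (at r) \<and> 0 < D" "\<exists>D. (v has_real_derivative D) (at r) \<and> 0 < D"
      if r: "0 < r" "r < R" for r
      using conjI[OF dU[OF r]] conjI[OF S.dv[OF r]] S.w_pos[OF r] S.z_pos[OF r] by fastforce+
    then show "\<not> u constant_on W" "\<not> V constant_on W"
      using that not_constant_of_increasing_profile[of R u U W] not_constant_of_increasing_profile[of R V v W]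
      by (simp_all add: u_def V_def)
  qed
  have "nonconst_pos_radial_sol p m q \<alpha> \<beta> (ball 0 R) u V"
    unfolding nonconst_pos_radial_sol_def
    using u_reg V_reg pos radial u_eq V_eq nonconst unfolding u_def V_def by simp
  moreover have "(radial_profile u has_real_derivative w r powr (1 / \<kappa>)) (at r)" if "0 < r" "r < R" for r
    using has_field_derivative_transform_within_open[OF dU[OF that], of "{0<..<R}" "radial_profile u"] that
    by (simp add: profile u_def \<rho>_def)
  ultimately show ?thesis
    by (intro exI[of _ u] exI[of _ V]) (simp add: profile V_def)
qed

end

section \<open>From the ball to the radial system\<close>

lemma GDERIV_grad:
  assumes "f differentiable (at x)"
  shows "GDERIV f x :> grad f (x::'a::euclidean_space)"
proof -
  from assms obtain f' where f': "(f has_derivative f') (at x)" unfolding differentiable_def by blast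
  then have lin: "linear f'" by (rule has_derivative_linear)
  have "f' h = h \<bullet> (\<Sum>b\<in>Basis. f' b *\<^sub>R b)" for h
  proof -
    have "f' h = f' (\<Sum>b\<in>Basis. (h \<bullet> b) *\<^sub>R b)" by (simp add: euclidean_representation)
    also have "\<dots> = (\<Sum>b\<in>Basis. (h \<bullet> b) * f' b)" by (simp add: linear_sum[OF lin] linear_scale[OF lin])
    finally show ?thesis by (simp add: inner_sum_right mult.commute)
  qed
  then have "f' = (\<lambda>h. h \<bullet> (\<Sum>b\<in>Basis. f' b *\<^sub>R b))" by (rule ext)
  then have g: "GDERIV f x :> (\<Sum>b\<in>Basis. f' b *\<^sub>R b)"
    using f' unfolding gderiv_def by simp
  then show ?thesis unfolding grad_eqI[OF g] .
qed

text \<open>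
  The unit vector \<open>e\<close> fixes a line through the origin; restricted to it, gradient and flux of a radial
  function become the scalar functions \<open>slope\<close> and \<open>flux\<close>.
\<close>

locale radial_flux =
  fixes R p :: real and f :: "'a::euclidean_space \<Rightarrow> real" and e :: 'a
  assumes R_pos: "0 < R" and radial: "radial_on (ball 0 R) f" and e: "norm e = 1"
    and diff: "\<And>x. x \<in> ball 0 R \<Longrightarrow> f differentiable (at x)"
    and flux_diff: "\<And>x. x \<in> ball 0 R \<Longrightarrow> p_flux p f differentiable (at x)"
begin

definition "slope r = grad f (r *\<^sub>R e) \<bullet> e"
definition "flux r = npow \<bar>slope r\<bar> (p - 2) * slope r"

lemma in_ball: "\<bar>r\<bar> < R \<Longrightarrow> r *\<^sub>R e \<in> ball 0 R"
  using e by simp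

lemma profile: "x \<in> ball 0 R \<Longrightarrow> f x = radial_profile f (norm x)"
  using radial_profile_eq[OF radial, of x] by simp

lemma profile_along_e:
  assumes "0 \<le> r" "r < R"
  shows "radial_profile f r = f (r *\<^sub>R e)"
  using profile[OF in_ball, of r] assms e by simp

lemma profile_has_derivative:
  assumes r: "0 < r" "r < R"
  shows "(radial_profile f has_real_derivative slope r) (at r)"
proof -
  have "(f has_derivative (\<lambda>h. h \<bullet> grad f (r *\<^sub>R e))) (at (r *\<^sub>R e))"
    using GDERIV_grad[OF diff[OF in_ball]] r unfolding gderiv_def by simp
  moreover have "((\<lambda>t. t *\<^sub>R e) has_derivative (\<lambda>t. t *\<^sub>R e)) (at r)"
    by (auto intro!: derivative_eq_intros)
  ultimately have "((\<lambda>t. f (t *\<^sub>R e)) has_derivative (\<lambda>t. t *\<^sub>R e \<bullet> grad f (r *\<^sub>R e))) (at r)"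
    by (intro has_derivative_compose[where f = "\<lambda>t. t *\<^sub>R e" and g = f])
  then have "((\<lambda>t. f (t *\<^sub>R e)) has_derivative (\<lambda>t. t * slope r)) (at r)"
    by (simp add: slope_def inner_commute)
  then have "((\<lambda>t. f (t *\<^sub>R e)) has_real_derivative slope r) (at r)"
    by (simp add: has_field_derivative_def mult.commute[of _ "slope r"])
  then show ?thesis
    by (rule has_field_derivative_transform_within_open[of _ _ _ "{0<..<R}"])
      (use r profile_along_e in auto)
qed

lemma profile_tendsto_at_0: "(radial_profile f \<longlongrightarrow> f 0) (at_right 0)"
proof -
  have "isCont f 0" using diff[of 0] R_pos by (simp add: differentiable_imp_continuous_within)
  moreover have "((\<lambda>r. r *\<^sub>R e) \<longlongrightarrow> 0 *\<^sub>R e) (at_right 0)" by (intro tendsto_intros)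
  ultimately have "((\<lambda>r. f (r *\<^sub>R e)) \<longlongrightarrow> f 0) (at_right 0)"
    using isCont_tendsto_compose[of 0 f "\<lambda>r. r *\<^sub>R e"] by simp
  moreover have "\<forall>\<^sub>F r in at_right 0. f (r *\<^sub>R e) = radial_profile f r"
    using eventually_at_right_0_less[OF R_pos] by eventually_elim (simp add: profile_along_e)
  ultimately show ?thesis by (rule Lim_transform_eventually)
qed

lemma grad_eq:
  assumes x: "x \<in> ball 0 R" "x \<noteq> 0"
  shows "grad f x = radial_field slope x"
  using x profile_has_derivative[of "norm x"]
  by (intro grad_eqI GDERIV_radial[where \<phi> = "radial_profile f" and R = R] profile) auto

lemma flux_eq:
  assumes x: "x \<in> ball 0 R" "x \<noteq> 0"
  shows "p_flux p f x = radial_field flux x"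
  using x by (simp add: p_flux_def grad_eq[OF x] radial_field_def flux_def)

lemma flux_along_e:
  assumes "0 < r" "r < R"
  shows "p_flux p f (r *\<^sub>R e) = flux r *\<^sub>R e" "p_flux p f ((- r) *\<^sub>R e) = (- flux r) *\<^sub>R e"
proof -
  have "e \<noteq> 0" using e by auto
  then show "p_flux p f (r *\<^sub>R e) = flux r *\<^sub>R e" "p_flux p f ((- r) *\<^sub>R e) = (- flux r) *\<^sub>R e"
    using flux_eq[OF in_ball, of r] flux_eq[OF in_ball, of "- r"] assms e
    by (simp_all add: radial_field_def)
qed

text \<open>
  The flux is odd along the ray and continuous at the origin, hence it vanishes there.
\<close>

lemma flux_tendsto_0: "(flux \<longlongrightarrow> 0) (at_right 0)"
proof -
  have cont: "isCont (p_flux p f) 0"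
    using flux_diff[of 0] R_pos by (simp add: differentiable_imp_continuous_within)
  have lim: "((\<lambda>r. p_flux p f ((s * r) *\<^sub>R e) \<bullet> e) \<longlongrightarrow> p_flux p f 0 \<bullet> e) (at_right 0)" for s
  proof -
    have "((\<lambda>r. (s * r) *\<^sub>R e) \<longlongrightarrow> (s * 0) *\<^sub>R e) (at_right 0)" by (intro tendsto_intros)
    then have "((\<lambda>r. p_flux p f ((s * r) *\<^sub>R e)) \<longlongrightarrow> p_flux p f 0) (at_right 0)"
      using isCont_tendsto_compose[OF cont, of "\<lambda>r. (s * r) *\<^sub>R e"] by simp
    then show ?thesis by (intro tendsto_inner tendsto_const)
  qed
  have ee: "e \<bullet> e = 1" using e by (simp add: dot_square_norm)
  have "\<forall>\<^sub>F r in at_right 0. p_flux p f ((1 * r) *\<^sub>R e) \<bullet> e = flux r"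
    using eventually_at_right_0_less[OF R_pos] by eventually_elim (simp add: flux_along_e ee)
  from Lim_transform_eventually[OF lim this]
  have plus: "(flux \<longlongrightarrow> p_flux p f 0 \<bullet> e) (at_right 0)" .
  have "\<forall>\<^sub>F r in at_right 0. p_flux p f ((- 1 * r) *\<^sub>R e) \<bullet> e = - flux r"
    using eventually_at_right_0_less[OF R_pos]
  proof eventually_elim
    case (elim r)
    then show ?case using flux_along_e(2)[of r] by (simp add: ee)
  qed
  from Lim_transform_eventually[OF lim this]
  have "((\<lambda>r. - (- flux r)) \<longlongrightarrow> - (p_flux p f 0 \<bullet> e)) (at_right 0)" by (rule tendsto_minus)
  then have "p_flux p f 0 \<bullet> e = - (p_flux p f 0 \<bullet> e)"
    using plus by (intro tendsto_unique[of "at_right 0" flux]) auto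
  then show ?thesis using plus by simp
qed

lemma flux_has_derivative:
  assumes r: "0 < r" "r < R"
  shows "(flux has_real_derivative
    p_laplacian p f (r *\<^sub>R e) - (real DIM('a) - 1) / r * flux r) (at r)"
proof -
  let ?x = "r *\<^sub>R e"
  have x: "?x \<in> ball 0 R" "?x \<noteq> 0" "norm ?x = r" using r e in_ball[of r] by auto
  obtain F' where F': "(p_flux p f has_derivative F') (at ?x)"
    using flux_diff[OF x(1)] unfolding differentiable_def by blast
  have "((\<lambda>t. t *\<^sub>R e) has_derivative (\<lambda>t. t *\<^sub>R e)) (at r)" by (auto intro!: derivative_eq_intros)
  from has_derivative_inner_left[OF has_derivative_compose[OF this F'], of e]
  have "((\<lambda>t. p_flux p f (t *\<^sub>R e) \<bullet> e) has_derivative (\<lambda>t. (F' e \<bullet> e) * t)) (at r)"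
    by (simp add: linear_scale[OF has_derivative_linear[OF F']] mult.commute)
  then have "((\<lambda>t. p_flux p f (t *\<^sub>R e) \<bullet> e) has_real_derivative F' e \<bullet> e) (at r)"
    by (simp add: has_field_derivative_def)
  then have d: "(flux has_real_derivative F' e \<bullet> e) (at r)"
    by (rule has_field_derivative_transform_within_open[of _ _ _ "{0<..<R}"])
      (use r e flux_along_e in \<open>auto simp: dot_square_norm\<close>)
  have "(p_flux p f has_derivative blinfun_apply (scaling_plus_projection (flux r / r)
      ((F' e \<bullet> e - flux r / r) / r\<^sup>2) ?x)) (at ?x)"
    by (rule has_derivative_transform_within_open
        [OF radial_field_has_derivative[OF x(2), unfolded x(3), OF d], of "ball 0 R - {0}"])
      (use x flux_eq in \<open>auto simp: open_delete\<close>)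
  from divergence_eq_of_derivative[OF this]
  have "p_laplacian p f ?x = F' e \<bullet> e + (real DIM('a) - 1) / r * flux r"
    unfolding p_laplacian_def x(3) using r by (simp add: diff_divide_distrib left_diff_distrib)
  with d show ?thesis by simp
qed

lemma weighted_flux_has_derivative:
  assumes r: "0 < r" "r < R"
  shows "((\<lambda>r. r powr (real DIM('a) - 1) * flux r) has_real_derivative
    r powr (real DIM('a) - 1) * p_laplacian p f (r *\<^sub>R e)) (at r)"
proof -
  let ?b = "real DIM('a) - 1"
  have "((\<lambda>r. r powr ?b * flux r) has_real_derivative
      ?b * r powr (?b - 1) * flux r + (p_laplacian p f (r *\<^sub>R e) - ?b / r * flux r) * r powr ?b) (at r)"
    using r by (intro DERIV_mult has_real_derivative_powr flux_has_derivative) auto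
  moreover have "r powr (?b - 1) = r powr ?b / r" by (simp only: powr_diff powr_one[OF less_imp_le[OF r(1)]])
  moreover have "b * (P / r) * F + (l - b / r * F) * P = P * l" for b P F l
    by (simp add: algebra_simps)
  ultimately show ?thesis by simp
qed

lemma weighted_flux_tendsto_0:
  assumes "2 \<le> DIM('a)"
  shows "((\<lambda>r. r powr (real DIM('a) - 1) * flux r) \<longlongrightarrow> 0) (at_right 0)"
  using tendsto_mult[OF tendsto_powr_zero_at_right flux_tendsto_0, of "real DIM('a) - 1"] assms by simp

lemma weighted_flux_mono:
  assumes "\<And>r. 0 < r \<Longrightarrow> r < R \<Longrightarrow> 0 \<le> p_laplacian p f (r *\<^sub>R e)" and "0 < s" "s \<le> r" "r < R"
  shows "s powr (real DIM('a) - 1) * flux s \<le> r powr (real DIM('a) - 1) * flux r"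
proof (rule DERIV_nonneg_imp_nondecreasing[where f = "\<lambda>r. r powr (real DIM('a) - 1) * flux r", OF assms(3)])
  fix t assume "s \<le> t" "t \<le> r"
  then have t: "0 < t" "t < R" using assms by auto
  have "0 \<le> t powr (real DIM('a) - 1) * p_laplacian p f (t *\<^sub>R e)" using assms(1)[OF t] by simp
  with weighted_flux_has_derivative[OF t]
  show "\<exists>y. ((\<lambda>r. r powr (real DIM('a) - 1) * flux r) has_real_derivative y) (at t) \<and> 0 \<le> y" by blast
qed

lemma flux_nonneg:
  assumes dim: "2 \<le> DIM('a)" and nonneg: "\<And>r. 0 < r \<Longrightarrow> r < R \<Longrightarrow> 0 \<le> p_laplacian p f (r *\<^sub>R e)"
    and r: "0 < r" "r < R"
  shows "0 \<le> flux r"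
proof -
  have "0 \<le> r powr (real DIM('a) - 1) * flux r"
    using nonneg r by (intro limit_at_0_le_of_deriv_nonneg[OF weighted_flux_has_derivative _ weighted_flux_tendsto_0[OF dim] r(1)]) auto
  then show ?thesis using r by (simp add: zero_le_mult_iff)
qed

lemma flux_pos_of_laplacian_pos:
  assumes dim: "2 \<le> DIM('a)" and pos: "\<And>r. 0 < r \<Longrightarrow> r < R \<Longrightarrow> 0 < p_laplacian p f (r *\<^sub>R e)"
    and r: "0 < r" "r < R"
  shows "0 < flux r"
proof -
  let ?F = "\<lambda>r. r powr (real DIM('a) - 1) * flux r"
  \<comment> \<open>Half the radius stands in for the origin, where the weighted flux has a limit but no derivative.\<close>
  have "?F (r / 2) < ?F r"
  proof (rule DERIV_pos_imp_increasing[where f = ?F])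
    fix t assume "r / 2 \<le> t" "t \<le> r"
    then have t: "0 < t" "t < R" using r by auto
    have "0 < t powr (real DIM('a) - 1) * p_laplacian p f (t *\<^sub>R e)" using pos[OF t] t by simp
    with weighted_flux_has_derivative[OF t]
    show "\<exists>y. (?F has_real_derivative y) (at t) \<and> 0 < y" by blast
  qed (use r in simp)
  moreover have "0 \<le> ?F (r / 2)"
    using flux_nonneg[OF dim less_imp_le[OF pos], of "r / 2"] r by simp
  ultimately have "0 < ?F r" by linarith
  then show ?thesis using r by (simp add: zero_less_mult_iff)
qed

lemma slope_eq_0_of_flux_eq_0: "flux r = 0 \<Longrightarrow> slope r = 0"
  by (auto simp: flux_def npow_def split: if_splits)

text \<open>
  The weighted flux is nondecreasing and starts from \<open>0\<close>. If it vanished at some \<open>r > 0\<close>, it would vanish on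
  \<open>(0,r]\<close>, and the function would be constant on the ball of radius \<open>r\<close>.
\<close>

lemma flux_pos_of_nonconstant:
  assumes dim: "2 \<le> DIM('a)" and nonneg: "\<And>r. 0 < r \<Longrightarrow> r < R \<Longrightarrow> 0 \<le> p_laplacian p f (r *\<^sub>R e)"
    and nonconst: "\<And>d. 0 < d \<Longrightarrow> d < R \<Longrightarrow> \<not> f constant_on ball 0 d"
    and r: "0 < r" "r < R"
  shows "0 < flux r"
proof (rule ccontr)
  assume "\<not> 0 < flux r"
  then have "flux r = 0" using flux_nonneg[OF dim nonneg r] by simp
  have "slope s = 0" if s: "0 < s" "s < r" for s
  proof (rule slope_eq_0_of_flux_eq_0)
    have "s powr (real DIM('a) - 1) * flux s \<le> 0"
      using weighted_flux_mono[OF nonneg s(1), of r] s r \<open>flux r = 0\<close> by simp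
    then have "flux s \<le> 0" using s by (simp add: mult_le_0_iff)
    then show "flux s = 0" using flux_nonneg[OF dim nonneg, of s] s r by simp
  qed
  then have d0: "(radial_profile f has_real_derivative 0) (at s)" if "0 < s" "s < r" for s
    using profile_has_derivative[of s] that r by simp
  have const: "radial_profile f s = radial_profile f (r / 2)" if "0 < s" "s < r" for s
    by (rule DERIV_isconst3[of 0 r]) (use that r d0 in auto)
  then have prof: "f x = radial_profile f (r / 2)" if "x \<in> ball 0 r" "x \<noteq> 0" for x
  proof -
    have "f x = radial_profile f (norm x)" using that r by (intro profile) simp
    also have "\<dots> = radial_profile f (r / 2)" using that by (intro const) simp_all
    finally show ?thesis .
  qed
  have "f 0 = radial_profile f (r / 2)"
  proof (rule tendsto_unique[OF _ profile_tendsto_at_0])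
    show "(radial_profile f \<longlongrightarrow> radial_profile f (r / 2)) (at_right 0)"
    proof (rule Lim_transform_eventually[OF tendsto_const])
      show "\<forall>\<^sub>F s in at_right 0. radial_profile f (r / 2) = radial_profile f s"
        using eventually_at_right_0_less[OF r(1)]
        by eventually_elim (rule const[symmetric], simp_all)
    qed
  qed simp
  with prof have "f x = radial_profile f (r / 2)" if "x \<in> ball 0 r" for x
    using that by (cases "x = 0") simp_all
  then have "f constant_on ball 0 r" unfolding constant_on_def by blast
  with nonconst[OF r] show False by simp
qed

lemma slope_pos: "0 < flux r \<Longrightarrow> 0 < slope r"
  by (auto simp: flux_def npow_def zero_less_mult_iff split: if_splits)

lemma flux_eq_slope_power: "0 < flux r \<Longrightarrow> flux r = slope r powr (p - 1)"
  using slope_pos[of r] by (auto simp: flux_def npow_def powr_diff power2_eq_square)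

end

context elliptic_system
begin

text \<open>
  The equation for \<open>u\<close> has the factor \<open>|\<nabla>u|\<^sup>\<alpha>\<close>, so that the sign of \<open>u'\<close> has to come from non-constancy. The
  equation for \<open>v\<close> has then a positive right-hand side. Passing from the flux of \<open>u\<close> to its power
  \<open>w = (u')\<^sup>\<kappa>\<close> removes the factor \<open>(u')\<^sup>\<alpha>\<close> and makes the first equation linear in \<open>w\<close>.
\<close>

theorem radial_sol_of_pde_solution:
  fixes u V :: "'a::euclidean_space \<Rightarrow> real"
  assumes sol: "nonconst_pos_radial_sol p m q \<alpha> \<beta> (ball 0 R) u V"
    and R: "0 < R" and dim: "DIM('a) = N"
  shows "\<exists>w z. radial_sol R w z (radial_profile V) \<and>
    (\<forall>r. 0 < r \<and> r < R \<longrightarrow> (radial_profile u has_real_derivative w r powr (1 / \<kappa>)) (at r))"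
proof -
  obtain e :: 'a where e: "norm e = 1" using nonempty_Basis norm_Basis by blast
  have reg: "f differentiable (at x)" if "solution_regularity p q \<alpha> (ball 0 R) f" "x \<in> ball 0 R"
    for f and x :: 'a
    using that unfolding solution_regularity_def C2_on_def C1_on_def by (auto split: if_splits)
  have regular: "solution_regularity p q \<alpha> (ball 0 R) u" "solution_regularity p q \<alpha> (ball 0 R) V"
    and radial: "radial_on (ball 0 R) u" "radial_on (ball 0 R) V"
    and Vpos: "\<And>x. x \<in> ball 0 R \<Longrightarrow> 0 < V x"
    and u_nonconst: "\<And>W. open W \<Longrightarrow> 0 \<in> W \<Longrightarrow> W \<subseteq> ball 0 R \<Longrightarrow> \<not> u constant_on W"
    and flux_diff: "\<And>x. x \<in> ball 0 R \<Longrightarrow> p_flux p u differentiable (at x)"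
      "\<And>x. x \<in> ball 0 R \<Longrightarrow> p_flux p V differentiable (at x)"
    and pde: "\<And>x. x \<in> ball 0 R \<Longrightarrow> p_laplacian p u x = npow (V x) m * npow (norm (grad u x)) \<alpha>"
      "\<And>x. x \<in> ball 0 R \<Longrightarrow> p_laplacian p V x = npow (V x) \<beta> * npow (norm (grad u x)) q"
    using sol unfolding nonconst_pos_radial_sol_def by blast+
  interpret u: radial_flux R p u e
    by (rule radial_flux.intro[OF R radial(1) e reg[OF regular(1)] flux_diff(1)])
  interpret V: radial_flux R p V e
    by (rule radial_flux.intro[OF R radial(2) e reg[OF regular(2)] flux_diff(2)])
  have dim2: "2 \<le> DIM('a)" using N dim by simp
  have nonconst: "\<not> u constant_on ball 0 d" if "0 < d" "d < R" for d
    using that by (intro u_nonconst) (auto simp: subset_ball)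
  have lap_u: "p_laplacian p u (r *\<^sub>R e) = radial_profile V r powr m * npow \<bar>u.slope r\<bar> \<alpha>"
    if r: "0 < r" "r < R" for r
  proof -
    have x: "r *\<^sub>R e \<in> ball 0 R" "r *\<^sub>R e \<noteq> 0" using u.in_ball[of r] r e by auto
    have "norm (grad u (r *\<^sub>R e)) = \<bar>u.slope r\<bar>"
      using u.grad_eq[OF x] r e by (simp add: radial_field_def)
    then show ?thesis using pde(1)[OF x(1)] V.profile_along_e[of r] r m by (simp add: npow_def)
  qed
  have flux_u: "0 < u.flux r" if "0 < r" "r < R" for r
    using u.flux_pos_of_nonconstant[OF dim2 _ nonconst that] lap_u by (simp add: npow_def)
  note slope_u = u.slope_pos[OF flux_u]
  have lap_V: "p_laplacian p V (r *\<^sub>R e) = radial_profile V r powr \<beta> * u.slope r powr q"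
    if r: "0 < r" "r < R" for r
  proof -
    have x: "r *\<^sub>R e \<in> ball 0 R" "r *\<^sub>R e \<noteq> 0" using u.in_ball[of r] r e by auto
    have "norm (grad u (r *\<^sub>R e)) = u.slope r"
      using u.grad_eq[OF x] r e slope_u[OF r] by (simp add: radial_field_def)
    moreover have "npow (V (r *\<^sub>R e)) \<beta> = V (r *\<^sub>R e) powr \<beta>"
      using Vpos[OF x(1)] by (simp add: npow_def)
    ultimately show ?thesis using pde(2)[OF x(1)] V.profile_along_e[of r] r q by (simp add: npow_def)
  qed
  have v_pos: "0 < radial_profile V r" if "0 \<le> r" "r < R" for r
    using V.profile_along_e[OF that] Vpos[OF V.in_ball[of r]] that by simp
  have "0 < p_laplacian p V (r *\<^sub>R e)" if "0 < r" "r < R" for r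
    using lap_V[OF that] v_pos[of r] slope_u[OF that] that by simp
  then have flux_V: "0 < V.flux r" if "0 < r" "r < R" for r
    by (rule V.flux_pos_of_laplacian_pos[OF dim2 _ that])
  note slope_V = V.slope_pos[OF flux_V]
  define w where "w = (\<lambda>r. u.flux r powr (\<kappa> / (p - 1)))"
  have w_slope: "w r = u.slope r powr \<kappa>" if "0 < r" "r < R" for r
    using u.flux_eq_slope_power[OF flux_u[OF that]] p by (simp add: w_def powr_powr)
  have "radial_sol R w V.flux (radial_profile V)"
  proof (rule radial_solution.intro[OF radial_system_axioms], rule radial_solution_axioms.intro)
    show "0 < R" by (rule R)
    show "0 < radial_profile V 0" using v_pos R by simp
    show "(radial_profile V \<longlongrightarrow> radial_profile V 0) (at_right 0)"
      using V.profile_tendsto_at_0 V.profile_along_e[of 0] R by simp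
    show "(V.flux \<longlongrightarrow> 0) (at_right 0)" by (rule V.flux_tendsto_0)
    show "(w \<longlongrightarrow> 0) (at_right 0)" unfolding w_def
    proof (rule tendsto_zero_powrI[OF u.flux_tendsto_0 tendsto_const])
      show "\<forall>\<^sub>F r in at_right 0. 0 \<le> u.flux r"
        using eventually_at_right_0_less[OF R] by eventually_elim (simp add: less_imp_le flux_u)
    qed (use kappa_pos p in simp)
  next
    fix r assume r: "0 < r" "r < R"
    show "0 < w r" using flux_u[OF r] by (simp add: w_def)
    show "0 < V.flux r" by (rule flux_V[OF r])
    show "0 < radial_profile V r" using v_pos r by simp
    show "(V.flux has_real_derivative
        radial_profile V r powr \<beta> * w r powr (q / \<kappa>) - (real N - 1) / r * V.flux r) (at r)"
      using V.flux_has_derivative[OF r] kappa_pos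
      by (simp add: lap_V[OF r] w_slope[OF r] powr_powr dim)
    show "(radial_profile V has_real_derivative V.flux r powr (1 / (p - 1))) (at r)"
      using V.profile_has_derivative[OF r] V.flux_eq_slope_power[OF flux_V[OF r]] slope_V[OF r] p
      by (simp add: powr_powr)
    have "(w has_real_derivative \<kappa> / (p - 1) * u.flux r powr (\<kappa> / (p - 1) - 1) *
        (p_laplacian p u (r *\<^sub>R e) - (real DIM('a) - 1) / r * u.flux r)) (at r)"
      unfolding w_def
      using DERIV_fun_powr[OF u.flux_has_derivative[OF r] flux_u[OF r], of "\<kappa> / (p - 1)"]
      by (simp only: of_nat_1)
    moreover have "u.flux r powr (\<kappa> / (p - 1) - 1) * p_laplacian p u (r *\<^sub>R e) = radial_profile V r powr m"
    proof -
      have "u.flux r powr (\<kappa> / (p - 1) - 1) = u.slope r powr ((p - 1) * (\<kappa> / (p - 1) - 1))"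
        using u.flux_eq_slope_power[OF flux_u[OF r]] by (simp add: powr_powr)
      also have "(p - 1) * (\<kappa> / (p - 1) - 1) = - \<alpha>" using p by (simp add: \<kappa>_def field_simps)
      finally have "u.flux r powr (\<kappa> / (p - 1) - 1) = u.slope r powr (- \<alpha>)" .
      moreover have "npow \<bar>u.slope r\<bar> \<alpha> = u.slope r powr \<alpha>"
        using slope_u[OF r] by (simp add: npow_def)
      moreover have "u.slope r powr (- \<alpha>) * u.slope r powr \<alpha> = 1"
        using slope_u[OF r] by (simp flip: powr_add)
      ultimately show ?thesis by (simp add: lap_u[OF r])
    qed
    moreover have "u.flux r powr (\<kappa> / (p - 1) - 1) * u.flux r = w r"
      using flux_u[OF r] by (simp add: w_def powr_diff)
    moreover have "\<kappa> / (p - 1) * F * (a - (real N - 1) / r * b)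
        = \<kappa> / (p - 1) * (F * a) - (real N - 1) * \<kappa> / (p - 1) / r * (F * b)" for F a b
      by (simp add: algebra_simps)
    ultimately show "(w has_real_derivative \<kappa> / (p - 1) * radial_profile V r powr m
        - (real N - 1) * \<kappa> / (p - 1) / r * w r) (at r)"
      by (simp only: dim)
  qed
  moreover have "(radial_profile u has_real_derivative w r powr (1 / \<kappa>)) (at r)" if "0 < r" "r < R" for r
    using u.profile_has_derivative[OF that] slope_u[OF that] w_slope[OF that] kappa_pos
    by (simp add: powr_powr)
  ultimately show ?thesis by blast
qed

end

section \<open>Classification of the boundary behaviour\<close>

lemma increasing_bounded_has_left_limit:
  fixes f :: "real \<Rightarrow> real"
  assumes R: "0 < R" and mono: "\<And>s r. 0 < s \<Longrightarrow> s \<le> r \<Longrightarrow> r < R \<Longrightarrow> f s \<le> f r"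
    and M: "\<And>r. 0 < r \<Longrightarrow> r < R \<Longrightarrow> f r \<le> M"
  shows "\<exists>L. (f \<longlongrightarrow> L) (at_left R)"
proof -
  have "(f \<longlongrightarrow> Sup (f ` ({..<R} \<inter> {0<..}))) (at R within ({..<R} \<inter> {0<..}))"
    by (rule Lim_left_bound) (use mono M in auto)
  moreover have "at R within ({..<R} \<inter> {0<..}) = at_left R"
    by (rule at_within_nhd[of _ "{0<..}"]) (use R in auto)
  ultimately show ?thesis by auto
qed

lemma not_at_top_of_bounded:
  fixes f :: "real \<Rightarrow> real"
  assumes R: "0 < R" and M: "\<And>r. 0 < r \<Longrightarrow> r < R \<Longrightarrow> f r \<le> M"
  shows "\<not> filterlim f at_top (at_left R)"
proof
  assume "filterlim f at_top (at_left R)"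
  then have "\<forall>\<^sub>F r in at_left R. M + 1 \<le> f r" unfolding filterlim_at_top by blast
  moreover have "\<forall>\<^sub>F r in at_left R. 0 < r \<and> r < R" unfolding eventually_at_left_field using R by auto
  ultimately have "\<forall>\<^sub>F r in at_left R. False" by eventually_elim (use M in force)
  then show False by simp
qed

lemma increasing_le_left_limit:
  fixes f :: "real \<Rightarrow> real"
  assumes R: "0 < R" and mono: "\<And>s r. 0 < s \<Longrightarrow> s \<le> r \<Longrightarrow> r < R \<Longrightarrow> f s \<le> f r"
    and lim: "(f \<longlongrightarrow> L) (at_left R)" and r: "0 < r" "r < R"
  shows "f r \<le> L"
proof (rule tendsto_lowerbound[OF lim])
  show "\<forall>\<^sub>F s in at_left R. f r \<le> f s"
    unfolding eventually_at_left_field using r mono[of r] by (intro exI[of _ r]) auto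
qed simp

context elliptic_system
begin

lemma rho_pos: "0 < 1 / \<kappa>" using kappa_pos by simp

text \<open>
  The alternatives for a single solution. Together with the existence of a solution with \<open>v = \<infinity>\<close> at the
  boundary for \<open>\<Theta> > 1\<close> they imply the classification by propositional reasoning.
\<close>

theorem boundary_behaviour:
  fixes u V :: "'a::euclidean_space \<Rightarrow> real"
  assumes sol: "nonconst_pos_radial_sol p m q \<alpha> \<beta> (ball 0 R) u V"
    and R: "0 < R" and dim: "DIM('a) = N"
  shows "finite_at_boundary R V \<Longrightarrow> \<not> infinite_at_boundary R u"
    and "critical_exp \<le> 1 \<Longrightarrow> bounded (u ` ball 0 R) \<and> bounded (V ` ball 0 R)"
    and "infinite_at_boundary R V \<Longrightarrow> 1 < critical_exp"
    and "infinite_at_boundary R V \<Longrightarrow> 1 / \<kappa> < critical_exp - 1 \<Longrightarrow>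
      finite_at_boundary R u \<and> \<not> infinite_at_boundary R u"
    and "infinite_at_boundary R V \<Longrightarrow> \<not> 1 / \<kappa> < critical_exp - 1 \<Longrightarrow>
      infinite_at_boundary R u \<and> \<not> finite_at_boundary R u"
    and "infinite_at_boundary R V \<Longrightarrow> \<not> bounded (V ` ball 0 R)"
proof -
  obtain w z where rs: "radial_sol R w z (radial_profile V)"
    and dU: "\<And>r. 0 < r \<Longrightarrow> r < R \<Longrightarrow> (radial_profile u has_real_derivative w r powr (1 / \<kappa>)) (at r)"
    using radial_sol_of_pde_solution[OF sol R dim] by blast
  interpret S: radial_solution "(real N - 1) * \<kappa> / (p - 1)" "real N - 1" "\<kappa> / (p - 1)" m \<beta> "q / \<kappa>" p R w z
    "radial_profile V" by (rule rs)
  note U_mono = S.primitive_mono[OF dU rho_pos]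
  note infinite_def = infinite_at_boundary_def
  have u_bounded: "\<exists>M. \<forall>r. 0 < r \<and> r < R \<longrightarrow> radial_profile u r \<le> M"
    if "\<exists>M. \<forall>r. 0 < r \<and> r < R \<longrightarrow> w r \<le> M"
    using that S.primitive_bounded_of_w_bounded[OF dU rho_pos] by blast
  have profile: "f x = radial_profile f (norm x)" if "radial_on (ball 0 R) f" "x \<in> ball 0 R"
    for f :: "'a \<Rightarrow> real" and x using radial_profile_eq[OF that(1), of x] that(2) by simp
  have image_bounded: "bounded (f ` ball 0 R)"
    if f: "radial_on (ball 0 R) f" "\<And>x. x \<in> ball 0 R \<Longrightarrow> 0 < f x"
      and M: "\<exists>M. \<forall>r. 0 < r \<and> r < R \<longrightarrow> radial_profile f r \<le> M" for f :: "'a \<Rightarrow> real"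
  proof -
    from M obtain M where M: "\<And>r. 0 < r \<Longrightarrow> r < R \<Longrightarrow> radial_profile f r \<le> M" by blast
    have "norm (f x) \<le> max M (f 0)" if x: "x \<in> ball 0 R" for x
      using profile[OF f(1) x] M[of "norm x"] f(2)[OF x] x by (cases "x = 0") auto
    then show ?thesis unfolding bounded_iff by blast
  qed
  have pos: "0 < u x" "0 < V x" if "x \<in> ball 0 R" for x
    using sol that unfolding nonconst_pos_radial_sol_def by blast+
  have radial: "radial_on (ball 0 R) u" "radial_on (ball 0 R) V"
    using sol unfolding nonconst_pos_radial_sol_def by blast+
  show "\<not> infinite_at_boundary R u" if h: "finite_at_boundary R V"
  proof -
    from h obtain L where "(radial_profile V \<longlongrightarrow> L) (at_left R)" unfolding finite_at_boundary_def by blast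
    from increasing_le_left_limit[OF R S.v_mono this] S.w_bounded_of_v_bounded u_bounded
    have "\<exists>M. \<forall>r. 0 < r \<and> r < R \<longrightarrow> radial_profile u r \<le> M" by blast
    then show ?thesis unfolding infinite_def using not_at_top_of_bounded[OF R] by blast
  qed
  have subcritical: "\<exists>M. \<forall>r. 0 < r \<and> r < R \<longrightarrow> radial_profile V r \<le> M" if "critical_exp \<le> 1"
    using S.w_bounded_of_critical_exp_le_1[OF that] S.v_bounded_of_w_bounded by blast
  show "bounded (u ` ball 0 R) \<and> bounded (V ` ball 0 R)" if "critical_exp \<le> 1"
    using image_bounded[OF radial(1) pos(1) u_bounded[OF S.w_bounded_of_critical_exp_le_1[OF that]]]
      image_bounded[OF radial(2) pos(2) subcritical[OF that]] by blast
  show "1 < critical_exp" if "infinite_at_boundary R V"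
    using that subcritical not_at_top_of_bounded[OF R] unfolding infinite_def by (meson not_le)
  show "finite_at_boundary R u \<and> \<not> infinite_at_boundary R u" if h: "1 / \<kappa> < critical_exp - 1"
  proof -
    obtain M where M: "\<And>r. 0 < r \<Longrightarrow> r < R \<Longrightarrow> radial_profile u r \<le> M"
      using S.primitive_bounded_of_large_critical_exp[OF dU rho_pos h] by blast
    show ?thesis unfolding finite_at_boundary_def infinite_def
      using increasing_bounded_has_left_limit[of R "radial_profile u", OF R U_mono M]
        not_at_top_of_bounded[of R "radial_profile u", OF R M] by blast
  qed
  show "infinite_at_boundary R u \<and> \<not> finite_at_boundary R u"
    if "infinite_at_boundary R V" "\<not> 1 / \<kappa> < critical_exp - 1"
  proof -
    have inf: "filterlim (radial_profile u) at_top (at_left R)"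
      using S.primitive_unbounded[OF dU rho_pos] that unfolding infinite_def by simp
    then show ?thesis unfolding finite_at_boundary_def infinite_def
      using not_tendsto_and_filterlim_at_infinity[OF _ _ filterlim_at_top_imp_at_infinity[OF inf]] by auto
  qed
  show "\<not> bounded (V ` ball 0 R)" if "infinite_at_boundary R V"
  proof
    assume "bounded (V ` ball 0 R)"
    then obtain M where M: "\<And>x. x \<in> ball 0 R \<Longrightarrow> norm (V x) \<le> M" unfolding bounded_iff by blast
    have "radial_profile V r \<le> M" if r: "0 < r" "r < R" for r
    proof -
      obtain x :: 'a where x: "norm x = r" using vector_choose_size[OF less_imp_le[OF r(1)]] by blast
      then show ?thesis using profile[OF radial(2), of x] M[of x] r by simp
    qed
    then show False using that not_at_top_of_bounded[OF R] unfolding infinite_def by blast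
  qed
qed

theorem exists_large_solution:
  assumes crit: "1 < critical_exp" and R: "0 < R" and dim: "DIM('a::euclidean_space) = N"
  shows "\<exists>(u :: 'a \<Rightarrow> real) V. nonconst_pos_radial_sol p m q \<alpha> \<beta> (ball 0 R) u V \<and> infinite_at_boundary R V"
proof -
  obtain w z v where rs: "radial_sol R w z v" and lim: "filterlim v at_top (at_left R)"
    using exists_blowup_solution_at[OF crit R] by blast
  obtain u V :: "'a \<Rightarrow> real" where sol: "nonconst_pos_radial_sol p m q \<alpha> \<beta> (ball 0 R) u V"
    and V: "\<And>r. 0 < r \<Longrightarrow> r < R \<Longrightarrow> radial_profile V r = v r"
    using exists_pde_solution[OF rs dim] by blast
  have "\<forall>\<^sub>F r in at_left R. radial_profile V r = v r"
    unfolding eventually_at_left_field using R V by (intro exI[of _ 0]) auto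
  then have "infinite_at_boundary R V" unfolding infinite_at_boundary_def
    using lim filterlim_cong[OF refl refl, of "radial_profile V" v] by blast
  with sol show ?thesis by blast
qed

end

theorem theorem1p1:
  fixes R p m q \<alpha> \<beta> :: real
    and \<Omega> :: "(real ^ 'n) set"
  assumes "CARD('n) \<ge> 2" and "R > 0" and "\<Omega> = ball 0 R"
    and "1 < p" and "m > 0" and "q > 0"
    and "0 \<le> \<alpha>" and "\<alpha> < p - 1" and "0 \<le> \<beta>" and "\<beta> \<le> m"
    and "(p - 1 - \<alpha>) * (p - 1 - \<beta>) - q * m \<noteq> 0"
  shows
    "(\<not> (\<exists>u v. nonconst_pos_radial_sol p m q \<alpha> \<beta> \<Omega> u v \<and>
              infinite_at_boundary R u \<and> finite_at_boundary R v))
     \<and>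
     ((\<forall>u v. nonconst_pos_radial_sol p m q \<alpha> \<beta> \<Omega> u v \<longrightarrow> bounded (u ` \<Omega>) \<and> bounded (v ` \<Omega>))
        \<longleftrightarrow> m * q < (p - 1 - \<alpha>) * (p - 1 - \<beta>))
     \<and>
     ((\<exists>u v. nonconst_pos_radial_sol p m q \<alpha> \<beta> \<Omega> u v \<and>
             finite_at_boundary R u \<and> infinite_at_boundary R v)
        \<longleftrightarrow> m * q > m * p + (p - \<alpha>) * (p - 1 - \<beta>))
     \<and>
     ((\<exists>u v. nonconst_pos_radial_sol p m q \<alpha> \<beta> \<Omega> u v \<and>
             infinite_at_boundary R u \<and> infinite_at_boundary R v)
        \<longleftrightarrow> (p - 1 - \<alpha>) * (p - 1 - \<beta>) < m * q \<and>
            m * q \<le> m * p + (p - \<alpha>) * (p - 1 - \<beta>))"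
proof -
  interpret elliptic_system "CARD('n)" p m q \<alpha> \<beta>
    using assms by unfold_locales auto
  have dim: "DIM(real ^ 'n) = CARD('n)" by simp
  note R = \<open>R > 0\<close> and \<Omega> = \<open>\<Omega> = ball 0 R\<close>
  let ?sol = "nonconst_pos_radial_sol p m q \<alpha> \<beta> \<Omega>"
  have crit: "1 < critical_exp \<longleftrightarrow> (p - 1 - \<alpha>) * (p - 1 - \<beta>) < m * q"
    unfolding critical_exp_gt_1_iff by (simp only: \<kappa>_def)
  have subcrit: "m * q < (p - 1 - \<alpha>) * (p - 1 - \<beta>) \<longleftrightarrow> \<not> 1 < critical_exp"
    using assms(11) unfolding crit by (auto simp: mult.commute[of q])
  note thr = critical_exp_threshold_iff
  have behaviour: "finite_at_boundary R v \<longrightarrow> \<not> infinite_at_boundary R u"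
    "\<not> 1 < critical_exp \<longrightarrow> bounded (u ` \<Omega>) \<and> bounded (v ` \<Omega>)"
    "infinite_at_boundary R v \<longrightarrow> 1 < critical_exp"
    "infinite_at_boundary R v \<and> 1 / \<kappa> < critical_exp - 1 \<longrightarrow>
      finite_at_boundary R u \<and> \<not> infinite_at_boundary R u"
    "infinite_at_boundary R v \<and> \<not> 1 / \<kappa> < critical_exp - 1 \<longrightarrow>
      infinite_at_boundary R u \<and> \<not> finite_at_boundary R u"
    "infinite_at_boundary R v \<longrightarrow> \<not> bounded (v ` \<Omega>)"
    if "?sol u v" for u v
    using boundary_behaviour[OF that[unfolded \<Omega>] R dim] unfolding \<Omega> by (auto simp: not_less)
  have large: "\<exists>u v. ?sol u v \<and> infinite_at_boundary R v" if "1 < critical_exp"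
    using exists_large_solution[OF that R dim] unfolding \<Omega> .
  have thr_crit: "1 < critical_exp" if "1 / \<kappa> < critical_exp - 1"
    using that rho_pos by linarith
  have i: "\<not> (\<exists>u v. ?sol u v \<and> infinite_at_boundary R u \<and> finite_at_boundary R v)"
    using behaviour(1) by blast
  have ii: "(\<forall>u v. ?sol u v \<longrightarrow> bounded (u ` \<Omega>) \<and> bounded (v ` \<Omega>))
      \<longleftrightarrow> m * q < (p - 1 - \<alpha>) * (p - 1 - \<beta>)"
    unfolding subcrit using behaviour(2,6) large by blast
  have iii: "(\<exists>u v. ?sol u v \<and> finite_at_boundary R u \<and> infinite_at_boundary R v)
      \<longleftrightarrow> m * q > m * p + (p - \<alpha>) * (p - 1 - \<beta>)"
    unfolding thr[symmetric] using behaviour(4,5) large thr_crit by blast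
  have iv: "(\<exists>u v. ?sol u v \<and> infinite_at_boundary R u \<and> infinite_at_boundary R v)
      \<longleftrightarrow> (p - 1 - \<alpha>) * (p - 1 - \<beta>) < m * q \<and> m * q \<le> m * p + (p - \<alpha>) * (p - 1 - \<beta>)"
    unfolding crit[symmetric] not_less[symmetric] thr[symmetric] using behaviour(3,4,5) large by blast
  show ?thesis by (intro conjI i ii iii iv)
qed

end
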